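(* Let $\mathbf{T}=(T_1,\dots,T_n)$ be a commuting tuple of Ritt operators on a Hilbert space $\mathcal{H}$. Then the following assertions are equivalent. 1. Each $T_i$, $1\le i\le n$, is similar to a contraction. 2. For all $1\le k\le n$ and all $1\le i_1<\dots<i_k\le n$, the tuple $(T_{i_1},\dots,T_{i_k})$ admits a joint bounded $H^\infty$-functional calculus. 3. The tuple $\mathbf{T}$ is jointly similar to a commuting $n$-tuple of contractions, i.e. there is an invertible $S\in B(\mathcal{H})$ such that $(ST_1S^{-1},\dots,ST_nS^{-1})$ is a commuting tuple of contractions.
   Context: Write $R(\lambda,T)=(\lambda I-T)^{-1}$. For $\gamma\in(0,\frac{\pi}{2})$ let $\mathcal{B}_\gamma$ be the interior of the convex hull of $1$ and the disc $D(0,\sin\gamma)$, and $\Gamma_{\mathcal{B}_\gamma}$ its boundary, oriented counterclockwise. A bounded operator $T$ is a Ritt operator of type $\alpha\in(0,\frac{\pi}{2})$ if $\sigma(T)\subseteq\overline{\mathcal{B}_\alpha}$ and for every $\beta\in(\alpha,\frac{\pi}{2})$ the set $\{(1-\lambda)R(\lambda,T):\lambda\in\mathbb{C}\setminus\overline{\mathcal{B}_\beta}\}$ is bounded; $T$ is a Ritt operator if it is so for some $\alpha$. $H_0^\infty(\prod_{i=1}^m\mathcal{B}_{\gamma_i})$ is the set of bounded holomorphic $\phi$ on $\prod_i\mathcal{B}_{\gamma_i}$ for which there are $c,s>0$ with $|\phi(\lambda_1,\dots,\lambda_m)|\le c\prod_i|1-\lambda_i|^s$. For a commuting tuple $\mathbf{T}=(T_1,\dots,T_m)$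 with $T_i$ Ritt of type $\alpha_i<\beta_i<\gamma_i<\frac{\pi}{2}$, set $$\phi(\mathbf{T})=\Big(\frac{1}{2\pi i}\Big)^m\int_{\prod_i\Gamma_{\mathcal{B}_{\beta_i}}}\phi(\lambda_1,\dots,\lambda_m)\prod_{i=1}^mR(\lambda_i,T_i)\,d\lambda_i$$ (absolutely convergent, independent of the $\beta_i$). $\mathbf{T}$ admits a joint bounded $H^\infty$-functional calculus if for some $\gamma_i\in(\alpha_i,\frac{\pi}{2})$ there is $C>0$ with $\|\phi(\mathbf{T})\|\le C\sup_{\prod_i\mathcal{B}_{\gamma_i}}|\phi|$ for all $\phi\in H_0^\infty(\prod_i\mathcal{B}_{\gamma_i})$. An operator $T$ is similar to a contraction if $\|STS^{-1}\|\le1$ for some invertible $S\in B(\mathcal{H})$. *)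

theory Defs
  imports "HOL-Complex_Analysis.Complex_Analysis"
begin

section \<open>Complex Hilbert spaces and bounded operators\<close>

text \<open>The inner product is linear in its first argument.\<close>

class complex_hilbert_space = banach +
  fixes scaleC :: "complex \<Rightarrow> 'a \<Rightarrow> 'a" (infixr \<open>*\<^sub>C\<close> 75)
    and cinner :: "'a \<Rightarrow> 'a \<Rightarrow> complex"
  assumes scaleC_of_real: "complex_of_real r *\<^sub>C x = r *\<^sub>R x"
    and scaleC_add_right: "a *\<^sub>C (x + y) = a *\<^sub>C x + a *\<^sub>C y"
    and scaleC_add_left: "(a + b) *\<^sub>C x = a *\<^sub>C x + b *\<^sub>C x"
    and scaleC_scaleC: "a *\<^sub>C (b *\<^sub>C x) = (a * b) *\<^sub>C x"
    and cinner_commute: "cinner y x = cnj (cinner x y)"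
    and cinner_add_left: "cinner (x + y) z = cinner x z + cinner y z"
    and cinner_scaleC_left: "cinner (a *\<^sub>C x) y = a * cinner x y"
    and cinner_self: "cinner x x = complex_of_real ((norm x)\<^sup>2)"

instantiation complex :: complex_hilbert_space
begin
definition scaleC_complex :: "complex \<Rightarrow> complex \<Rightarrow> complex"
  where "scaleC_complex a x = a * x"
definition cinner_complex :: "complex \<Rightarrow> complex \<Rightarrow> complex"
  where "cinner_complex x y = x * cnj y"
instance
  by standard
    (auto simp: scaleC_complex_def cinner_complex_def scaleR_conv_of_real algebra_simps
      complex_norm_square simp del: of_real_power)
end

lemma norm_scaleC: "norm (a *\<^sub>C x) = cmod a * norm x"
  for x :: "'a::complex_hilbert_space"
proof -
  have "cinner (a *\<^sub>C x) (a *\<^sub>C x) = a * cnj (a * cinner x x)"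
    by (metis cinner_commute cinner_scaleC_left)
  also have "\<dots> = complex_of_real ((cmod a * norm x)\<^sup>2)"
    by (simp add: cinner_self power_mult_distrib complex_norm_square[symmetric] mult.assoc[symmetric])
  finally have "(norm (a *\<^sub>C x))\<^sup>2 = (cmod a * norm x)\<^sup>2"
    by (simp only: cinner_self of_real_eq_iff)
  then show ?thesis
    by (simp add: power2_eq_iff_nonneg)
qed

lemma bounded_linear_scaleC: "bounded_linear (\<lambda>x::'a::complex_hilbert_space. a *\<^sub>C x)"
proof (rule bounded_linear_intro[where K = "cmod a"])
  show "a *\<^sub>C (r *\<^sub>R x) = r *\<^sub>R (a *\<^sub>C x)" for r and x :: 'a
    by (simp add: scaleC_of_real[symmetric] scaleC_scaleC mult.commute)
qed (simp_all add: scaleC_add_right norm_scaleC mult.commute)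

text \<open>The type \<open>'a \<Rightarrow>\<^sub>L 'a\<close> consists of the bounded \<^emph>\<open>real\<close>-linear maps; \<open>B(\<H>)\<close> is the
  following subset.\<close>

definition bounded_ops :: "('a::complex_hilbert_space \<Rightarrow>\<^sub>L 'a) set"
  where "bounded_ops = {A. \<forall>c x. blinfun_apply A (c *\<^sub>C x) = c *\<^sub>C blinfun_apply A x}"

lift_definition scale_op :: "complex \<Rightarrow> ('a::complex_hilbert_space \<Rightarrow>\<^sub>L 'a) \<Rightarrow> 'a \<Rightarrow>\<^sub>L 'a"
  is "\<lambda>c f x. c *\<^sub>C f x"
  by (rule bounded_linear_compose[OF bounded_linear_scaleC])

definition op_invertible :: "('a::complex_hilbert_space \<Rightarrow>\<^sub>L 'a) \<Rightarrow> bool"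
  where "op_invertible A \<longleftrightarrow>
    (\<exists>B\<in>bounded_ops. A o\<^sub>L B = id_blinfun \<and> B o\<^sub>L A = id_blinfun)"

definition op_inverse :: "('a::complex_hilbert_space \<Rightarrow>\<^sub>L 'a) \<Rightarrow> 'a \<Rightarrow>\<^sub>L 'a"
  where "op_inverse A =
    (THE B. B \<in> bounded_ops \<and> A o\<^sub>L B = id_blinfun \<and> B o\<^sub>L A = id_blinfun)"

definition op_spectrum :: "('a::complex_hilbert_space \<Rightarrow>\<^sub>L 'a) \<Rightarrow> complex set"
  where "op_spectrum T = {z. \<not> op_invertible (scale_op z id_blinfun - T)}"

definition resolvent :: "complex \<Rightarrow> ('a::complex_hilbert_space \<Rightarrow>\<^sub>L 'a) \<Rightarrow> 'a \<Rightarrow>\<^sub>L 'a"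
  where "resolvent z T = op_inverse (scale_op z id_blinfun - T)"

definition op_commute :: "('a::complex_hilbert_space \<Rightarrow>\<^sub>L 'a) \<Rightarrow> ('a \<Rightarrow>\<^sub>L 'a) \<Rightarrow> bool"
  where "op_commute A B \<longleftrightarrow> A o\<^sub>L B = B o\<^sub>L A"

definition op_conj :: "('a::complex_hilbert_space \<Rightarrow>\<^sub>L 'a) \<Rightarrow> ('a \<Rightarrow>\<^sub>L 'a) \<Rightarrow> 'a \<Rightarrow>\<^sub>L 'a"
  where "op_conj S T = S o\<^sub>L T o\<^sub>L op_inverse S"

definition op_contraction :: "('a::complex_hilbert_space \<Rightarrow>\<^sub>L 'a) \<Rightarrow> bool"
  where "op_contraction T \<longleftrightarrow> norm T \<le> 1"

definition similar_to_contraction :: "('a::complex_hilbert_space \<Rightarrow>\<^sub>L 'a) \<Rightarrow> bool"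
  where "similar_to_contraction T \<longleftrightarrow>
    (\<exists>S\<in>bounded_ops. op_invertible S \<and> op_contraction (op_conj S T))"

section \<open>Stolz domains and Ritt operators\<close>

definition stolz :: "real \<Rightarrow> complex set"
  where "stolz \<gamma> = interior (convex hull (insert 1 (ball 0 (sin \<gamma>))))"

text \<open>The boundary of \<open>stolz \<gamma>\<close>, counterclockwise from \<open>1\<close> to \<open>1\<close>. The two tangents from \<open>1\<close> touch
  the circle of radius \<open>sin \<gamma>\<close> at the points with arguments \<open>\<plusminus>(\<pi>/2 - \<gamma>)\<close>, i.e. at
  \<open>sin \<gamma> (sin \<gamma> \<plusminus> \<i> cos \<gamma>)\<close>.\<close>

definition stolz_boundary :: "real \<Rightarrow> real \<Rightarrow> complex"
  where "stolz_boundary \<gamma> =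
    linepath 1 (of_real (sin \<gamma>) * cis (pi/2 - \<gamma>)) +++
    part_circlepath 0 (sin \<gamma>) (pi/2 - \<gamma>) (3*pi/2 + \<gamma>) +++
    linepath (of_real (sin \<gamma>) * cis (- (pi/2 - \<gamma>))) 1"

definition ritt_of_type :: "real \<Rightarrow> ('a::complex_hilbert_space \<Rightarrow>\<^sub>L 'a) \<Rightarrow> bool"
  where "ritt_of_type \<alpha> T \<longleftrightarrow>
    T \<in> bounded_ops \<and> \<alpha> \<in> {0<..<pi/2} \<and> op_spectrum T \<subseteq> closure (stolz \<alpha>) \<and>
    (\<forall>\<beta>\<in>{\<alpha><..<pi/2}.
      bounded ((\<lambda>z. scale_op (1 - z) (resolvent z T)) ` (- closure (stolz \<beta>))))"

definition ritt :: "('a::complex_hilbert_space \<Rightarrow>\<^sub>L 'a) \<Rightarrow> bool"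
  where "ritt T \<longleftrightarrow> (\<exists>\<alpha>. ritt_of_type \<alpha> T)"

section \<open>The joint functional calculus\<close>

text \<open>Tuples of length \<open>m\<close> are indexed by \<open>{1..m}\<close>; points of \<open>\<complex>\<^sup>m\<close> are extensional functions.\<close>

definition stolz_prod :: "nat \<Rightarrow> (nat \<Rightarrow> real) \<Rightarrow> (nat \<Rightarrow> complex) set"
  where "stolz_prod m \<gamma> = (\<Pi>\<^sub>E i\<in>{1..m}. stolz (\<gamma> i))"

text \<open>Holomorphic functions of several variables: continuous, and holomorphic in each variable
  separately.\<close>

definition holomorphic_on_stolz_prod ::
    "((nat \<Rightarrow> complex) \<Rightarrow> complex) \<Rightarrow> nat \<Rightarrow> (nat \<Rightarrow> real) \<Rightarrow> bool"
  where "holomorphic_on_stolz_prod \<phi> m \<gamma> \<longleftrightarrow>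
    continuous_on (stolz_prod m \<gamma>) \<phi> \<and>
    (\<forall>z\<in>stolz_prod m \<gamma>. \<forall>i\<in>{1..m}. (\<lambda>w. \<phi> (z(i := w))) holomorphic_on stolz (\<gamma> i))"

definition H0_infty :: "nat \<Rightarrow> (nat \<Rightarrow> real) \<Rightarrow> ((nat \<Rightarrow> complex) \<Rightarrow> complex) set"
  where "H0_infty m \<gamma> =
    {\<phi>. holomorphic_on_stolz_prod \<phi> m \<gamma> \<and> bounded (\<phi> ` stolz_prod m \<gamma>) \<and>
      (\<exists>c>0. \<exists>s>0. \<forall>z\<in>stolz_prod m \<gamma>. cmod (\<phi> z) \<le> c * (\<Prod>i=1..m. cmod (1 - z i) powr s))}"

text \<open>The library's Bochner integral requires a second countable range, which \<open>B(\<H>)\<close> is not.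
  This is the same definition as \<open>has_bochner_integral\<close>, without that sort constraint.\<close>

definition has_op_integral :: "'b measure \<Rightarrow> ('b \<Rightarrow> 'c::real_normed_vector) \<Rightarrow> 'c \<Rightarrow> bool"
  where "has_op_integral M f x \<longleftrightarrow>
    f \<in> borel_measurable M \<and>
    (\<exists>s. (\<forall>i. Bochner_Integration.simple_bochner_integrable M (s i)) \<and>
      (\<lambda>i. \<integral>\<^sup>+t. ennreal (norm (f t - s i t)) \<partial>M) \<longlonglongrightarrow> 0 \<and>
      (\<lambda>i. Bochner_Integration.simple_bochner_integral M (s i)) \<longlonglongrightarrow> x)"

definition op_integral :: "'b measure \<Rightarrow> ('b \<Rightarrow> 'c::real_normed_vector) \<Rightarrow> 'c"
  where "op_integral M f = (THE x. has_op_integral M f x)"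

definition resolvent_prod ::
    "nat \<Rightarrow> (nat \<Rightarrow> complex) \<Rightarrow> (nat \<Rightarrow> 'a::complex_hilbert_space \<Rightarrow>\<^sub>L 'a) \<Rightarrow> 'a \<Rightarrow>\<^sub>L 'a"
  where "resolvent_prod m z T =
    foldr (\<lambda>i A. resolvent (z i) (T i) o\<^sub>L A) [1..<Suc m] id_blinfun"

text \<open>The integral over the product of the curves \<open>stolz_boundary (\<beta> i)\<close>, pulled back to the parameter
  cube. The cube is open because \<open>\<phi>\<close> and the resolvents are only meaningful away from \<open>1\<close>, the
  common end point of the curves.\<close>

definition joint_calculus ::
    "nat \<Rightarrow> (nat \<Rightarrow> real) \<Rightarrow> (nat \<Rightarrow> 'a::complex_hilbert_space \<Rightarrow>\<^sub>L 'a) \<Rightarrow>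
      ((nat \<Rightarrow> complex) \<Rightarrow> complex) \<Rightarrow> 'a \<Rightarrow>\<^sub>L 'a"
  where "joint_calculus m \<beta> T \<phi> =
    scale_op ((1 / (2 * of_real pi * \<i>)) ^ m)
      (op_integral (\<Pi>\<^sub>M i\<in>{1..m}. restrict_space lborel {0<..<1::real})
        (\<lambda>t. let z = (\<lambda>i\<in>{1..m}. stolz_boundary (\<beta> i) (t i)) in
          scale_op (\<phi> z * (\<Prod>i=1..m. vector_derivative (stolz_boundary (\<beta> i)) (at (t i))))
            (resolvent_prod m z T)))"

text \<open>The operator \<open>joint_calculus m \<beta> T \<phi>\<close> does not depend on the admissible angles \<open>\<beta>\<close>; the
  estimate is therefore required for all of them.\<close>

definition joint_bounded_calculus ::
    "nat \<Rightarrow> (nat \<Rightarrow> 'a::complex_hilbert_space \<Rightarrow>\<^sub>L 'a) \<Rightarrow> bool"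
  where "joint_bounded_calculus m T \<longleftrightarrow>
    (\<exists>\<alpha> \<gamma>. (\<forall>i\<in>{1..m}. ritt_of_type (\<alpha> i) (T i) \<and> \<gamma> i \<in> {\<alpha> i<..<pi/2}) \<and>
      (\<exists>C>0. \<forall>\<phi>\<in>H0_infty m \<gamma>. \<forall>\<beta>. (\<forall>i\<in>{1..m}. \<beta> i \<in> {\<alpha> i<..<\<gamma> i}) \<longrightarrow>
        norm (joint_calculus m \<beta> T \<phi>) \<le> C * (SUP z\<in>stolz_prod m \<gamma>. cmod (\<phi> z))))"

end

theory Submission
  imports Defs
begin

text \<open>
  All three conditions are equivalent to one about the single operators: each \<open>T = T\<^sub>i\<close> and its adjoint
  satisfy a square function estimate \<open>\<Sum>\<^sub>k (k+1) \<parallel>T\<^sup>k (I - T) x\<parallel>\<^sup>2 \<le> M\<^sup>2 \<parallel>x\<parallel>\<^sup>2\<close>.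

  For a contraction the estimate is an energy argument along the resolvents \<open>(I + n(I - T))\<^sup>-\<^sup>1 x\<close>, and it
  is invariant under similarity. It also follows from a bounded calculus of \<open>T\<close>, applied to signed sums
  \<open>\<Sum>\<^sub>j \<plusminus> 2^j z^(2^j) (1 - z)\<close>, which are bounded on Stolz domains uniformly in the signs.

  Conversely, let \<open>P x\<close> be the limit of \<open>T\<^sup>k x\<close>. The Hilbertian norm
  \<open>\<parallel>P x\<parallel>\<^sup>2 + \<Sum>\<^sub>k (k+1) \<parallel>T\<^sup>k (I - T) x\<parallel>\<^sup>2\<close> makes \<open>T\<close> a contraction and every contraction commuting
  with \<open>T\<close> stays one, so the operators can be treated one after the other; a telescoping sum that pairs the square
  functions of \<open>T\<close> and of its adjoint shows that this norm is equivalent to the original one. The square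
  functions also bound the joint calculus: multiply \<open>\<phi>\<close> by an approximate unit whose terms contain
  \<open>\<Prod>\<^sub>i (z\<^sub>i\<^sup>k (1 - z\<^sub>i))\<^sup>3\<close>. Two of the three factors are moved onto \<open>x\<close> and \<open>y\<close> in \<open>\<langle>\<phi>(T) x, y\<rangle>\<close>, the third
  makes the contour integral small, and the Cauchy-Schwarz inequality sums over all multi-indices.
\<close>

section \<open>Complex Hilbert spaces\<close>

text \<open>A contraction may act isometrically on large subspaces, so the decrease of the norms of
  \<open>T^k x\<close> says nothing about \<open>I - T\<close>. Along the resolvents of
  \<open>I - T\<close> the inequality \<open>Re <(I - T) w, w> >= 0\<close> suffices. The price is
  the return from resolvents to powers, paid with the Ritt estimate
  \<open>(k+1) norm (T^k (I - T)) <= M\<close>. In the renorming, power boundedness and the square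
  function of \<open>T\<close> bound the new norm from above; the square function of the adjoint
  gives the bound from below by duality. The term with \<open>P\<close> is there because the square
  function vanishes on the fixed vectors of \<open>T\<close>. The estimate of the calculus must hold
  for all contour angles at once. Hence every constant is expressed through the outer angle \<gamma>
  and through a resolvent bound at an angle strictly inside all contours. Once their existence is
  settled, operator integrals are tested against vectors \<open>x\<close> and \<open>y\<close>, so
  that Fubini, Cauchy and dominated convergence are used for scalar functions only.\<close>

lemma scaleC_one [simp]: "1 *\<^sub>C x = x"
  for x :: "'a::complex_hilbert_space"
  using scaleC_of_real[of 1 x] by simp

lemma scaleC_minus_one: "(- 1) *\<^sub>C x = - x"
  for x :: "'a::complex_hilbert_space"
  using scaleC_of_real[of "-1" x] by simp

lemma scaleC_zero_right [simp]: "a *\<^sub>C 0 = (0::'a::complex_hilbert_space)"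
  by (metis norm_eq_zero norm_scaleC mult_zero_right)

lemma scaleC_minus_right: "a *\<^sub>C (- x) = - (a *\<^sub>C x)"
  for x :: "'a::complex_hilbert_space"
  by (metis (no_types, opaque_lifting) scaleC_minus_one scaleC_scaleC mult.commute)

lemma scaleC_minus_left: "(- a) *\<^sub>C x = - (a *\<^sub>C x)"
  for x :: "'a::complex_hilbert_space"
  by (metis (no_types, opaque_lifting) scaleC_minus_one scaleC_scaleC mult_minus1)

lemma scaleC_diff_right: "a *\<^sub>C (x - y) = a *\<^sub>C x - a *\<^sub>C y"
  for x :: "'a::complex_hilbert_space"
  by (metis (no_types, lifting) scaleC_add_right scaleC_minus_right uminus_add_conv_diff add.commute)

lemma scaleC_diff_left: "(a - b) *\<^sub>C x = a *\<^sub>C x - b *\<^sub>C x"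
  for x :: "'a::complex_hilbert_space"
  by (metis (no_types, lifting) scaleC_add_left scaleC_minus_left uminus_add_conv_diff add.commute)

lemma cinner_add_right: "cinner x (y + z) = cinner x y + cinner x z"
  for x :: "'a::complex_hilbert_space"
  by (metis cinner_add_left cinner_commute complex_cnj_add)

lemma cinner_scaleC_right: "cinner x (a *\<^sub>C y) = cnj a * cinner x y"
  for x :: "'a::complex_hilbert_space"
  by (metis cinner_scaleC_left cinner_commute complex_cnj_mult)

text \<open>Positive semidefinite Hermitian forms; only the real part of the diagonal has to be mentioned
  because the diagonal is real by symmetry.\<close>

definition psd_form :: "('a::complex_hilbert_space \<Rightarrow> 'a \<Rightarrow> complex) \<Rightarrow> bool"
  where "psd_form f \<longleftrightarrow>
    (\<forall>x y z. f (x + y) z = f x z + f y z) \<and> (\<forall>a x y. f (a *\<^sub>C x) y = a * f x y) \<and>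
    (\<forall>x y. f y x = cnj (f x y)) \<and> (\<forall>x. 0 \<le> Re (f x x))"

lemma psd_form_add_right: "psd_form f \<Longrightarrow> f x (y + z) = f x y + f x z"
  unfolding psd_form_def by (metis complex_cnj_add)

lemma psd_form_scaleC_right: "psd_form f \<Longrightarrow> f x (a *\<^sub>C y) = cnj a * f x y"
  unfolding psd_form_def by (metis complex_cnj_mult)

text \<open>The form may be degenerate, so vectors cannot be normalised. Inserting
  \<open>- t x + u y\<close> with \<open>u = f x y\<close> absorbs the phase of \<open>u\<close> and
  leaves a real quadratic polynomial in \<open>t\<close> that is never negative.\<close>

lemma psd_form_cauchy_schwarz:
  assumes f: "psd_form f"
  shows "(cmod (f x y))\<^sup>2 \<le> Re (f x x) * Re (f y y)"
proof -
  have diag: "f x x = of_real (Re (f x x))" for x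
  proof -
    have "f x x = cnj (f x x)" using f unfolding psd_form_def by blast
    then show ?thesis by (metis Reals_cnj_iff of_real_Re)
  qed
  define u where "u = f x y"
  have fyx: "f y x = cnj u" using f unfolding psd_form_def u_def by blast
  have lin: "f (x + y) z = f x z + f y z" "f (a *\<^sub>C x) y = a * f x y" for a x y z
    using f unfolding psd_form_def by blast+
  have exp: "Re (f (a *\<^sub>C x + b *\<^sub>C y) (a *\<^sub>C x + b *\<^sub>C y)) =
      (cmod a)\<^sup>2 * Re (f x x) + 2 * Re (a * cnj b * u) + (cmod b)\<^sup>2 * Re (f y y)" for a b
  proof -
    have "f (a *\<^sub>C x + b *\<^sub>C y) (a *\<^sub>C x + b *\<^sub>C y) =
       a * cnj a * f x x + a * cnj b * u + b * cnj a * cnj u + b * cnj b * f y y"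
      using lin by (simp add: psd_form_add_right[OF f] psd_form_scaleC_right[OF f] fyx
          u_def[symmetric] algebra_simps)
    also have "\<dots> = of_real ((cmod a)\<^sup>2 * Re (f x x)) + (a * cnj b * u + cnj (a * cnj b * u))
       + of_real ((cmod b)\<^sup>2 * Re (f y y))"
      by (subst (1 2) diag) (simp add: complex_norm_square del: of_real_power)
    finally show ?thesis by (simp add: algebra_simps)
  qed
  have pos: "0 \<le> (cmod a)\<^sup>2 * Re (f x x) + 2 * Re (a * cnj b * u) + (cmod b)\<^sup>2 * Re (f y y)" for a b
    using f unfolding exp[symmetric] psd_form_def by blast
  have re: "0 \<le> t^2 * Re (f x x) - 2 * t * (cmod u)^2 + (cmod u)^2 * Re (f y y)" for t :: real
  proof -
    have "Re (of_real (-t) * cnj u * u) = - t * (cmod u)^2"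
      using cmod_power2[of u] by (simp add: power2_eq_square algebra_simps)
    then show ?thesis using pos[of "of_real (-t)" u] by simp
  qed
  have nx: "0 \<le> Re (f x x)" and ny: "0 \<le> Re (f y y)" using f unfolding psd_form_def by blast+
  show ?thesis
  proof (cases "u = 0")
    case True then show ?thesis using nx ny by (simp add: u_def[symmetric])
  next
    case False
    then have p: "0 < (cmod u)^2" by simp
    have *: "2 * t * (cmod u)\<^sup>2 - (cmod u)\<^sup>2 * Re (f y y) \<le> t^2 * Re (f x x)" for t
      using re[of t] by simp
    show ?thesis
    proof (cases "Re (f x x) = 0")
      case True
      \<comment> \<open>Here the polynomial is linear in \<open>t\<close>, and this value of
        \<open>t\<close> already makes it negative.\<close>
      have "2 * (Re (f y y) + 1) * (cmod u)\<^sup>2 - (cmod u)\<^sup>2 * Re (f y y) \<le> 0"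
        using *[of "Re (f y y) + 1"] True by simp
      then have "(cmod u)^2 * (Re (f y y) + 2) \<le> 0" by (simp add: algebra_simps)
      moreover have "0 < (cmod u)^2 * (Re (f y y) + 2)" using p ny by (intro mult_pos_pos) auto
      ultimately show ?thesis by linarith
    next
      case False
      then have px: "0 < Re (f x x)" using nx by simp
      define t where "t = (cmod u)^2 / Re (f x x)"
      have t: "t * Re (f x x) = (cmod u)^2" using px by (simp add: t_def)
      have "2 * t * (cmod u)\<^sup>2 - (cmod u)\<^sup>2 * Re (f y y) \<le> t * (cmod u)^2"
        using *[of t] unfolding power2_eq_square[of t] mult.assoc t by simp
      then have "(cmod u)\<^sup>2 * t \<le> (cmod u)\<^sup>2 * Re (f y y)" by (simp add: algebra_simps)
      then have "t \<le> Re (f y y)" using p by simp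
      then show ?thesis unfolding u_def[symmetric] using px by (simp add: t_def field_simps)
    qed
  qed
qed

section \<open>The inner product as a bounded bilinear map\<close>

lemma psd_form_cinner: "psd_form (cinner :: 'a::complex_hilbert_space \<Rightarrow> _)"
  unfolding psd_form_def by (auto simp: cinner_add_left cinner_scaleC_left cinner_self intro: cinner_commute)

lemma Re_cinner_self [simp]: "Re (cinner x x) = (norm x)\<^sup>2"
  for x :: "'a::complex_hilbert_space"
  by (simp add: cinner_self)

lemma cmod_cinner_le: "cmod (cinner x y) \<le> norm x * norm y"
  for x :: "'a::complex_hilbert_space"
proof -
  have "(cmod (cinner x y))\<^sup>2 \<le> (norm x * norm y)\<^sup>2"
    using psd_form_cauchy_schwarz[OF psd_form_cinner, of x y] by (simp add: power_mult_distrib)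
  then show ?thesis by (simp add: power2_le_iff_abs_le)
qed

lemma bounded_bilinear_cinner: "bounded_bilinear (cinner :: 'a::complex_hilbert_space \<Rightarrow> _)"
proof (rule bounded_bilinear.intro)
  show "cinner (r *\<^sub>R a) b = r *\<^sub>R cinner a b" for r and a b :: 'a
    by (metis scaleC_of_real cinner_scaleC_left scaleR_conv_of_real)
  show "cinner a (r *\<^sub>R b) = r *\<^sub>R cinner a b" for r and a b :: 'a
    by (metis scaleC_of_real cinner_scaleC_right scaleR_conv_of_real complex_cnj_complex_of_real)
  show "\<exists>K. \<forall>a b. cmod (cinner a b) \<le> norm a * norm (b::'a) * K"
    by (rule exI[of _ 1]) (simp add: cmod_cinner_le)
qed (simp_all add: cinner_add_left cinner_add_right)

interpretation cinner: bounded_bilinear "cinner :: 'a::complex_hilbert_space \<Rightarrow> _"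
  by (rule bounded_bilinear_cinner)

lemma norm_add_square: "(norm (x + y))\<^sup>2 = (norm x)\<^sup>2 + 2 * Re (cinner x y) + (norm y)\<^sup>2"
  for x :: "'a::complex_hilbert_space"
proof -
  have "Re (cinner (x + y) (x + y)) = Re (cinner x x) + Re (cinner x y) + Re (cinner y x) + Re (cinner y y)"
    by (simp only: cinner_add_left cinner_add_right plus_complex.simps)
  moreover have "Re (cinner y x) = Re (cinner x y)" by (subst cinner_commute) simp
  ultimately show ?thesis by simp
qed

lemma norm_diff_square: "(norm (x - y))\<^sup>2 = (norm x)\<^sup>2 - 2 * Re (cinner x y) + (norm y)\<^sup>2"
  for x :: "'a::complex_hilbert_space"
  using norm_add_square[of x "-y"] by (simp add: cinner.minus_right)

lemma parallelogram: "(norm (x - y))\<^sup>2 + (norm (x + y))\<^sup>2 = 2 * (norm x)\<^sup>2 + 2 * (norm y)\<^sup>2"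
  for x :: "'a::complex_hilbert_space"
  by (simp add: norm_add_square norm_diff_square)

lemma cinner_ext: "(\<And>y. cinner x y = cinner x' y) \<Longrightarrow> x = x'"
  for x :: "'a::complex_hilbert_space"
proof -
  assume "\<And>y. cinner x y = cinner x' y"
  then have "cinner (x - x') (x - x') = 0" by (simp add: cinner.diff_left)
  then show ?thesis by (simp add: cinner_self)
qed

lemma cinner_ext_right: "(\<And>x. cinner x y = cinner x y') \<Longrightarrow> y = y'"
  for y :: "'a::complex_hilbert_space"
  by (rule cinner_ext) (metis cinner_commute)

lemma norm_le_cinner:
  assumes c: "0 \<le> c" and le: "\<And>y. cmod (cinner x y) \<le> c * norm y"
  shows "norm (x::'a::complex_hilbert_space) \<le> c"
proof (cases "x = 0")
  case False
  have "norm x * norm x \<le> c * norm x"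
    using le[of x] by (simp add: cinner_self power2_eq_square norm_mult)
  then show ?thesis using False by (simp add: mult_le_cancel_right)
qed (use c in simp)

text \<open>The representing vector is the minimiser of \<open>\<parallel>x\<parallel>\<^sup>2 - 2 Re (f x)\<close>, and minimising sequences
  converge by the parallelogram law.\<close>

lemma riesz_representation:
  fixes f :: "'a::complex_hilbert_space \<Rightarrow> complex"
  assumes add: "\<And>x y. f (x + y) = f x + f y" and scale: "\<And>a x. f (a *\<^sub>C x) = a * f x"
    and bound: "\<And>x. cmod (f x) \<le> M * norm x" and M: "0 \<le> M"
  shows "\<exists>z. norm z \<le> M \<and> (\<forall>x. f x = cinner x z)"
proof -
  have fR: "f (r *\<^sub>R x) = r * f x" for r :: real and x
    by (metis scale scaleC_of_real)
  have diff: "f (x - y) = f x - f y" for x y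
    by (metis add add_diff_cancel diff_add_cancel)
  define \<Phi> where "\<Phi> x = (norm x)\<^sup>2 - 2 * Re (f x)" for x
  have lower: "- M\<^sup>2 \<le> \<Phi> x" for x
  proof -
    have "Re (f x) \<le> M * norm x" by (meson bound complex_Re_le_cmod order_trans)
    moreover have "0 \<le> (norm x - M)\<^sup>2" by simp
    ultimately show ?thesis by (simp add: \<Phi>_def power2_eq_square algebra_simps)
  qed
  define I where "I = (INF x. \<Phi> x)"
  have bdd: "bdd_below (range \<Phi>)" using lower by (auto intro!: bdd_belowI)
  have I: "I \<le> \<Phi> x" for x unfolding I_def by (rule cINF_lower[OF bdd]) simp
  have "\<exists>x. \<Phi> x < I + 1 / real (Suc n)" for n
    using cINF_less_iff[OF _ bdd, of "I + 1 / real (Suc n)"] unfolding I_def by auto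
  then obtain x where x: "\<Phi> (x n) < I + 1 / real (Suc n)" for n by metis
  have para: "(norm (u - v))\<^sup>2 \<le> 2 * \<Phi> u + 2 * \<Phi> v - 4 * I" for u v
  proof -
    have "\<Phi> ((1/2) *\<^sub>R (u + v)) = (norm (u + v))\<^sup>2 / 4 - Re (f u) - Re (f v)"
      unfolding \<Phi>_def fR add norm_scaleR by (simp add: power_mult_distrib power_divide add_divide_distrib)
    then show ?thesis using I[of "(1/2) *\<^sub>R (u + v)"] parallelogram[of u v]
      by (simp add: \<Phi>_def field_simps)
  qed
  have close: "(norm (x m - x n))\<^sup>2 \<le> 4 / real (Suc N)" if "N \<le> m" "N \<le> n" for m n N
  proof -
    have "1 / real (Suc m) \<le> 1 / real (Suc N)" "1 / real (Suc n) \<le> 1 / real (Suc N)"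
      using that by (auto simp: frac_le)
    then show ?thesis using para[of "x m" "x n"] x[of m] x[of n] by linarith
  qed
  have "Cauchy x"
  proof (rule metric_CauchyI)
    fix e :: real assume e: "0 < e"
    then obtain N where N: "4 / e\<^sup>2 < real N" using reals_Archimedean2 by blast
    then have "4 / real (Suc N) < e\<^sup>2" using e by (simp add: field_simps add_strict_increasing)
    then have "(norm (x m - x n))\<^sup>2 < e\<^sup>2" if "N \<le> m" "N \<le> n" for m n
      using close[OF that] by linarith
    then show "\<exists>N. \<forall>m\<ge>N. \<forall>n\<ge>N. dist (x m) (x n) < e"
      unfolding dist_norm using e power_less_imp_less_base[of _ 2 e] by (intro exI[of _ N]) auto
  qed
  then obtain z where z: "x \<longlonglongrightarrow> z" using Cauchy_convergent_iff convergent_def by blast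
  have fl: "bounded_linear f"
    by (rule bounded_linear_intro[of _ M])
      (auto simp: add fR scaleR_conv_of_real bound mult.commute)
  have "(\<lambda>n. \<Phi> (x n)) \<longlonglongrightarrow> \<Phi> z"
    unfolding \<Phi>_def by (intro tendsto_intros bounded_linear.tendsto[OF fl] z)
  moreover have "(\<lambda>n. I + 1 / real (Suc n)) \<longlonglongrightarrow> I + 0"
    by (intro tendsto_intros LIMSEQ_Suc[OF lim_1_over_n])
  ultimately have "\<Phi> z \<le> I + 0"
    by (rule LIMSEQ_le) (use x in \<open>auto intro: less_imp_le\<close>)
  then have min: "\<Phi> z \<le> \<Phi> v" for v using I[of v] by simp
  have re: "Re (cinner v z) = Re (f v)" for v
  proof (rule ccontr)
    assume "Re (cinner v z) \<noteq> Re (f v)"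
    define d where "d = Re (f v) - Re (cinner z v)"
    have sym: "Re (cinner z v) = Re (cinner v z)" by (subst cinner_commute) simp
    have d0: "d \<noteq> 0" using \<open>Re (cinner v z) \<noteq> Re (f v)\<close> by (simp add: d_def sym)
    have ge: "2 * t * d \<le> t\<^sup>2 * (norm v)\<^sup>2" for t :: real
    proof -
      have "\<Phi> (z + t *\<^sub>R v) = \<Phi> z - 2 * t * d + t\<^sup>2 * (norm v)\<^sup>2"
        unfolding \<Phi>_def norm_add_square add fR d_def
        by (simp add: cinner.scaleR_right power_mult_distrib algebra_simps)
      then show ?thesis using min[of "z + t *\<^sub>R v"] by linarith
    qed
    \<comment> \<open>The \<open>+ 1\<close> keeps the denominator positive when
      \<open>v = 0\<close>; the inequality at this \<open>t\<close> leaves only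
      \<open>t = 0\<close>, that is \<open>d = 0\<close>.\<close>
    define t where "t = d / ((norm v)\<^sup>2 + 1)"
    have n: "0 < (norm v)\<^sup>2 + 1" by (smt (verit) zero_le_power2)
    have d: "d = t * ((norm v)\<^sup>2 + 1)" using n by (simp add: t_def)
    have "2 * t\<^sup>2 * ((norm v)\<^sup>2 + 1) \<le> t\<^sup>2 * (norm v)\<^sup>2"
      using ge[of t] unfolding d by (simp add: power2_eq_square algebra_simps)
    then have "t\<^sup>2 * ((norm v)\<^sup>2 + 2) \<le> 0" by (simp add: algebra_simps)
    moreover have "0 < t\<^sup>2 * ((norm v)\<^sup>2 + 2)"
      using d0 n by (intro mult_pos_pos) (auto simp: t_def)
    ultimately show False by linarith
  qed
  have eq: "f v = cinner v z" for v
  proof (rule complex_eqI)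
    show "Re (f v) = Re (cinner v z)" using re[of v] by simp
    show "Im (f v) = Im (cinner v z)"
      using re[of "\<i> *\<^sub>C v"] by (simp add: scale cinner_scaleC_left)
  qed
  have "norm z \<le> M"
  proof (rule norm_le_cinner[OF M])
    show "cmod (cinner z y) \<le> M * norm y" for y
      using bound[of y] by (metis eq cinner_commute complex_mod_cnj)
  qed
  then show ?thesis using eq by blast
qed

section \<open>Bounded operators\<close>

lemma bounded_ops_scaleC: "A \<in> bounded_ops \<Longrightarrow> A (c *\<^sub>C x) = c *\<^sub>C A x"
  unfolding bounded_ops_def by blast

lemma bounded_opsI:
  fixes A :: "'a::complex_hilbert_space \<Rightarrow>\<^sub>L 'a"
  shows "(\<And>c x. A (c *\<^sub>C x) = c *\<^sub>C A x) \<Longrightarrow> A \<in> bounded_ops"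
  unfolding bounded_ops_def by blast

lemma scale_op_apply [simp]: "scale_op c A x = c *\<^sub>C A x"
  by transfer simp

lemma id_blinfun_in_bounded_ops [simp]: "id_blinfun \<in> bounded_ops"
  by (simp add: bounded_ops_def)

lemma compose_in_bounded_ops [simp]:
  "A \<in> bounded_ops \<Longrightarrow> B \<in> bounded_ops \<Longrightarrow> A o\<^sub>L B \<in> bounded_ops"
  by (simp add: bounded_ops_def)

lemma add_in_bounded_ops [simp]: "A \<in> bounded_ops \<Longrightarrow> B \<in> bounded_ops \<Longrightarrow> A + B \<in> bounded_ops"
  by (simp add: bounded_ops_def blinfun.add_left scaleC_add_right)

lemma diff_in_bounded_ops [simp]: "A \<in> bounded_ops \<Longrightarrow> B \<in> bounded_ops \<Longrightarrow> A - B \<in> bounded_ops"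
  by (simp add: bounded_ops_def blinfun.diff_left scaleC_diff_right)

lemma scaleR_scaleC_commute: "r *\<^sub>R (c *\<^sub>C x) = c *\<^sub>C (r *\<^sub>R x)"
  for x :: "'a::complex_hilbert_space"
  by (metis scaleC_of_real scaleC_scaleC mult.commute)

lemma scaleR_in_bounded_ops [simp]: "A \<in> bounded_ops \<Longrightarrow> r *\<^sub>R A \<in> bounded_ops"
  by (simp add: bounded_ops_def blinfun.scaleR_left scaleR_scaleC_commute)

lemma sum_in_bounded_ops: "(\<And>i. i \<in> I \<Longrightarrow> A i \<in> bounded_ops) \<Longrightarrow> (\<Sum>i\<in>I. A i) \<in> bounded_ops"
  by (induction I rule: infinite_finite_induct)
    (simp_all add: add_in_bounded_ops, simp_all add: bounded_ops_def)

text \<open>Makes the complex-linear operators a complete set, so that Banach fixed points found in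
  it are again complex-linear.\<close>

lemma closed_bounded_ops: "closed (bounded_ops :: ('a::complex_hilbert_space \<Rightarrow>\<^sub>L 'a) set)"
proof -
  have "closed {A :: 'a \<Rightarrow>\<^sub>L 'a. A (c *\<^sub>C x) = c *\<^sub>C A x}" for c x
    by (intro closed_Collect_eq continuous_intros
        bounded_linear.continuous_on[OF bounded_linear_scaleC])
  then show ?thesis unfolding bounded_ops_def Collect_all_eq by auto
qed

lemma norm_scale_op: "norm (scale_op c A) = cmod c * norm A"
proof (rule antisym)
  have le: "norm (scale_op c A) \<le> cmod c * norm A" for c and A :: "'a \<Rightarrow>\<^sub>L 'a"
    by (rule norm_blinfun_bound)
      (auto simp: norm_scaleC mult.assoc intro!: mult_left_mono norm_blinfun)
  show "norm (scale_op c A) \<le> cmod c * norm A" by (rule le)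
  show "cmod c * norm A \<le> norm (scale_op c A)"
  proof (cases "c = 0")
    case False
    have "A = scale_op (1 / c) (scale_op c A)"
      using False by (intro blinfun_eqI) (simp add: scaleC_scaleC)
    then have "norm A \<le> cmod (1 / c) * norm (scale_op c A)" by (metis le)
    then show ?thesis using False by (simp add: norm_divide field_simps)
  qed simp
qed

lemma op_inverse_unique:
  assumes "B \<in> bounded_ops" "A o\<^sub>L B = id_blinfun" "B o\<^sub>L A = id_blinfun"
  shows "op_inverse A = B"
proof -
  have "C = B" if "A o\<^sub>L C = id_blinfun" "C o\<^sub>L A = id_blinfun" for C
  proof (rule blinfun_eqI)
    fix x
    have "C x = B (A (C x))" by (metis assms(3) blinfun_apply_blinfun_compose id_blinfun.rep_eq id_apply)
    then show "C x = B x" by (metis that(1) blinfun_apply_blinfun_compose id_blinfun.rep_eq id_apply)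
  qed
  then show ?thesis unfolding op_inverse_def using assms by (metis (mono_tags, lifting) the_equality)
qed

lemma op_invertibleD:
  assumes "op_invertible A"
  shows "op_inverse A \<in> bounded_ops" "A o\<^sub>L op_inverse A = id_blinfun"
    "op_inverse A o\<^sub>L A = id_blinfun"
  using assms op_inverse_unique unfolding op_invertible_def by metis+

lemma op_invertible_apply:
  assumes "op_invertible A"
  shows "A (op_inverse A x) = x" "op_inverse A (A x) = x"
  using op_invertibleD[OF assms] by (metis blinfun_apply_blinfun_compose id_blinfun.rep_eq)+

lemma op_invertible_compose:
  assumes A: "op_invertible A" and B: "op_invertible B"
  shows "op_invertible (A o\<^sub>L B)" "op_inverse (A o\<^sub>L B) = op_inverse B o\<^sub>L op_inverse A"
proof -
  have *: "op_inverse B o\<^sub>L op_inverse A \<in> bounded_ops"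
    "(A o\<^sub>L B) o\<^sub>L (op_inverse B o\<^sub>L op_inverse A) = id_blinfun"
    "(op_inverse B o\<^sub>L op_inverse A) o\<^sub>L (A o\<^sub>L B) = id_blinfun"
    using op_invertibleD[OF A] op_invertibleD[OF B]
    by (auto intro!: blinfun_eqI simp: op_invertible_apply A B)
  then show "op_invertible (A o\<^sub>L B)" unfolding op_invertible_def by blast
  show "op_inverse (A o\<^sub>L B) = op_inverse B o\<^sub>L op_inverse A"
    by (rule op_inverse_unique) (use * in auto)
qed

lemma op_inverse_commute:
  assumes A: "op_invertible A" and AB: "A o\<^sub>L B = B o\<^sub>L A"
  shows "op_inverse A o\<^sub>L B = B o\<^sub>L op_inverse A"
proof (rule blinfun_eqI)
  fix x
  have "A (B (op_inverse A x)) = B x"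
    using AB op_invertible_apply(1)[OF A] by (metis blinfun_apply_blinfun_compose)
  then show "(op_inverse A o\<^sub>L B) x = (B o\<^sub>L op_inverse A) x"
    using op_invertible_apply(2)[OF A] by (metis blinfun_apply_blinfun_compose)
qed

lemma op_conj_compose:
  "op_invertible S \<Longrightarrow> op_conj S A o\<^sub>L op_conj S B = op_conj S (A o\<^sub>L B)"
  unfolding op_conj_def by (intro blinfun_eqI) (simp add: op_invertible_apply)

lemma op_conj_in_bounded_ops:
  "S \<in> bounded_ops \<Longrightarrow> op_invertible S \<Longrightarrow> A \<in> bounded_ops \<Longrightarrow> op_conj S A \<in> bounded_ops"
  unfolding op_conj_def by (simp add: op_invertibleD)

subsection \<open>Adjoints\<close>

text \<open>Meaningful on \<open>bounded_ops\<close> only: a real-linear map that is not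
  complex-linear satisfies the defining identity with no \<open>B\<close>.\<close>

definition adj :: "('a::complex_hilbert_space \<Rightarrow>\<^sub>L 'a) \<Rightarrow> 'a \<Rightarrow>\<^sub>L 'a"
  where "adj A = (SOME B. B \<in> bounded_ops \<and> (\<forall>x y. cinner (A x) y = cinner x (B y)))"

text \<open>Riesz for each fixed \<open>y\<close>; uniqueness of the representing vector makes it
  depend linearly on \<open>y\<close>. Produces both adjoints and Gram operators.\<close>

lemma bounded_sesquilinear_form_representation:
  fixes f :: "'a::complex_hilbert_space \<Rightarrow> 'a \<Rightarrow> complex"
  assumes add1: "\<And>x y z. f (x + y) z = f x z + f y z" and scale1: "\<And>a x y. f (a *\<^sub>C x) y = a * f x y"
    and add2: "\<And>x y z. f x (y + z) = f x y + f x z" and scale2: "\<And>a x y. f x (a *\<^sub>C y) = cnj a * f x y"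
    and bound: "\<And>x y. cmod (f x y) \<le> M * norm x * norm y" and M: "0 \<le> M"
  shows "\<exists>B\<in>bounded_ops. norm B \<le> M \<and> (\<forall>x y. f x y = cinner x (blinfun_apply B y))"
proof -
  have "\<exists>z. norm z \<le> M * norm y \<and> (\<forall>x. f x y = cinner x z)" for y
  proof (rule riesz_representation)
    show "cmod (f x y) \<le> M * norm y * norm x" for x using bound[of x y] by (simp add: mult_ac)
  qed (simp_all add: add1 scale1 M)
  then obtain B where B: "norm (B y) \<le> M * norm y" "f x y = cinner x (B y)" for x y by metis
  have "bounded_linear B"
  proof (rule bounded_linear_intro[of _ M])
    show "B (x + y) = B x + B y" for x y
      by (rule cinner_ext_right) (simp add: B(2)[symmetric] add2 cinner_add_right)
    show "B (r *\<^sub>R x) = r *\<^sub>R B x" for r x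
      by (rule cinner_ext_right)
        (simp add: B(2)[symmetric] scaleC_of_real[symmetric] scale2 cinner_scaleC_right)
    show "norm (B x) \<le> norm x * M" for x using B(1)[of x] by (simp add: mult.commute)
  qed
  note app = bounded_linear_Blinfun_apply[OF this]
  have "Blinfun B \<in> bounded_ops"
    by (rule bounded_opsI, rule cinner_ext_right)
      (simp add: app B(2)[symmetric] scale2 cinner_scaleC_right)
  moreover have "norm (Blinfun B) \<le> M"
    by (rule norm_blinfun_bound) (use M in \<open>auto simp: app B(1)\<close>)
  ultimately show ?thesis using B(2) app by (intro bexI[of _ "Blinfun B"]) auto
qed

lemma adj_props:
  assumes "A \<in> bounded_ops"
  shows adj_in_bounded_ops: "adj A \<in> bounded_ops" and cinner_adj: "cinner (A x) y = cinner x (adj A y)"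
proof -
  have "\<exists>B\<in>bounded_ops. norm B \<le> norm A \<and> (\<forall>x y. cinner (A x) y = cinner x (blinfun_apply B y))"
  proof (rule bounded_sesquilinear_form_representation)
    show "cmod (cinner (A x) y) \<le> norm A * norm x * norm y" for x y
      by (rule order_trans[OF cmod_cinner_le]) (simp add: mult_right_mono norm_blinfun)
  qed (simp_all add: blinfun.add_right cinner_add_left cinner_add_right
      cinner_scaleC_right cinner_scaleC_left bounded_ops_scaleC[OF assms])
  then have "\<exists>B. B \<in> bounded_ops \<and> (\<forall>x y. cinner (A x) y = cinner x (B y))" by blast
  then have "adj A \<in> bounded_ops \<and> (\<forall>x y. cinner (A x) y = cinner x (adj A y))"
    unfolding adj_def by (rule someI_ex)
  then show "adj A \<in> bounded_ops" "cinner (A x) y = cinner x (adj A y)" by auto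
qed

lemma adj_eqI:
  fixes A B :: "'a::complex_hilbert_space \<Rightarrow>\<^sub>L 'a"
  assumes "A \<in> bounded_ops" "\<And>x y. cinner (A x) y = cinner x (blinfun_apply B y)"
  shows "adj A = B"
  by (rule blinfun_eqI, rule cinner_ext_right) (metis assms cinner_adj)

lemma adj_adj: "A \<in> bounded_ops \<Longrightarrow> adj (adj A) = A"
  by (rule adj_eqI) (auto simp: adj_in_bounded_ops, metis cinner_adj cinner_commute)

lemma adj_compose:
  "A \<in> bounded_ops \<Longrightarrow> B \<in> bounded_ops \<Longrightarrow> adj (A o\<^sub>L B) = adj B o\<^sub>L adj A"
  by (rule adj_eqI) (auto simp: cinner_adj)

lemma adj_id [simp]: "adj id_blinfun = id_blinfun"
  by (rule adj_eqI) auto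

lemma adj_diff:
  "A \<in> bounded_ops \<Longrightarrow> B \<in> bounded_ops \<Longrightarrow> adj (A - B) = adj A - adj B"
  by (rule adj_eqI) (auto simp: cinner_adj blinfun.diff_left cinner.diff_left cinner.diff_right)

lemma norm_adj: "A \<in> bounded_ops \<Longrightarrow> norm (adj A) = norm A"
proof -
  have le: "norm (adj A) \<le> norm A" if A: "A \<in> bounded_ops" for A :: "'a \<Rightarrow>\<^sub>L 'a"
  proof (rule norm_blinfun_bound)
    show "norm (adj A y) \<le> norm A * norm y" for y
    proof (rule norm_le_cinner)
      fix x
      have "cmod (cinner (adj A y) x) = cmod (cinner (A x) y)"
        by (metis A cinner_adj cinner_commute complex_mod_cnj)
      also have "\<dots> \<le> norm (A x) * norm y" by (rule cmod_cinner_le)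
      also have "\<dots> \<le> norm A * norm x * norm y" by (intro mult_right_mono norm_blinfun) auto
      finally show "cmod (cinner (adj A y) x) \<le> norm A * norm y * norm x" by (simp add: mult_ac)
    qed auto
  qed auto
  assume A: "A \<in> bounded_ops"
  show ?thesis using le[OF A] le[OF adj_in_bounded_ops[OF A]] by (simp add: adj_adj A)
qed

subsection \<open>Invertibility and square roots by fixed points\<close>

lemma norm_blinfun_compose_le: "norm A \<le> a \<Longrightarrow> norm B \<le> b \<Longrightarrow> norm (A o\<^sub>L B) \<le> a * b"
  by (rule order_trans[OF norm_blinfun_compose]) (auto intro!: mult_mono order_trans[OF norm_ge_zero])

text \<open>In place of a Neumann series, the fixed points of \<open>X = I + K X\<close> and
  \<open>Y = I + Y K\<close> are a right and a left inverse, and these coincide.\<close>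

lemma op_invertible_id_minus:
  fixes K :: "'a::complex_hilbert_space \<Rightarrow>\<^sub>L 'a"
  assumes K: "K \<in> bounded_ops" "norm K < 1"
  shows "op_invertible (id_blinfun - K)"
proof -
  have compl: "complete (bounded_ops :: ('a \<Rightarrow>\<^sub>L 'a) set)"
    using closed_bounded_ops complete_eq_closed by blast
  have "\<exists>!X\<in>bounded_ops. id_blinfun + (K o\<^sub>L X) = X"
  proof (rule Banach_fix[OF compl _ norm_ge_zero K(2)])
    show "dist (id_blinfun + (K o\<^sub>L X)) (id_blinfun + (K o\<^sub>L Y)) \<le> norm K * dist X Y" for X Y
      unfolding dist_norm using norm_blinfun_compose[of K "X - Y"]
      by (simp add: bounded_bilinear.diff_right[OF bounded_bilinear_blinfun_compose])
  qed (use K(1) id_blinfun_in_bounded_ops in blast, use K(1) in auto)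
  then obtain X where X: "X \<in> bounded_ops" "id_blinfun + (K o\<^sub>L X) = X" by blast
  have "\<exists>!Y\<in>bounded_ops. id_blinfun + (Y o\<^sub>L K) = Y"
  proof (rule Banach_fix[OF compl _ norm_ge_zero K(2)])
    show "dist (id_blinfun + (X o\<^sub>L K)) (id_blinfun + (Y o\<^sub>L K)) \<le> norm K * dist X Y" for X Y
      unfolding dist_norm using norm_blinfun_compose[of "X - Y" K]
      by (simp add: bounded_bilinear.diff_left[OF bounded_bilinear_blinfun_compose] mult.commute)
  qed (use K(1) id_blinfun_in_bounded_ops in blast, use K(1) in auto)
  then obtain Y where Y: "id_blinfun + (Y o\<^sub>L K) = Y" by blast
  have X': "X x - K (X x) = x" for x
    using arg_cong[OF X(2), of "\<lambda>Z. blinfun_apply Z x"] by (simp add: blinfun.add_left algebra_simps)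
  have Y': "Y (x - K x) = x" for x
    using arg_cong[OF Y, of "\<lambda>Z. blinfun_apply Z x"]
    by (simp add: blinfun.add_left blinfun.diff_right algebra_simps)
  have YX: "Y x = X x" for x using X'[of x] Y'[of "X x"] by simp
  have "(id_blinfun - K) o\<^sub>L X = id_blinfun"
    by (rule blinfun_eqI) (simp add: blinfun.diff_left X')
  moreover have "X o\<^sub>L (id_blinfun - K) = id_blinfun"
    by (rule blinfun_eqI) (simp add: blinfun.diff_left YX[symmetric] Y')
  ultimately have "(id_blinfun - K) o\<^sub>L X = id_blinfun" "X o\<^sub>L (id_blinfun - K) = id_blinfun" by simp_all
  then show ?thesis unfolding op_invertible_def using X(1) by blast
qed

lemma op_invertible_scaleR:
  assumes A: "op_invertible A" and r: "r \<noteq> 0"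
  shows "op_invertible (r *\<^sub>R A)"
  unfolding op_invertible_def
proof (intro bexI conjI)
  show "inverse r *\<^sub>R op_inverse A \<in> bounded_ops" using op_invertibleD[OF A] by simp
  show "(r *\<^sub>R A) o\<^sub>L (inverse r *\<^sub>R op_inverse A) = id_blinfun"
    "(inverse r *\<^sub>R op_inverse A) o\<^sub>L (r *\<^sub>R A) = id_blinfun"
    using r by (auto intro!: blinfun_eqI
        simp: blinfun.scaleR_left blinfun.scaleR_right op_invertible_apply[OF A])
qed

text \<open>An equivalent Hilbertian norm is \<open>x \<mapsto> \<parallel>S x\<parallel>\<close> with \<open>S\<close> the square root of its Gram operator.
  The root of \<open>I - K\<close> is \<open>I - Y\<close> with \<open>Y\<close> the fixed point of the contraction \<open>Y \<mapsto> (K + Y\<^sup>2)/2\<close>.\<close>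

lemma equivalent_form_similarity:
  fixes b :: "'a::complex_hilbert_space \<Rightarrow> 'a \<Rightarrow> complex"
  assumes b: "psd_form b" and c: "0 < c"
    and lower: "\<And>x. c * (norm x)\<^sup>2 \<le> Re (b x x)" and upper: "\<And>x. Re (b x x) \<le> C * (norm x)\<^sup>2"
    and C: "0 \<le> C"
  shows "\<exists>S\<in>bounded_ops. op_invertible S \<and> (\<forall>x. (norm (blinfun_apply S x))\<^sup>2 = Re (b x x))"
proof -
  \<comment> \<open>With \<open>D\<close> as normalisation the operator \<open>K = I - B/D\<close>,
    where \<open>B\<close> is the Gram operator of \<open>b\<close>, lies between \<open>0\<close>
    and \<open>\<rho> < 1\<close>. Adding \<open>c\<close> keeps \<open>D\<close> positive even for
    \<open>C = 0\<close>.\<close>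
  define D where "D = C + c"
  have D: "0 < D" using c C by (simp add: D_def)
  define \<rho> where "\<rho> = 1 - c / D"
  have \<rho>: "0 \<le> \<rho>" "\<rho> < 1" using c C D by (simp_all add: \<rho>_def D_def field_simps)
  define k where "k x y = cinner x y - b x y / D" for x y
  have badd: "b (x + y) z = b x z + b y z" and bscale: "b (a *\<^sub>C x) z = a * b x z" for a x y z
    using b unfolding psd_form_def by blast+
  have bsym: "b y x = cnj (b x y)" for x y
    using b unfolding psd_form_def by blast
  have k_le: "Re (k x x) \<le> \<rho> * (norm x)\<^sup>2" for x
    using lower[of x] D by (simp add: k_def \<rho>_def field_simps)
  have k_psd: "psd_form k"
    unfolding psd_form_def
  proof (intro conjI allI)
    show "k (x + y) z = k x z + k y z" for x y z
      by (simp add: k_def badd cinner_add_left add_divide_distrib)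
    show "k (a *\<^sub>C x) z = a * k x z" for a x z
      by (simp add: k_def bscale cinner_scaleC_left algebra_simps)
    show "k y x = cnj (k x y)" for x y
      unfolding k_def by (subst bsym, subst cinner_commute) simp
    show "0 \<le> Re (k x x)" for x
    proof -
      have "Re (b x x) \<le> D * (norm x)\<^sup>2"
        using upper[of x] c by (simp add: D_def algebra_simps add_increasing2)
      then show ?thesis using D by (simp add: k_def field_simps)
    qed
  qed
  have kadd: "k (x + y) z = k x z + k y z" and kscale: "k (a *\<^sub>C x) z = a * k x z" for a x y z
    using k_psd unfolding psd_form_def by blast+
  have ksym: "k y x = cnj (k x y)" for x y
    using k_psd unfolding psd_form_def by blast
  have "\<exists>K\<in>bounded_ops. norm K \<le> \<rho> \<and> (\<forall>x y. k x y = cinner x (blinfun_apply K y))"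
  proof (rule bounded_sesquilinear_form_representation[OF kadd kscale psd_form_add_right[OF k_psd]
        psd_form_scaleC_right[OF k_psd] _ \<rho>(1)])
    fix x y
    have nn: "0 \<le> Re (k x x)" for x using k_psd unfolding psd_form_def by blast
    have "(cmod (k x y))\<^sup>2 \<le> Re (k x x) * Re (k y y)" by (rule psd_form_cauchy_schwarz[OF k_psd])
    also have "\<dots> \<le> (\<rho> * (norm x)\<^sup>2) * (\<rho> * (norm y)\<^sup>2)"
      by (intro mult_mono k_le nn) (use \<rho> in auto)
    also have "\<dots> = (\<rho> * norm x * norm y)\<^sup>2" by (simp add: power2_eq_square)
    finally show "cmod (k x y) \<le> \<rho> * norm x * norm y"
      using \<rho> by (simp add: power2_le_iff_abs_le)
  qed
  then obtain K where K: "K \<in> bounded_ops" "norm K \<le> \<rho>" "\<And>x y. k x y = cinner x (K y)" by blast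
  have Ksym: "cinner (K x) y = cinner x (K y)" for x y
    by (metis K(3) ksym cinner_commute)
  \<comment> \<open>Symmetry belongs to the set because it turns \<open>norm ((I - Y) x)^2\<close>
    into \<open><(I - Y)^2 x, x>\<close>. The ball of radius \<rho> is invariant since
    \<open>(\<rho> + \<rho>^2)/2 <= \<rho>\<close>, and on it the Lipschitz constant is
    \<rho>.\<close>
  define Ys :: "('a \<Rightarrow>\<^sub>L 'a) set" where
    "Ys = bounded_ops \<inter> {Y. norm Y \<le> \<rho>} \<inter> (\<Inter>x. \<Inter>y. {Y :: 'a \<Rightarrow>\<^sub>L 'a. cinner (Y x) y = cinner x (Y y)})"
  have "closed {Y :: 'a \<Rightarrow>\<^sub>L 'a. norm Y \<le> \<rho>}"
    by (intro closed_Collect_le continuous_intros)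
  moreover have "closed {Y :: 'a \<Rightarrow>\<^sub>L 'a. cinner (Y x) y = cinner x (Y y)}" for x y
    by (intro closed_Collect_eq continuous_intros
        bounded_bilinear.continuous_on[OF bounded_bilinear_cinner])
  ultimately have "closed Ys" unfolding Ys_def using closed_bounded_ops
    by (intro closed_Int closed_INT ballI) auto
  then have compl: "complete Ys" using complete_eq_closed by blast
  have "\<exists>!Y\<in>Ys. (1/2) *\<^sub>R (K + (Y o\<^sub>L Y)) = Y"
  proof (rule Banach_fix[OF compl _ \<rho>])
    have "0 \<in> Ys" using \<rho> by (auto simp: Ys_def bounded_ops_def cinner.zero_left cinner.zero_right)
    then show "Ys \<noteq> {}" by blast
    show "(\<lambda>Y. (1/2) *\<^sub>R (K + (Y o\<^sub>L Y))) ` Ys \<subseteq> Ys"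
    proof clarify
      fix Y assume Y: "Y \<in> Ys"
      have "norm (K + (Y o\<^sub>L Y)) \<le> \<rho> + \<rho> * \<rho>"
        by (intro norm_triangle_mono K norm_blinfun_compose_le) (use Y in \<open>auto simp: Ys_def\<close>)
      also have "\<dots> \<le> 2 * \<rho>" using \<rho> by (simp add: mult_left_le)
      finally have "norm ((1/2) *\<^sub>R (K + (Y o\<^sub>L Y))) \<le> \<rho>" by simp
      then show "(1/2) *\<^sub>R (K + (Y o\<^sub>L Y)) \<in> Ys"
        using Y K(1) by (auto simp: Ys_def blinfun.scaleR_left blinfun.add_left cinner.scaleR_left
            cinner.scaleR_right cinner_add_left cinner_add_right Ksym)
    qed
    fix Y Z assume Y: "Y \<in> Ys" and Z: "Z \<in> Ys"
    have "(Y o\<^sub>L Y) - (Z o\<^sub>L Z) = ((Y - Z) o\<^sub>L Y) + (Z o\<^sub>L (Y - Z))"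
      by (simp add: bounded_bilinear.diff_left[OF bounded_bilinear_blinfun_compose] bounded_bilinear.diff_right[OF bounded_bilinear_blinfun_compose])
    also have "norm \<dots> \<le> norm (Y - Z) * \<rho> + \<rho> * norm (Y - Z)"
      by (intro norm_triangle_mono norm_blinfun_compose_le) (use Y Z in \<open>auto simp: Ys_def\<close>)
    finally have "norm ((1/2) *\<^sub>R ((Y o\<^sub>L Y) - (Z o\<^sub>L Z))) \<le> \<rho> * norm (Y - Z)" by simp
    then show "dist ((1/2) *\<^sub>R (K + (Y o\<^sub>L Y))) ((1/2) *\<^sub>R (K + (Z o\<^sub>L Z))) \<le> \<rho> * dist Y Z"
      unfolding dist_norm by (simp add: scaleR_diff_right[symmetric])
  qed
  then obtain Y where Y: "Y \<in> Ys" and fix_Y: "(1/2) *\<^sub>R (K + (Y o\<^sub>L Y)) = Y" by blast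
  have Yb: "Y \<in> bounded_ops" "norm Y < 1" and Ysym: "cinner (Y x) y = cinner x (Y y)" for x y
    using Y \<rho> by (auto simp: Ys_def)
  define S where "S = sqrt D *\<^sub>R (id_blinfun - Y)"
  have "S \<in> bounded_ops" unfolding S_def using Yb by simp
  moreover have "op_invertible S"
    unfolding S_def using op_invertible_id_minus[OF Yb] D by (intro op_invertible_scaleR) auto
  moreover have "(norm (S x))\<^sup>2 = Re (b x x)" for x
  proof -
    \<comment> \<open>The fixed point equation says \<open>2 Y = K + Y^2\<close>, hence
      \<open>(I - Y)^2 = I - K\<close>.\<close>
    have YY: "K x + Y (Y x) = 2 *\<^sub>R Y x"
      using arg_cong[OF fix_Y, of "\<lambda>Z. 2 *\<^sub>R blinfun_apply Z x"]
      by (simp add: blinfun.scaleR_left blinfun.add_left)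
    have "cinner (x - Y x) (x - Y x) = cinner x (x - 2 *\<^sub>R Y x + Y (Y x))"
      by (simp add: cinner.diff_left cinner.diff_right cinner_add_right Ysym scaleR_2 algebra_simps)
    also have "\<dots> = cinner x (x - K x)" by (simp add: YY[symmetric])
    also have "\<dots> = b x x / D" by (simp add: cinner.diff_right K(3)[symmetric] k_def)
    finally have "(norm (x - Y x))\<^sup>2 = Re (b x x) / D" by (metis Re_cinner_self Re_divide_of_real)
    then show ?thesis using D
      by (simp add: S_def blinfun.scaleR_left blinfun.diff_left power_mult_distrib)
  qed
  ultimately show ?thesis by blast
qed

section \<open>Square functions\<close>

definition opow :: "('a::complex_hilbert_space \<Rightarrow>\<^sub>L 'a) \<Rightarrow> nat \<Rightarrow> 'a \<Rightarrow>\<^sub>L 'a"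
  where "opow T k = ((o\<^sub>L) T ^^ k) id_blinfun"

definition pdiff :: "('a::complex_hilbert_space \<Rightarrow>\<^sub>L 'a) \<Rightarrow> nat \<Rightarrow> 'a \<Rightarrow>\<^sub>L 'a"
  where "pdiff T k = opow T k o\<^sub>L (id_blinfun - T)"

lemma opow_0 [simp]: "opow T 0 = id_blinfun"
  and opow_Suc: "opow T (Suc k) = T o\<^sub>L opow T k"
  by (simp_all add: opow_def)

lemma opow_apply: "opow T k x = (blinfun_apply T ^^ k) x"
  by (induction k) (simp_all add: opow_Suc)

lemma opow_add_apply: "opow T (j + k) x = opow T j (opow T k x)"
  by (simp add: opow_apply funpow_add)

lemma opow_commute_apply:
  assumes "\<And>x. R (blinfun_apply T x) = T (R x)"
  shows "R (opow T k x) = opow T k (R x)"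
  by (induction k arbitrary: x) (simp_all add: opow_Suc assms)

lemma T_opow: "T (opow T k x) = opow T k (T x)"
  by (rule opow_commute_apply) simp

lemma pdiff_apply: "pdiff T k x = opow T k x - opow T k (T x)"
  by (simp add: pdiff_def blinfun.diff_left blinfun.diff_right)

lemma pdiff_apply': "pdiff T k x = opow T k x - opow T (Suc k) x"
  by (simp add: pdiff_apply opow_Suc T_opow)

lemma opow_pdiff: "opow T j (pdiff T k x) = pdiff T (j + k) x"
  by (simp add: pdiff_apply blinfun.diff_right opow_add_apply)

lemma opow_in_bounded_ops [simp]: "T \<in> bounded_ops \<Longrightarrow> opow T k \<in> bounded_ops"
  by (induction k) (simp_all add: opow_Suc)

lemma pdiff_in_bounded_ops [simp]: "T \<in> bounded_ops \<Longrightarrow> pdiff T k \<in> bounded_ops"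
  by (simp add: pdiff_def)

lemma pdiff_commute_apply:
  assumes T: "T \<in> bounded_ops" and "\<And>x. R (blinfun_apply T x) = T (R x)" and "bounded_linear R"
  shows "R (pdiff T k x) = pdiff T k (R x)"
proof -
  interpret R: bounded_linear R by fact
  show ?thesis
    by (simp add: pdiff_apply R.diff opow_commute_apply[of R T] assms)
qed

lemma adj_opow: "T \<in> bounded_ops \<Longrightarrow> adj (opow T k) = opow (adj T) k"
proof (induction k)
  case (Suc k)
  have "adj (opow T (Suc k)) = opow (adj T) k o\<^sub>L adj T"
    using Suc by (simp add: opow_Suc adj_compose)
  also have "\<dots> = opow (adj T) (Suc k)"
    by (rule blinfun_eqI) (simp add: opow_Suc T_opow)
  finally show ?case .
qed simp

lemma adj_pdiff: "T \<in> bounded_ops \<Longrightarrow> adj (pdiff T k) = pdiff (adj T) k"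
  unfolding pdiff_def
  by (subst adj_compose) (auto simp: adj_diff adj_opow blinfun.diff_left blinfun.diff_right T_opow
      intro!: blinfun_eqI)

lemma op_conj_apply: "op_conj S T x = S (T (op_inverse S x))"
  by (simp add: op_conj_def)

lemma opow_op_conj:
  assumes S: "op_invertible S"
  shows "opow (op_conj S T) k = op_conj S (opow T k)"
proof (induction k)
  case 0
  show ?case by (intro blinfun_eqI) (simp add: op_conj_def op_invertible_apply[OF S])
next
  case (Suc k)
  then show ?case by (simp add: opow_Suc op_conj_compose[OF S])
qed

lemma pdiff_op_conj:
  assumes S: "op_invertible S"
  shows "pdiff (op_conj S T) k = op_conj S (pdiff T k)"
  by (intro blinfun_eqI)
    (simp add: pdiff_def opow_op_conj[OF S] op_conj_apply blinfun.diff_left blinfun.diff_right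
      op_invertible_apply[OF S])

lemma op_invertible_op_inverse:
  assumes "op_invertible S" "S \<in> bounded_ops"
  shows "op_invertible (op_inverse S)" "op_inverse (op_inverse S) = S"
  using assms op_invertibleD[OF assms(1)] op_inverse_unique unfolding op_invertible_def by metis+

lemma op_conj_op_inverse:
  assumes "op_invertible S" "S \<in> bounded_ops"
  shows "op_conj (op_inverse S) (op_conj S T) = T"
  by (intro blinfun_eqI)
    (simp add: op_conj_def op_invertible_op_inverse[OF assms] op_invertible_apply[OF assms(1)])

lemma op_invertible_adj:
  assumes S: "op_invertible S" "S \<in> bounded_ops"
  shows "op_invertible (adj S)" "op_inverse (adj S) = adj (op_inverse S)"
proof -
  note I = op_invertibleD[OF S(1)]
  have *: "adj S o\<^sub>L adj (op_inverse S) = id_blinfun" "adj (op_inverse S) o\<^sub>L adj S = id_blinfun"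
    using adj_compose[OF I(1) S(2)] adj_compose[OF S(2) I(1)] by (simp_all add: I)
  show "op_invertible (adj S)" unfolding op_invertible_def
    using * adj_in_bounded_ops[OF I(1)] by blast
  show "op_inverse (adj S) = adj (op_inverse S)"
    by (rule op_inverse_unique[OF adj_in_bounded_ops[OF I(1)] *])
qed

text \<open>On adjoints, conjugation by \<open>S\<close> becomes conjugation by the inverse of
  \<open>adj S\<close>. This is what makes a condition on \<open>T\<close> and \<open>adj T\<close>
  together invariant under similarity.\<close>

lemma adj_op_conj:
  assumes S: "op_invertible S" "S \<in> bounded_ops" and T: "T \<in> bounded_ops"
  shows "adj (op_conj S T) = op_conj (op_inverse (adj S)) (adj T)"
proof -
  have "op_inverse (op_inverse (adj S)) = adj S"
    by (rule op_invertible_op_inverse(2)[OF op_invertible_adj(1)[OF S] adj_in_bounded_ops[OF S(2)]])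
  moreover have "adj (op_conj S T) = adj (op_inverse S) o\<^sub>L (adj T o\<^sub>L adj S)"
    unfolding op_conj_def by (simp add: adj_compose S(2) T op_invertibleD(1)[OF S(1)])
  ultimately show ?thesis
    by (intro blinfun_eqI) (simp add: op_conj_def op_invertible_adj(2)[OF S])
qed

text \<open>The discrete counterpart of the square function given by the integral of
  \<open>t norm (A exp(-tA) x)^2 dt\<close> with \<open>A = I - T\<close>. Finite sums make
  summability a consequence instead of an assumption.\<close>

definition square_function_bounded :: "real \<Rightarrow> ('a::complex_hilbert_space \<Rightarrow>\<^sub>L 'a) \<Rightarrow> bool"
  where "square_function_bounded M T \<longleftrightarrow>
    (\<forall>x N. (\<Sum>k<N. real (Suc k) * (norm (pdiff T k x))\<^sup>2) \<le> M\<^sup>2 * (norm x)\<^sup>2)"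

definition square_op :: "('a::complex_hilbert_space \<Rightarrow>\<^sub>L 'a) \<Rightarrow> bool"
  where "square_op T \<longleftrightarrow> T \<in> bounded_ops \<and>
    (\<exists>M. (\<forall>k. norm (opow T k) \<le> M) \<and> square_function_bounded M T \<and> square_function_bounded M (adj T))"

lemma square_function_bounded_mono:
  fixes T :: "'a::complex_hilbert_space \<Rightarrow>\<^sub>L 'a"
  assumes "square_function_bounded M T" "0 \<le> M" "M \<le> M'"
  shows "square_function_bounded M' T"
  unfolding square_function_bounded_def
proof (intro allI)
  fix x :: 'a and N
  have "M\<^sup>2 * (norm x)\<^sup>2 \<le> M'\<^sup>2 * (norm x)\<^sup>2"
    using assms by (intro mult_right_mono power_mono) auto
  then show "(\<Sum>k<N. real (Suc k) * (norm (pdiff T k x))\<^sup>2) \<le> M'\<^sup>2 * (norm x)\<^sup>2"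
    using assms(1) unfolding square_function_bounded_def by (meson order_trans)
qed

lemma square_function_bounded_abs: "square_function_bounded \<bar>M\<bar> T = square_function_bounded M T"
  by (simp add: square_function_bounded_def)

lemma square_opI:
  assumes T: "T \<in> bounded_ops" and "\<And>k. norm (opow T k) \<le> M1"
    "square_function_bounded M2 T" "square_function_bounded M3 (adj T)"
  shows "square_op T"
proof -
  have "norm (opow T k) \<le> max M1 (max \<bar>M2\<bar> \<bar>M3\<bar>)" for k using assms(2)[of k] by simp
  moreover have "square_function_bounded (max M1 (max \<bar>M2\<bar> \<bar>M3\<bar>)) T"
    by (rule square_function_bounded_mono[of "\<bar>M2\<bar>"]) (use assms in \<open>auto simp: square_function_bounded_abs\<close>)
  moreover have "square_function_bounded (max M1 (max \<bar>M2\<bar> \<bar>M3\<bar>)) (adj T)"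
    by (rule square_function_bounded_mono[of "\<bar>M3\<bar>"]) (use assms in \<open>auto simp: square_function_bounded_abs\<close>)
  ultimately show ?thesis unfolding square_op_def using T by blast
qed

lemma square_function_bounded_op_conj:
  assumes S: "op_invertible S" and T: "square_function_bounded M T"
  shows "square_function_bounded (norm S * M * norm (op_inverse S)) (op_conj S T)"
  unfolding square_function_bounded_def
proof (intro allI)
  fix x N
  define y where "y = op_inverse S x"
  have "(\<Sum>k<N. real (Suc k) * (norm (pdiff (op_conj S T) k x))\<^sup>2)
      = (\<Sum>k<N. real (Suc k) * (norm (S (pdiff T k y)))\<^sup>2)"
    by (simp only: pdiff_op_conj[OF S]) (simp add: op_conj_def y_def)
  also have "\<dots> \<le> (\<Sum>k<N. (norm S)\<^sup>2 * (real (Suc k) * (norm (pdiff T k y))\<^sup>2))"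
  proof (rule sum_mono)
    fix k
    have "(norm (S (pdiff T k y)))\<^sup>2 \<le> (norm S * norm (pdiff T k y))\<^sup>2"
      by (intro power_mono norm_blinfun) auto
    then show "real (Suc k) * (norm (S (pdiff T k y)))\<^sup>2 \<le> (norm S)\<^sup>2 * (real (Suc k) * (norm (pdiff T k y))\<^sup>2)"
      using mult_left_mono[of _ _ "real (Suc k)"] by (fastforce simp: power_mult_distrib mult.left_commute)
  qed
  also have "\<dots> = (norm S)\<^sup>2 * (\<Sum>k<N. real (Suc k) * (norm (pdiff T k y))\<^sup>2)"
    by (rule sum_distrib_left[symmetric])
  also have "\<dots> \<le> (norm S)\<^sup>2 * (M\<^sup>2 * (norm y)\<^sup>2)"
    using T unfolding square_function_bounded_def by (intro mult_left_mono) auto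
  also have "\<dots> \<le> (norm S)\<^sup>2 * (M\<^sup>2 * (norm (op_inverse S) * norm x)\<^sup>2)"
    unfolding y_def by (intro mult_left_mono power_mono norm_blinfun) auto
  finally show "(\<Sum>k<N. real (Suc k) * (norm (pdiff (op_conj S T) k x))\<^sup>2)
      \<le> (norm S * M * norm (op_inverse S))\<^sup>2 * (norm x)\<^sup>2"
    by (simp add: power_mult_distrib mult_ac)
qed

lemma norm_op_conj_le: "norm (op_conj S T) \<le> norm S * norm T * norm (op_inverse S)"
  unfolding op_conj_def by (intro norm_blinfun_compose_le order_refl)

lemma square_op_op_conj:
  assumes S: "op_invertible S" "S \<in> bounded_ops" and T: "square_op T"
  shows "square_op (op_conj S T)"
proof -
  obtain M where M: "\<And>k. norm (opow T k) \<le> M" "square_function_bounded M T"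
    "square_function_bounded M (adj T)" and Tb: "T \<in> bounded_ops"
    using T unfolding square_op_def by blast
  show ?thesis
  proof (rule square_opI)
    show "op_conj S T \<in> bounded_ops" by (rule op_conj_in_bounded_ops[OF S(2,1) Tb])
    show "norm (opow (op_conj S T) k) \<le> norm S * M * norm (op_inverse S)" for k
      unfolding opow_op_conj[OF S(1)]
      by (rule order_trans[OF norm_op_conj_le]) (intro mult_right_mono mult_left_mono M; simp)
    show "square_function_bounded (norm S * M * norm (op_inverse S)) (op_conj S T)"
      by (rule square_function_bounded_op_conj[OF S(1) M(2)])
    show "square_function_bounded (norm (op_inverse (adj S)) * M * norm (op_inverse (op_inverse (adj S))))
        (adj (op_conj S T))"
      unfolding adj_op_conj[OF S Tb]
      by (rule square_function_bounded_op_conj[OF _ M(3)])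
        (use op_invertible_adj[OF S] op_invertible_op_inverse S adj_in_bounded_ops in blast)
  qed
qed

subsection \<open>Contractions\<close>

lemma norm_blinfun_le_one: "norm T \<le> 1 \<Longrightarrow> norm (blinfun_apply T y) \<le> norm y"
  by (rule order_trans[OF norm_blinfun]) (simp add: mult_left_le_one_le)

lemma Cauchy_Schwarz_sum_sqrt:
  fixes f g :: "'b \<Rightarrow> real"
  shows "(\<Sum>i\<in>I. f i * g i) \<le> sqrt (\<Sum>i\<in>I. (f i)\<^sup>2) * sqrt (\<Sum>i\<in>I. (g i)\<^sup>2)"
proof -
  have "(\<Sum>i\<in>I. f i * g i)\<^sup>2 \<le> (\<Sum>i\<in>I. (f i)\<^sup>2) * (\<Sum>i\<in>I. (g i)\<^sup>2)"
    by (rule Cauchy_Schwarz_ineq_sum)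
  then show ?thesis unfolding real_sqrt_mult[symmetric] by (rule real_le_rsqrt)
qed

text \<open>With \<open>A = I - T\<close> and \<open>u\<^sub>n = (I + nA)\<^sup>-\<^sup>1 x\<close>, dissipativity of \<open>-A\<close> makes \<open>\<parallel>u\<^sub>n\<parallel>\<^sup>2\<close> decrease by at least
  \<open>(2n+1) \<parallel>A (I + nA)\<^sup>-\<^sup>1 (I + (n+1)A)\<^sup>-\<^sup>1 x\<parallel>\<^sup>2\<close>, and \<open>T\<^sup>n (I + nA) (I + (n+1)A)\<close> is bounded
  uniformly in \<open>n\<close>.\<close>

lemma contraction_square_function_bounded:
  fixes T :: "'a::complex_hilbert_space \<Rightarrow>\<^sub>L 'a"
  assumes T: "T \<in> bounded_ops" "norm T \<le> 1" and M: "\<And>k. real (Suc k) * norm (pdiff T k) \<le> M"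
  shows "square_function_bounded (1 + 2 * M + 4 * M\<^sup>2) T"
  unfolding square_function_bounded_def
proof (intro allI)
  fix x :: 'a and N :: nat
  \<comment> \<open>The three summands bound the three terms of \<open>T^k (I + kA)(I + (k+1)A) =
    T^k + (2k+1) T^k A + k(k+1) T^k A^2\<close>.\<close>
  define L where "L = 1 + 2 * M + 4 * M\<^sup>2"
  have M0: "0 \<le> M" using M[of 0] order_trans[OF norm_ge_zero] by simp
  have contr: "norm (T y) \<le> norm y" for y
    using T(2) by (rule norm_blinfun_le_one)
  have contr_pow: "norm (opow T k y) \<le> norm y" for k y
  proof (induction k)
    case (Suc k)
    show ?case using order_trans[OF contr Suc] by (simp add: opow_Suc)
  qed simp
  have pd: "real (Suc k) * norm (pdiff T k y) \<le> M * norm y" for k y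
  proof -
    have "real (Suc k) * norm (pdiff T k y) \<le> real (Suc k) * (norm (pdiff T k) * norm y)"
      by (intro mult_left_mono norm_blinfun) auto
    also have "\<dots> \<le> M * norm y" unfolding mult.assoc[symmetric] by (intro mult_right_mono M) auto
    finally show ?thesis .
  qed
  define A where "A y = y - T y" for y
  have A_add: "A (y + z) = A y + A z" and A_scale: "A (r *\<^sub>R y) = r *\<^sub>R A y" for y z r
    by (simp_all add: A_def blinfun.add_right blinfun.scaleR_right scaleR_diff_right)
  define E where "E n y = y + real n *\<^sub>R A y" for n y
  have E_swap: "E m (E n y) = E n (E m y)" for m n y
    by (simp add: E_def A_add A_scale scaleR_add_right mult.commute add_ac)
  have "\<exists>F. (\<forall>y. E n (F y) = y) \<and> (\<forall>y. F (E n y) = y)" for n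
  proof -
    \<comment> \<open>\<open>I + nA = (n+1)(I - K)\<close>, and \<open>K\<close> has norm below one
      although \<open>T\<close> may have norm one.\<close>
    define K where "K = (real n / real (Suc n)) *\<^sub>R T"
    have "norm K \<le> real n / real (Suc n)"
      using T(2) by (simp add: K_def mult_left_le divide_right_mono)
    also have "\<dots> < 1" by simp
    finally have "op_invertible (id_blinfun - K)"
      using T(1) by (intro op_invertible_id_minus) (auto simp: K_def)
    then have inv: "op_invertible (real (Suc n) *\<^sub>R (id_blinfun - K))"
      by (rule op_invertible_scaleR) simp
    have "real (Suc n) *\<^sub>R (y - K y) = E n y" for y
      by (simp add: K_def E_def A_def scaleR_diff_right blinfun.scaleR_left scaleR_add_left)
    then have E: "blinfun_apply (real (Suc n) *\<^sub>R (id_blinfun - K)) y = E n y" for y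
      by (simp add: blinfun.scaleR_left blinfun.diff_left)
    show ?thesis using op_invertible_apply[OF inv] unfolding E by blast
  qed
  then obtain F where F: "E n (F n y) = y" "F n (E n y) = y" for n y by metis
  define u where "u n = F n x" for n
  define w where "w n = F (Suc n) (u n)" for n
  have Eu: "E n (u n) = x" for n by (simp add: u_def F)
  have Ew: "E (Suc n) (w n) = u n" for n by (simp add: w_def F)
  have Ew': "E n (w n) = u (Suc n)" for n
  proof -
    have "E (Suc n) (E n (w n)) = x" by (simp add: E_swap[of "Suc n"] Ew Eu)
    then show ?thesis by (metis F(2) Eu)
  qed
  \<comment> \<open>\<open>w n\<close> links neighbouring resolvents: \<open>I + (n+1)A\<close>
    sends it to \<open>u n\<close> and \<open>I + nA\<close> sends it to \<open>u (Suc n)\<close>,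
    so these differ by \<open>A (w n)\<close>. The cross term contributes
    \<open>2n norm (A (w n))^2\<close> plus a nonnegative dissipation term.\<close>
  have energy: "real (2 * n + 1) * (norm (A (w n)))\<^sup>2 \<le> (norm (u n))\<^sup>2 - (norm (u (Suc n)))\<^sup>2" for n
  proof -
    have "u n = u (Suc n) + A (w n)"
      by (subst Ew[of n, symmetric], subst Ew'[of n, symmetric]) (simp add: E_def algebra_simps)
    then have "(norm (u n))\<^sup>2 = (norm (u (Suc n)))\<^sup>2 + 2 * Re (cinner (u (Suc n)) (A (w n))) + (norm (A (w n)))\<^sup>2"
      by (simp add: norm_add_square)
    moreover have "Re (cinner (u (Suc n)) (A (w n))) = Re (cinner (w n) (A (w n))) + n * (norm (A (w n)))\<^sup>2"
      unfolding Ew'[symmetric] E_def by (simp add: cinner_add_left cinner.scaleR_left)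
    moreover have "0 \<le> Re (cinner (w n) (A (w n)))"
    proof -
      have "Re (cinner (w n) (T (w n))) \<le> norm (w n) * norm (T (w n))"
        by (meson cmod_cinner_le complex_Re_le_cmod order_trans)
      also have "\<dots> \<le> norm (w n) * norm (w n)" by (intro mult_left_mono contr) auto
      finally show ?thesis by (simp add: A_def cinner.diff_right power2_eq_square)
    qed
    ultimately show ?thesis by (simp add: algebra_simps)
  qed
  have "(\<Sum>k<N. real (2 * k + 1) * (norm (A (w k)))\<^sup>2) \<le> (\<Sum>k<N. (norm (u k))\<^sup>2 - (norm (u (Suc k)))\<^sup>2)"
    by (intro sum_mono energy)
  also have "\<dots> = (norm (u 0))\<^sup>2 - (norm (u N))\<^sup>2" by (rule sum_lessThan_telescope')
  also have "\<dots> \<le> (norm x)\<^sup>2"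
    using Eu[of 0] by (simp add: E_def)
  finally have sum: "(\<Sum>k<N. real (2 * k + 1) * (norm (A (w k)))\<^sup>2) \<le> (norm x)\<^sup>2" .
  have bound: "norm (pdiff T k x) \<le> L * norm (A (w k))" for k
  proof -
    define v where "v = A (w k)"
    have Apd: "pdiff T k y = opow T k (A y)" for k y by (simp add: pdiff_apply A_def blinfun.diff_right)
    \<comment> \<open>The power is halved so that each of the two factors \<open>A\<close> meets
      about \<open>k/2\<close> powers of \<open>T\<close>; each half gains a factor of order
      \<open>1/k\<close>, which compensates \<open>k(k+1)\<close>.\<close>
    have AA: "opow T k (A (A v)) = pdiff T (k div 2) (pdiff T (k - k div 2) v)"
    proof -
      have AT: "A (opow T i y) = opow T i (A y)" for i y
        by (simp add: A_def blinfun.diff_right T_opow)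
      show ?thesis
        by (simp add: Apd AT opow_add_apply[symmetric])
    qed
    have "x = E k (E (Suc k) (w k))" by (simp add: Ew Eu)
    then have "A x = v + real (2 * k + 1) *\<^sub>R A v + (real k * real (Suc k)) *\<^sub>R A (A v)"
    proof -
      have "real (2 * k + 1) = real k + real (Suc k)" by simp
      then show ?thesis using \<open>x = E k (E (Suc k) (w k))\<close>
        by (simp only: E_def A_add A_scale v_def[symmetric] scaleR_add_right scaleR_add_left
            scaleR_scaleR add_ac)
    qed
    then have "pdiff T k x = opow T k v + real (2 * k + 1) *\<^sub>R pdiff T k v
        + (real k * real (Suc k)) *\<^sub>R pdiff T (k div 2) (pdiff T (k - k div 2) v)"
      by (simp only: Apd[of k] blinfun.add_right blinfun.scaleR_right AA)
    also have "norm \<dots> \<le> norm v + 2 * M * norm v + 4 * M\<^sup>2 * norm v"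
    proof (intro norm_triangle_mono)
      show "norm (opow T k v) \<le> norm v" by (rule contr_pow)
      have "real (2 * k + 1) * norm (pdiff T k v) \<le> 2 * (real (Suc k) * norm (pdiff T k v))"
        by (simp add: algebra_simps)
      then show "norm (real (2 * k + 1) *\<^sub>R pdiff T k v) \<le> 2 * M * norm v" using pd[of k v] by simp
      define i where "i = k div 2"
      define j where "j = k - k div 2"
      have "real k \<le> real (2 * Suc i)" "real (Suc k) \<le> real (2 * Suc j)"
        unfolding i_def j_def of_nat_le_iff by presburger+
      then have "real k \<le> 2 * real (Suc i)" "real (Suc k) \<le> 2 * real (Suc j)"
        unfolding of_nat_mult of_nat_numeral .
      then have kk: "real k * real (Suc k) \<le> (2 * real (Suc i)) * (2 * real (Suc j))"
        by (intro mult_mono) auto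
      have "real k * real (Suc k) * norm (pdiff T i (pdiff T j v))
          \<le> 4 * (real (Suc j) * (real (Suc i) * norm (pdiff T i (pdiff T j v))))"
        using mult_right_mono[OF kk norm_ge_zero[of "pdiff T i (pdiff T j v)"]]
        by (simp add: mult_ac del: of_nat_Suc)
      also have "\<dots> \<le> 4 * (real (Suc j) * (M * norm (pdiff T j v)))"
        by (intro mult_left_mono pd) auto
      also have "\<dots> \<le> 4 * (M * (M * norm v))"
        using mult_left_mono[OF pd[of j v] M0] by (simp add: mult_ac)
      finally show "norm ((real k * real (Suc k)) *\<^sub>R pdiff T (k div 2) (pdiff T (k - k div 2) v))
          \<le> 4 * M\<^sup>2 * norm v"
        by (simp add: i_def j_def power2_eq_square mult_ac)
    qed
    finally show ?thesis by (simp add: L_def v_def algebra_simps)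
  qed
  have "(\<Sum>k<N. real (Suc k) * (norm (pdiff T k x))\<^sup>2)
      \<le> (\<Sum>k<N. L\<^sup>2 * (real (2 * k + 1) * (norm (A (w k)))\<^sup>2))"
  proof (rule sum_mono)
    fix k
    have "real (Suc k) * (norm (pdiff T k x))\<^sup>2 \<le> real (2 * k + 1) * (L * norm (A (w k)))\<^sup>2"
      by (intro mult_mono power_mono bound) auto
    then show "real (Suc k) * (norm (pdiff T k x))\<^sup>2 \<le> L\<^sup>2 * (real (2 * k + 1) * (norm (A (w k)))\<^sup>2)"
      by (simp add: power_mult_distrib mult_ac)
  qed
  also have "\<dots> \<le> L\<^sup>2 * (norm x)\<^sup>2"
    unfolding sum_distrib_left[symmetric] by (intro mult_left_mono sum) auto
  finally show "(\<Sum>k<N. real (Suc k) * (norm (pdiff T k x))\<^sup>2) \<le> (1 + 2 * M + 4 * M\<^sup>2)\<^sup>2 * (norm x)\<^sup>2"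
    by (simp add: L_def)
qed

lemma similar_to_contraction_square_function:
  assumes T: "T \<in> bounded_ops" and S: "S \<in> bounded_ops" "op_invertible S"
    and contr: "norm (op_conj S T) \<le> 1" and M: "\<And>k. real (Suc k) * norm (pdiff T k) \<le> M"
  shows "\<exists>M'. square_function_bounded M' T"
proof -
  note S' = op_invertible_op_inverse[OF S(2,1)]
  have "real (Suc k) * norm (pdiff (op_conj S T) k) \<le> norm S * M * norm (op_inverse S)" for k
  proof -
    have "real (Suc k) * norm (pdiff (op_conj S T) k)
        \<le> real (Suc k) * (norm S * norm (pdiff T k) * norm (op_inverse S))"
      unfolding pdiff_op_conj[OF S(2)] by (intro mult_left_mono norm_op_conj_le) auto
    also have "\<dots> = norm S * (real (Suc k) * norm (pdiff T k)) * norm (op_inverse S)"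
      by (simp add: mult_ac)
    also have "\<dots> \<le> norm S * M * norm (op_inverse S)"
      by (intro mult_right_mono mult_left_mono M) auto
    finally show ?thesis .
  qed
  from contraction_square_function_bounded[OF op_conj_in_bounded_ops[OF S T] contr this]
  have "\<exists>M'. square_function_bounded M' (op_conj S T)" by blast
  then show ?thesis
    using square_function_bounded_op_conj[OF S'(1)] op_conj_op_inverse[OF S(2,1)] by metis
qed

text \<open>The adjoint of the contraction \<open>op_conj S T\<close> is a contraction similar to
  \<open>adj T\<close>, so the one-sided estimate applies twice.\<close>

lemma similar_to_contraction_square_op:
  assumes T: "T \<in> bounded_ops" and sim: "similar_to_contraction T"
    and M: "\<And>k. real (Suc k) * norm (pdiff T k) \<le> M"
  shows "square_op T"
proof -
  obtain S where S: "S \<in> bounded_ops" "op_invertible S" and contr: "norm (op_conj S T) \<le> 1"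
    using sim unfolding similar_to_contraction_def op_contraction_def by blast
  note S' = op_invertible_op_inverse[OF S(2,1)]
  obtain M1 where M1: "square_function_bounded M1 T"
    using similar_to_contraction_square_function[OF T S contr M] by blast
  have Si: "op_inverse (adj S) \<in> bounded_ops" "op_invertible (op_inverse (adj S))"
    using op_invertible_adj[OF S(2,1)] op_invertible_op_inverse adj_in_bounded_ops[OF S(1)]
      op_invertibleD(1) by blast+
  have "norm (op_conj (op_inverse (adj S)) (adj T)) \<le> 1"
    unfolding adj_op_conj[OF S(2,1) T, symmetric] using contr
    by (simp add: norm_adj op_conj_in_bounded_ops[OF S T])
  moreover have "real (Suc k) * norm (pdiff (adj T) k) \<le> M" for k
    using M[of k] by (simp add: adj_pdiff[OF T, symmetric] norm_adj T)
  ultimately obtain M2 where M2: "square_function_bounded M2 (adj T)"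
    using similar_to_contraction_square_function[OF adj_in_bounded_ops[OF T] Si] by blast
  have pow: "norm (opow (op_conj S T) k) \<le> 1" for k
  proof (induction k)
    case (Suc k)
    then show ?case using norm_blinfun_compose_le[OF contr Suc] by (simp add: opow_Suc)
  qed (simp add: norm_blinfun_id_le)
  have "norm (opow T k) \<le> norm (op_inverse S) * norm S" for k
  proof -
    have "opow T k = op_conj (op_inverse S) (opow (op_conj S T) k)"
      by (metis opow_op_conj S(2,1) S'(1) op_conj_op_inverse)
    then have "norm (opow T k) \<le> norm (op_inverse S) * norm (opow (op_conj S T) k) * norm S"
      by (metis norm_op_conj_le S'(2))
    also have "\<dots> \<le> norm (op_inverse S) * 1 * norm S"
      by (intro mult_right_mono mult_left_mono pow) auto
    finally show ?thesis by simp
  qed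
  then show ?thesis by (rule square_opI[OF T _ M1 M2])
qed

subsection \<open>Joint similarity\<close>

text \<open>The telescoping identity is \<open>(k+1) z\<^sup>2\<^sup>k (1 - z\<^sup>2)\<^sup>2 = g\<^sub>k - g\<^sub>k\<^sub>+\<^sub>1\<close> with
  \<open>g\<^sub>k = z\<^sup>2\<^sup>k + k (z\<^sup>2\<^sup>k - z\<^sup>2\<^sup>k\<^sup>+\<^sup>2)\<close>; even powers allow \<open>T\<^sup>2\<^sup>k (I - T)\<^sup>2\<close> to be split evenly between
  the square functions of \<open>T\<close> and of its adjoint.\<close>

lemma square_op_mean_ergodic:
  assumes T: "square_op T"
  obtains P L where "\<And>x. (\<lambda>N. opow T (2 * N) x) \<longlonglongrightarrow> P x" and "0 \<le> L"
    and "\<And>x. (norm (x - P x))\<^sup>2 \<le> L * (\<Sum>k. real (Suc k) * (norm (pdiff T k x))\<^sup>2)"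
    and "\<And>x. (\<lambda>N. pdiff T (2 * N) x) \<longlonglongrightarrow> 0"
proof -
  obtain M where Mp: "\<And>k. norm (opow T k) \<le> M" and M1: "square_function_bounded M T"
    and M2: "square_function_bounded M (adj T)" and Tb: "T \<in> bounded_ops"
    using T unfolding square_op_def by blast
  have M0: "0 \<le> M" using Mp[of 0] norm_ge_zero order_trans by blast
  have pow: "norm (opow T k y) \<le> M * norm y" for k y
    by (rule order_trans[OF norm_blinfun mult_right_mono[OF Mp]]) auto
  \<comment> \<open>\<open>(1 + M)^2\<close> bounds the operator \<open>J = (I + T)^2\<close> below,
    and the last \<open>M\<close> comes from the square function of the adjoint.\<close>
  define L where "L = ((1 + M) * (1 + M) * M)\<^sup>2"
  have T1: "norm (y + T y) \<le> (1 + M) * norm y" for y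
    using norm_triangle_ineq[of y "T y"] pow[of 1 y] by (simp add: opow_Suc algebra_simps)
  define g where "g x k = real (Suc k) * (norm (pdiff T k x))\<^sup>2" for x k
  have g0: "0 \<le> g x k" for x k by (simp add: g_def)
  have gM: "(\<Sum>k<N. g x k) \<le> M\<^sup>2 * (norm x)\<^sup>2" for x N
    using M1 unfolding square_function_bounded_def g_def by blast
  have gs: "summable (g x)" for x
    by (rule summableI_nonneg_bounded[OF g0 gM])
  have gtail: "(\<lambda>N. \<Sum>k\<in>{N..<2 * N}. g x k) \<longlonglongrightarrow> 0" for x
  proof (rule LIMSEQ_I)
    fix e :: real assume "0 < e"
    then obtain N where "\<And>m n. N \<le> m \<Longrightarrow> norm (sum (g x) {m..<n}) < e"
      using gs[of x] unfolding summable_Cauchy by blast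
    then show "\<exists>no. \<forall>n\<ge>no. norm ((\<Sum>k\<in>{n..<2 * n}. g x k) - 0) < e" by auto
  qed
  define v where "v x N = opow T (2 * N) x" for x N
  \<comment> \<open>\<open>U x N\<close> is \<open>g_N(T) x\<close> for the telescoping polynomials.
    The factor \<open>J\<close> arises from
    \<open>(1 - z^2)^2 = (1 + z)^2 (1 - z)^2\<close>.\<close>
  define U where "U x N = v x N + real N *\<^sub>R (v x N - v x (Suc N))" for x N
  define J where "J y = (y + T y) + T (y + T y)" for y
  have vdiff: "v x N - v x (Suc N) = pdiff T (2 * N) (x + T x)" for x N
    by (simp add: v_def pdiff_apply opow_Suc T_opow blinfun.add_right)
  have tele: "U x k - U x (Suc k) = real (Suc k) *\<^sub>R pdiff T k (J (pdiff T k x))" for x k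
  proof -
    have "U x k - U x (Suc k) = real (Suc k) *\<^sub>R (v x k - 2 *\<^sub>R v x (Suc k) + v x (Suc (Suc k)))"
      by (simp add: U_def algebra_simps scaleR_2)
    also have "v x k - 2 *\<^sub>R v x (Suc k) + v x (Suc (Suc k)) = pdiff T k (J (pdiff T k x))"
    proof -
      have v: "v y k = opow T k (opow T k y)" for y
        by (simp add: v_def mult_2 opow_add_apply)
      have vS: "v y (Suc k) = v (T (T y)) k" for y k
        by (simp add: v_def opow_Suc T_opow)
      show ?thesis
        by (simp add: vS v J_def pdiff_apply T_opow blinfun.add_right blinfun.diff_right scaleR_2)
    qed
    finally show ?thesis .
  qed
  have J: "norm (J y) \<le> (1 + M) * (1 + M) * norm y" for y
    unfolding J_def mult.assoc
    by (rule order_trans[OF T1 mult_left_mono[OF T1]]) (use M0 in simp)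
  have U_diff: "(norm (U x m - U x n))\<^sup>2 \<le> L * (\<Sum>k\<in>{m..<n}. g x k)" if mn: "m \<le> n" for x m n
  proof -
    define s where "s = (\<Sum>k\<in>{m..<n}. g x k)"
    have s0: "0 \<le> s" unfolding s_def by (intro sum_nonneg g0)
    have U: "U x m - U x n = (\<Sum>k\<in>{m..<n}. real (Suc k) *\<^sub>R pdiff T k (J (pdiff T k x)))"
      using sum_Suc_diff'[OF mn, of "\<lambda>k. - U x k"]
      unfolding tele[symmetric] by simp
    have "norm (U x m - U x n) \<le> (1 + M) * (1 + M) * M * sqrt s"
    \<comment> \<open>Duality: against \<open>y\<close>, one factor \<open>pdiff T k\<close> passes
      to the adjoint. Cauchy-Schwarz with the weight split as \<open>sqrt (k+1)\<close> twice then
      pairs the two square functions, leaving only a tail of the one for \<open>x\<close>.\<close>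
    proof (rule norm_le_cinner)
      fix y
      have "cmod (cinner (U x m - U x n) y)
          \<le> (\<Sum>k\<in>{m..<n}. cmod (cinner (real (Suc k) *\<^sub>R pdiff T k (J (pdiff T k x))) y))"
        unfolding U cinner.sum_left by (rule norm_sum)
      also have "\<dots> \<le> (\<Sum>k\<in>{m..<n}. (1 + M) * (1 + M) *
          ((sqrt (real (Suc k)) * norm (pdiff T k x)) * (sqrt (real (Suc k)) * norm (pdiff (adj T) k y))))"
      proof (rule sum_mono)
        fix k
        have "cmod (cinner (real (Suc k) *\<^sub>R pdiff T k (J (pdiff T k x))) y)
            = real (Suc k) * cmod (cinner (J (pdiff T k x)) (pdiff (adj T) k y))"
          unfolding cinner.scaleR_left cinner_adj[OF pdiff_in_bounded_ops[OF Tb]] adj_pdiff[OF Tb] by simp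
        also have "\<dots> \<le> real (Suc k) * ((1 + M) * (1 + M) * norm (pdiff T k x) * norm (pdiff (adj T) k y))"
          by (intro mult_left_mono order_trans[OF cmod_cinner_le] mult_right_mono J) auto
        also have "\<dots> = (1 + M) * (1 + M) * ((sqrt (real (Suc k)) * norm (pdiff T k x))
            * (sqrt (real (Suc k)) * norm (pdiff (adj T) k y)))"
        proof -
          have "s * (c * a * b) = c * ((r * a) * (r * b))" if "r * r = s" for r s c a b :: real
            unfolding that[symmetric] by (simp add: mult_ac)
          from this[of "sqrt (real (Suc k))"] show ?thesis by simp
        qed
        finally show "cmod (cinner (real (Suc k) *\<^sub>R pdiff T k (J (pdiff T k x))) y) \<le> (1 + M) * (1 + M) *
          ((sqrt (real (Suc k)) * norm (pdiff T k x)) * (sqrt (real (Suc k)) * norm (pdiff (adj T) k y)))" .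
      qed
      also have "\<dots> \<le> (1 + M) * (1 + M) * (sqrt (\<Sum>k\<in>{m..<n}. (sqrt (real (Suc k)) * norm (pdiff T k x))\<^sup>2)
          * sqrt (\<Sum>k\<in>{m..<n}. (sqrt (real (Suc k)) * norm (pdiff (adj T) k y))\<^sup>2))"
        unfolding sum_distrib_left[symmetric] by (intro mult_left_mono Cauchy_Schwarz_sum_sqrt) (use M0 in auto)
      also have "\<dots> \<le> (1 + M) * (1 + M) * (sqrt s * (M * norm y))"
      proof (intro mult_left_mono mult_mono)
        show "sqrt (\<Sum>k\<in>{m..<n}. (sqrt (real (Suc k)) * norm (pdiff T k x))\<^sup>2) \<le> sqrt s"
          by (simp add: s_def g_def power_mult_distrib)
        have "(\<Sum>k\<in>{m..<n}. (sqrt (real (Suc k)) * norm (pdiff (adj T) k y))\<^sup>2)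
            \<le> (\<Sum>k<n. real (Suc k) * (norm (pdiff (adj T) k y))\<^sup>2)"
          by (subst power_mult_distrib, subst real_sqrt_pow2) (auto intro!: sum_mono2)
        also have "\<dots> \<le> (M * norm y)\<^sup>2"
          using M2 unfolding square_function_bounded_def by (simp add: power_mult_distrib)
        finally show "sqrt (\<Sum>k\<in>{m..<n}. (sqrt (real (Suc k)) * norm (pdiff (adj T) k y))\<^sup>2) \<le> M * norm y"
          using M0 by (intro real_le_lsqrt) (auto intro: sum_nonneg)
      qed (use M0 s0 in \<open>auto intro: sum_nonneg\<close>)
      finally show "cmod (cinner (U x m - U x n) y) \<le> (1 + M) * (1 + M) * M * sqrt s * norm y"
        by (simp add: mult_ac)
    qed (use M0 s0 in auto)
    then have "(norm (U x m - U x n))\<^sup>2 \<le> ((1 + M) * (1 + M) * M * sqrt s)\<^sup>2"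
      by (intro power_mono) auto
    then show ?thesis using s0 by (simp add: L_def s_def[symmetric] power_mult_distrib)
  qed
  have Npd: "(\<lambda>N. real N *\<^sub>R pdiff T (2 * N) x) \<longlonglongrightarrow> 0" for x
  proof (rule tendsto_norm_zero_cancel, rule tendsto_sandwich[of "\<lambda>_. 0"])
    \<comment> \<open>Power boundedness dominates \<open>T^(2N) (I - T) x\<close> by each term with
      \<open>N <= k < 2N\<close>. Averaging over these \<open>N\<close> indices, whose weights are
      at least \<open>N\<close>, bounds the square by a block of a convergent series.\<close>
    have "norm (real N *\<^sub>R pdiff T (2 * N) x) \<le> sqrt (M\<^sup>2 * (\<Sum>k\<in>{N..<2 * N}. g x k))" for N
    proof (rule real_le_rsqrt)
      have "real N * (norm (real N *\<^sub>R pdiff T (2 * N) x))\<^sup>2 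
          = (\<Sum>k\<in>{N..<2 * N}. (norm (real N *\<^sub>R pdiff T (2 * N) x))\<^sup>2)" by simp
      also have "\<dots> \<le> (\<Sum>k\<in>{N..<2 * N}. real N * (M\<^sup>2 * g x k))"
      proof (rule sum_mono)
        fix k assume k: "k \<in> {N..<2 * N}"
        have "pdiff T (2 * N) x = opow T (2 * N - k) (pdiff T k x)" using k by (simp add: opow_pdiff)
        then have "norm (pdiff T (2 * N) x) \<le> M * norm (pdiff T k x)" by (simp add: pow)
        then have "(norm (pdiff T (2 * N) x))\<^sup>2 \<le> M\<^sup>2 * (norm (pdiff T k x))\<^sup>2"
          unfolding power_mult_distrib[symmetric] by (intro power_mono) auto
        then have "real N * (real N * (norm (pdiff T (2 * N) x))\<^sup>2)
            \<le> real N * (real (Suc k) * (M\<^sup>2 * (norm (pdiff T k x))\<^sup>2))"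
          using k by (intro mult_left_mono mult_mono) auto
        then show "(norm (real N *\<^sub>R pdiff T (2 * N) x))\<^sup>2 \<le> real N * (M\<^sup>2 * g x k)"
          by (simp add: g_def power_mult_distrib power2_eq_square[of "real N"] mult_ac)
      qed
      also have "\<dots> = real N * (M\<^sup>2 * (\<Sum>k\<in>{N..<2 * N}. g x k))" by (simp add: sum_distrib_left)
      finally show "(norm (real N *\<^sub>R pdiff T (2 * N) x))\<^sup>2 \<le> M\<^sup>2 * (\<Sum>k\<in>{N..<2 * N}. g x k)"
        by (cases "N = 0") auto
    qed
    then show "\<forall>\<^sub>F N in sequentially. norm (real N *\<^sub>R pdiff T (2 * N) x)
        \<le> sqrt (M\<^sup>2 * (\<Sum>k\<in>{N..<2 * N}. g x k))" by simp
    have "(\<lambda>N. sqrt (M\<^sup>2 * (\<Sum>k\<in>{N..<2 * N}. g x k))) \<longlonglongrightarrow> sqrt (M\<^sup>2 * 0)"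
      by (intro tendsto_intros gtail)
    then show "(\<lambda>N. sqrt (M\<^sup>2 * (\<Sum>k\<in>{N..<2 * N}. g x k))) \<longlonglongrightarrow> 0" by simp
  qed auto
  have L0: "0 \<le> L" by (simp add: L_def)
  have "Cauchy (U x)" for x
  proof (rule metric_CauchyI)
    fix e :: real assume e: "0 < e"
    then have "0 < e\<^sup>2 / (L + 1)" using L0 by (intro divide_pos_pos) auto
    then obtain N where N: "\<And>m n. N \<le> m \<Longrightarrow> norm (sum (g x) {m..<n}) < e\<^sup>2 / (L + 1)"
      using gs[of x] unfolding summable_Cauchy by blast
    have *: "norm (U x m - U x n) < e" if "N \<le> m" "m \<le> n" for m n
    proof -
      have "L * sum (g x) {m..<n} \<le> (L + 1) * sum (g x) {m..<n}"
        by (intro mult_right_mono sum_nonneg g0) auto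
      also have "\<dots> < e\<^sup>2" using N[OF that(1), of n] L0 by (simp add: field_simps sum_nonneg g0)
      finally have "(norm (U x m - U x n))\<^sup>2 < e\<^sup>2" using U_diff[OF that(2), of x] by linarith
      then show ?thesis using e by (simp add: power_less_imp_less_base)
    qed
    have "dist (U x m) (U x n) < e" if "N \<le> m" "N \<le> n" for m n
      using *[of m n] *[of n m] that by (cases "m \<le> n") (auto simp: dist_norm norm_minus_commute)
    then show "\<exists>N. \<forall>m\<ge>N. \<forall>n\<ge>N. dist (U x m) (U x n) < e" by blast
  qed
  then have "\<forall>x. \<exists>z. U x \<longlonglongrightarrow> z" using Cauchy_convergent_iff convergent_def by blast
  then obtain P where P: "\<And>x. U x \<longlonglongrightarrow> P x" by metis
  show thesis
  proof (rule that)
    show "(\<lambda>N. opow T (2 * N) x) \<longlonglongrightarrow> P x" for x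
    proof -
      have "(\<lambda>N. U x N - real N *\<^sub>R pdiff T (2 * N) (x + T x)) \<longlonglongrightarrow> P x - 0"
        by (intro tendsto_diff P Npd)
      then show ?thesis by (simp add: U_def vdiff) (simp add: v_def)
    qed
    show "(norm (x - P x))\<^sup>2 \<le> L * (\<Sum>k. real (Suc k) * (norm (pdiff T k x))\<^sup>2)" for x
    proof (rule Lim_bounded)
      show "(\<lambda>N. (norm (x - U x N))\<^sup>2) \<longlonglongrightarrow> (norm (x - P x))\<^sup>2" by (intro tendsto_intros P)
      show "\<forall>N\<ge>0. (norm (x - U x N))\<^sup>2 \<le> L * (\<Sum>k. real (Suc k) * (norm (pdiff T k x))\<^sup>2)"
      proof (intro allI impI)
        fix N
        have "(norm (U x 0 - U x N))\<^sup>2 \<le> L * (\<Sum>k\<in>{0..<N}. g x k)" by (rule U_diff) simp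
        also have "\<dots> \<le> L * suminf (g x)"
          by (intro mult_left_mono sum_le_suminf gs L0) (auto simp: g0)
        finally have "(norm (U x 0 - U x N))\<^sup>2 \<le> L * suminf (g x)" .
        moreover have "U x 0 = x" by (simp add: U_def v_def)
        ultimately show "(norm (x - U x N))\<^sup>2 \<le> L * (\<Sum>k. real (Suc k) * (norm (pdiff T k x))\<^sup>2)"
          unfolding g_def[symmetric] by simp
      qed
    qed
    show "(\<lambda>N. pdiff T (2 * N) x) \<longlonglongrightarrow> 0" for x
    proof -
      have "(\<lambda>N. inverse (real (Suc N)) *\<^sub>R (real (Suc N) *\<^sub>R pdiff T (2 * Suc N) x)) \<longlonglongrightarrow> 0 *\<^sub>R 0"
        by (intro tendsto_scaleR LIMSEQ_inverse_real_of_nat LIMSEQ_Suc[OF Npd])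
      then have "(\<lambda>N. pdiff T (2 * Suc N) x) \<longlonglongrightarrow> 0" by simp
      then show ?thesis by (rule LIMSEQ_imp_Suc)
    qed
  qed (rule L0)
qed

text \<open>\<open>T\<close> contracts the new norm because \<open>P T = P\<close> and because
  replacing \<open>x\<close> by \<open>T x\<close> shifts the series, dropping its first term and
  lowering the weights. A contraction commuting with \<open>T\<close> commutes with \<open>P\<close>
  and with every difference, so it contracts each term separately.\<close>

lemma square_op_similarity:
  fixes T :: "'a::complex_hilbert_space \<Rightarrow>\<^sub>L 'a"
  assumes T: "square_op T"
  shows "\<exists>S\<in>bounded_ops. op_invertible S \<and> (\<forall>x. norm (blinfun_apply S (T x)) \<le> norm (S x)) \<and>
    (\<forall>R\<in>bounded_ops. norm R \<le> 1 \<longrightarrow> op_commute R T \<longrightarrow> (\<forall>x. norm (S (blinfun_apply R x)) \<le> norm (S x)))"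
proof -
  obtain M where Mp: "\<And>k. norm (opow T k) \<le> M" and M1: "square_function_bounded M T"
    and Tb: "T \<in> bounded_ops"
    using T unfolding square_op_def by blast
  have M0: "0 \<le> M" using Mp[of 0] norm_ge_zero order_trans by blast
  have pow: "norm (opow T k y) \<le> M * norm y" for k y
    by (rule order_trans[OF norm_blinfun mult_right_mono[OF Mp]]) auto
  obtain P L where P: "\<And>x. (\<lambda>N. opow T (2 * N) x) \<longlonglongrightarrow> P x" and L0: "0 \<le> L"
    and low: "\<And>x. (norm (x - P x))\<^sup>2 \<le> L * (\<Sum>k. real (Suc k) * (norm (pdiff T k x))\<^sup>2)"
    and pd0: "\<And>x. (\<lambda>N. pdiff T (2 * N) x) \<longlonglongrightarrow> 0"
    using square_op_mean_ergodic[OF T] by blast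
  define g where "g x k = real (Suc k) * (norm (pdiff T k x))\<^sup>2" for x k
  have g0: "0 \<le> g x k" for x k by (simp add: g_def)
  have gM: "(\<Sum>k<N. g x k) \<le> M\<^sup>2 * (norm x)\<^sup>2" for x N
    using M1 unfolding square_function_bounded_def g_def by blast
  have gs: "summable (g x)" for x
    by (rule summableI_nonneg_bounded[OF g0 gM])
  define h where "h x y k = complex_of_real (real (Suc k)) * cinner (pdiff T k x) (pdiff T k y)" for x y k
  have hs: "summable (h x y)" for x y
  proof (rule summable_comparison_test'[of "\<lambda>k. g x k + g y k" 0])
    show "summable (\<lambda>k. g x k + g y k)" by (intro summable_add gs)
    fix k
    have "cmod (cinner (pdiff T k x) (pdiff T k y)) \<le> norm (pdiff T k x) * norm (pdiff T k y)"
      by (rule cmod_cinner_le)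
    also have "\<dots> \<le> (norm (pdiff T k x))\<^sup>2 + (norm (pdiff T k y))\<^sup>2"
      using sum_squares_bound[of "norm (pdiff T k x)" "norm (pdiff T k y)"]
        mult_nonneg_nonneg[OF norm_ge_zero norm_ge_zero, of "pdiff T k x" "pdiff T k y"] by linarith
    finally have "real (Suc k) * cmod (cinner (pdiff T k x) (pdiff T k y))
        \<le> real (Suc k) * ((norm (pdiff T k x))\<^sup>2 + (norm (pdiff T k y))\<^sup>2)"
      by (rule mult_left_mono) simp
    then show "norm (h x y k) \<le> g x k + g y k"
      unfolding h_def g_def norm_mult by (simp add: distrib_left del: of_nat_Suc)
  qed
  define b where "b x y = cinner (P x) (P y) + suminf (h x y)" for x y
  have P_add: "P (x + y) = P x + P y" for x y
    by (rule LIMSEQ_unique[OF P]) (unfold blinfun.add_right, intro tendsto_add P)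
  have P_scale: "P (a *\<^sub>C x) = a *\<^sub>C P x" for a x
    by (rule LIMSEQ_unique[OF P])
      (unfold bounded_ops_scaleC[OF opow_in_bounded_ops[OF Tb]],
        intro bounded_linear.tendsto[OF bounded_linear_scaleC] P)
  have h_self: "h x x k = of_real (g x k)" for x k
    by (simp add: h_def g_def cinner_self)
  have b_self: "Re (b x x) = (norm (P x))\<^sup>2 + suminf (g x)" for x
  proof -
    have "h x x = (\<lambda>k. of_real (g x k))" by (rule ext) (rule h_self)
    then show ?thesis by (simp add: b_def suminf_of_real[OF gs, symmetric])
  qed
  have sg0: "0 \<le> suminf (g x)" for x by (intro suminf_nonneg gs g0)
  have sgM: "suminf (g x) \<le> M\<^sup>2 * (norm x)\<^sup>2" for x by (rule suminf_le_const[OF gs gM])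
  have b_psd: "psd_form b"
    unfolding psd_form_def
  proof (intro conjI allI)
    show "b (x + y) z = b x z + b y z" for x y z
    proof -
      have "h (x + y) z k = h x z k + h y z k" for k
        by (simp add: h_def blinfun.add_right cinner_add_left distrib_left)
      then have "h (x + y) z = (\<lambda>k. h x z k + h y z k)" by (rule ext)
      then show ?thesis
        using suminf_add[OF hs hs, of x z y z] by (simp add: b_def P_add cinner_add_left)
    qed
    show "b (a *\<^sub>C x) y = a * b x y" for a x y
    proof -
      have "h (a *\<^sub>C x) y k = a * h x y k" for k
        by (simp add: h_def bounded_ops_scaleC[OF pdiff_in_bounded_ops[OF Tb]] cinner_scaleC_left)
      then have "h (a *\<^sub>C x) y = (\<lambda>k. a * h x y k)" by (rule ext)
      then show ?thesis
        by (simp add: b_def P_scale cinner_scaleC_left suminf_mult[OF hs] distrib_left)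
    qed
    show "b y x = cnj (b x y)" for x y
    proof -
      have "h y x k = cnj (h x y k)" for k
        by (simp add: h_def cinner_commute[of "pdiff T k y"])
      then have "h y x = (\<lambda>k. cnj (h x y k))" by (rule ext)
      moreover have "(\<lambda>k. cnj (h x y k)) sums cnj (suminf (h x y))"
        unfolding sums_cnj by (rule summable_sums[OF hs])
      ultimately have "suminf (h y x) = cnj (suminf (h x y))" by (simp add: sums_iff)
      then show ?thesis by (simp add: b_def cinner_commute[of "P y"])
    qed
    show "0 \<le> Re (b x x)" for x unfolding b_self using sg0[of x] by simp
  qed
  have "\<exists>S\<in>bounded_ops. op_invertible S \<and> (\<forall>x. (norm (blinfun_apply S x))\<^sup>2 = Re (b x x))"
  \<comment> \<open>Lower constant: split \<open>x = P x + (x - P x)\<close> and bound the second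
    part by \<open>L\<close> times the series. Upper constant: \<open>P\<close> and the square
    function contribute \<open>M^2\<close> each.\<close>
  proof (rule equivalent_form_similarity[OF b_psd, of "1 / (2 + 2 * L)" "2 * M\<^sup>2"])
    show "0 < 1 / (2 + 2 * L)" using L0 by simp
    show "1 / (2 + 2 * L) * (norm x)\<^sup>2 \<le> Re (b x x)" for x
    proof -
      have "(norm x)\<^sup>2 \<le> (norm (P x) + norm (x - P x))\<^sup>2"
        using norm_triangle_ineq[of "P x" "x - P x"] by (intro power_mono) auto
      also have "\<dots> \<le> 2 * (norm (P x))\<^sup>2 + 2 * (norm (x - P x))\<^sup>2"
        using sum_squares_bound[of "norm (P x)" "norm (x - P x)"] by (simp add: power2_sum)
      also have "\<dots> \<le> 2 * (norm (P x))\<^sup>2 + 2 * (L * suminf (g x))"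
        using low[of x, folded g_def] by simp
      also have "\<dots> \<le> (2 + 2 * L) * ((norm (P x))\<^sup>2 + suminf (g x))"
        using L0 sg0[of x] by (simp add: algebra_simps)
      finally show ?thesis using L0 by (simp add: b_self field_simps)
    qed
    show "Re (b x x) \<le> 2 * M\<^sup>2 * (norm x)\<^sup>2" for x
    proof -
      have "norm (P x) \<le> M * norm x"
        by (rule Lim_bounded[OF tendsto_norm[OF P]]) (use pow in auto)
      then have "(norm (P x))\<^sup>2 \<le> M\<^sup>2 * (norm x)\<^sup>2"
        unfolding power_mult_distrib[symmetric] by (intro power_mono) auto
      then show ?thesis using sgM[of x] by (simp add: b_self)
    qed
  qed simp
  then obtain S where S: "S \<in> bounded_ops" "op_invertible S"
    and nS: "\<And>x. (norm (S x))\<^sup>2 = (norm (P x))\<^sup>2 + suminf (g x)"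
    unfolding b_self by blast
  have leI: "norm (S y) \<le> norm (S x)" if "norm (P y) \<le> norm (P x)" "suminf (g y) \<le> suminf (g x)" for x y
  proof -
    have "(norm (P y))\<^sup>2 \<le> (norm (P x))\<^sup>2" using that by (intro power_mono) auto
    then have "(norm (S y))\<^sup>2 \<le> (norm (S x))\<^sup>2" unfolding nS using that by linarith
    then show ?thesis by (simp add: power2_le_iff_abs_le)
  qed
  have "norm (S (T x)) \<le> norm (S x)" for x
  proof (rule leI)
    \<comment> \<open>The limit is defined along even powers; decay of the differences gives the
      same limit for \<open>T x\<close>.\<close>
    have "(\<lambda>N. opow T (2 * N) x - pdiff T (2 * N) x) \<longlonglongrightarrow> P x - 0" by (intro tendsto_diff P pd0)
    then have "(\<lambda>N. opow T (2 * N) (T x)) \<longlonglongrightarrow> P x" by (simp add: pdiff_apply)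
    then have "P (T x) = P x" by (rule LIMSEQ_unique[OF P])
    then show "norm (P (T x)) \<le> norm (P x)" by simp
    have "g (T x) k \<le> g x (Suc k)" for k
    proof -
      have "pdiff T k (T x) = pdiff T (Suc k) x"
        by (simp add: pdiff_apply opow_Suc T_opow)
      then show ?thesis by (simp add: g_def mult_right_mono)
    qed
    then have "suminf (g (T x)) \<le> (\<Sum>k. g x (Suc k))"
      by (intro suminf_le gs) (use gs[of x] summable_Suc_iff in auto)
    also have "\<dots> = suminf (g x) - g x 0" by (rule suminf_split_head[OF gs])
    finally show "suminf (g (T x)) \<le> suminf (g x)" using g0[of x 0] by linarith
  qed
  moreover have "norm (S (R x)) \<le> norm (S x)"
    if R: "R \<in> bounded_ops" "norm R \<le> 1" "op_commute R T" for R x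
  proof (rule leI)
    have contr: "norm (R y) \<le> norm y" for y
      using R(2) by (rule norm_blinfun_le_one)
    have comm: "R (T y) = T (R y)" for y
      using R(3) unfolding op_commute_def by (metis blinfun_apply_blinfun_compose)
    have "P (R x) = R (P x)"
    proof (rule LIMSEQ_unique[OF P])
      have "(\<lambda>N. R (opow T (2 * N) x)) \<longlonglongrightarrow> R (P x)" by (intro blinfun.tendsto tendsto_const P)
      then show "(\<lambda>N. opow T (2 * N) (R x)) \<longlonglongrightarrow> R (P x)"
        by (simp add: opow_commute_apply[of "blinfun_apply R" T] comm)
    qed
    then show "norm (P (R x)) \<le> norm (P x)" by (simp add: contr)
    have "g (R x) k \<le> g x k" for k
    proof -
      have "pdiff T k (R x) = R (pdiff T k x)"
        by (rule pdiff_commute_apply[symmetric]) (auto simp: Tb comm blinfun.bounded_linear_right)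
      then show ?thesis unfolding g_def by (intro mult_left_mono power_mono) (auto simp: contr)
    qed
    then show "suminf (g (R x)) \<le> suminf (g x)" by (intro suminf_le gs)
  qed
  ultimately show ?thesis using S by blast
qed

text \<open>The next operator is conjugated by the \<open>S\<close> found so far before it is
  renormed, so \<open>square_op\<close> has to survive similarity. The operators that are already
  contractions commute with it and stay contractions in the new norm.\<close>

lemma square_op_joint_similarity:
  fixes T :: "nat \<Rightarrow> 'a::complex_hilbert_space \<Rightarrow>\<^sub>L 'a"
  assumes T: "\<And>i. i \<in> {1..n} \<Longrightarrow> square_op (T i)"
    and comm: "\<And>i j. i \<in> {1..n} \<Longrightarrow> j \<in> {1..n} \<Longrightarrow> op_commute (T i) (T j)"
  shows "\<exists>S\<in>bounded_ops. op_invertible S \<and> (\<forall>i\<in>{1..n}. op_contraction (op_conj S (T i)))"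
proof -
  have "m \<le> n \<Longrightarrow> \<exists>S\<in>bounded_ops. op_invertible S \<and> (\<forall>i\<in>{1..m}. op_contraction (op_conj S (T i)))" for m
  proof (induction m)
    case 0
    have "op_invertible (id_blinfun :: 'a \<Rightarrow>\<^sub>L 'a)"
      unfolding op_invertible_def by (intro bexI[of _ id_blinfun] conjI blinfun_eqI) auto
    then show ?case by (intro bexI[of _ id_blinfun]) auto
  next
    case (Suc m)
    then obtain S where S: "S \<in> bounded_ops" "op_invertible S"
      and contr: "\<And>i. i \<in> {1..m} \<Longrightarrow> norm (op_conj S (T i)) \<le> 1"
      unfolding op_contraction_def by auto
    define X where "X i = op_conj S (T i)" for i
    have Xb: "X i \<in> bounded_ops" if "i \<in> {1..n}" for i
      unfolding X_def using T[OF that] by (intro op_conj_in_bounded_ops S) (simp add: square_op_def)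
    have "square_op (X (Suc m))"
      unfolding X_def using Suc.prems by (intro square_op_op_conj S T) auto
    then obtain R where R: "R \<in> bounded_ops" "op_invertible R"
      and R1: "\<And>x. norm (R (X (Suc m) x)) \<le> norm (R x)"
      and R2: "\<And>Q x. Q \<in> bounded_ops \<Longrightarrow> norm Q \<le> 1 \<Longrightarrow> op_commute Q (X (Suc m)) \<Longrightarrow>
        norm (R (blinfun_apply Q x)) \<le> norm (R x)"
      using square_op_similarity by metis
    have RX: "norm (R (X i x)) \<le> norm (R x)" if i: "i \<in> {1..Suc m}" for i x
    proof (cases "i = Suc m")
      case False
      have "op_commute (X i) (X (Suc m))"
        using comm[of i "Suc m"] i Suc.prems unfolding op_commute_def X_def by (simp add: op_conj_compose[OF S(2)])
      then show ?thesis using i False Suc.prems contr[of i] by (intro R2 Xb) (auto simp: X_def)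
    qed (simp add: R1)
    have "norm (op_conj (R o\<^sub>L S) (T i)) \<le> 1" if i: "i \<in> {1..Suc m}" for i
    proof (intro norm_blinfun_bound)
      fix x
      have "norm (R (X i (op_inverse R x))) \<le> norm (R (op_inverse R x))" by (rule RX[OF i])
      then show "norm (op_conj (R o\<^sub>L S) (T i) x) \<le> 1 * norm x"
        by (simp add: op_conj_apply X_def op_invertible_compose[OF R(2) S(2)] op_invertible_apply[OF R(2)])
    qed simp
    then show ?case
      using R S op_invertible_compose[OF R(2) S(2)] unfolding op_contraction_def
      by (intro bexI[of _ "R o\<^sub>L S"]) auto
  qed
  then show ?thesis by blast
qed

section \<open>Stolz domains\<close>

lemma sin_angle: "\<gamma> \<in> {0<..<pi/2} \<Longrightarrow> 0 < sin \<gamma> \<and> sin \<gamma> < 1"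
  using sin_gt_zero[of \<gamma>] sin_monotone_2pi[of \<gamma> "pi/2"] by auto

lemma sin_angle_mono: "\<beta> \<in> {0<..<\<gamma>} \<Longrightarrow> \<gamma> < pi/2 \<Longrightarrow> sin \<beta> < sin \<gamma>"
  using sin_monotone_2pi[of \<beta> \<gamma>] by auto

lemma stolz_mono: "\<alpha> \<in> {0<..\<beta>} \<Longrightarrow> \<beta> < pi/2 \<Longrightarrow> stolz \<alpha> \<subseteq> stolz \<beta>"
  unfolding stolz_def
  by (intro interior_mono hull_mono insert_mono subset_ball)
    (use sin_angle_mono[of \<alpha> \<beta>] in \<open>cases "\<alpha> = \<beta>"; force\<close>)

lemma open_stolz: "open (stolz \<gamma>)"
  by (simp add: stolz_def)

text \<open>The homothety with centre \<open>1\<close> and ratio \<open>u > 0\<close> maps the open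
  disc to an open disc of radius \<open>u sin \<gamma>\<close> inside the hull, hence inside its
  interior.\<close>

lemma stolz_segment_point:
  assumes u: "0 < u" "u \<le> 1" and w: "cmod w < sin \<gamma>"
  shows "(1 - of_real u) + of_real u * w \<in> stolz \<gamma>"
proof -
  have "ball (1 - complex_of_real u) (u * sin \<gamma>) \<subseteq> convex hull (insert 1 (ball 0 (sin \<gamma>)))"
  proof
    fix z :: complex assume z: "z \<in> ball (1 - complex_of_real u) (u * sin \<gamma>)"
    define w' where "w' = (z - (1 - of_real u)) / of_real u"
    have "cmod w' = cmod (z - (1 - of_real u)) / u" using u by (simp add: w'_def norm_divide)
    also have "\<dots> < sin \<gamma>" using z u by (simp add: dist_norm norm_minus_commute field_simps)
    finally have w': "w' \<in> convex hull (insert 1 (ball 0 (sin \<gamma>)))" by (intro hull_inc) simp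
    have "(1 - u) *\<^sub>R 1 + u *\<^sub>R w' \<in> convex hull (insert 1 (ball 0 (sin \<gamma>)))"
      by (rule convexD[OF convex_convex_hull hull_inc w']) (use u in auto)
    moreover have "(1 - u) *\<^sub>R 1 + u *\<^sub>R w' = z"
      using u by (simp add: w'_def scaleR_conv_of_real)
    ultimately show "z \<in> convex hull (insert 1 (ball 0 (sin \<gamma>)))" by simp
  qed
  then have "ball (1 - complex_of_real u) (u * sin \<gamma>) \<subseteq> stolz \<gamma>"
    unfolding stolz_def by (intro interior_maximal open_ball)
  moreover have "(1 - of_real u) + of_real u * w \<in> ball (1 - of_real u) (u * sin \<gamma>)"
    using u w by (simp add: dist_norm norm_mult)
  ultimately show ?thesis by blast
qed

lemma stolz_hull_cases:
  assumes "z \<in> convex hull (insert 1 (cball 0 r))" and r: "0 \<le> r"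
  obtains u w where "0 \<le> u" "u \<le> 1" "cmod w \<le> r" "z = (1 - of_real u) + of_real u * w"
proof -
  have ne: "cball (0::complex) r \<noteq> {}" using r by simp
  obtain u v w where uv: "0 \<le> u" "0 \<le> v" "u + v = 1" "w \<in> convex hull (cball 0 r)"
    "z = u *\<^sub>R 1 + v *\<^sub>R w"
    using assms(1) unfolding convex_hull_insert[OF ne] by blast
  have "u = 1 - v" using uv(3) by simp
  then have "z = (1 - of_real v) + of_real v * w" using uv(5) by (simp add: scaleR_conv_of_real)
  moreover have "cmod w \<le> r" using uv(4) by (simp add: hull_same)
  ultimately show thesis using that uv by auto
qed

lemma closure_stolz_cases:
  assumes "z \<in> closure (stolz \<alpha>)" and \<alpha>: "\<alpha> \<in> {0<..<pi/2}"
  obtains u w where "0 \<le> u" "u \<le> 1" "cmod w \<le> sin \<alpha>" "z = (1 - of_real u) + of_real u * w"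
proof -
  have "convex hull (insert 1 (ball 0 (sin \<alpha>))) \<subseteq> convex hull (insert (1::complex) (cball 0 (sin \<alpha>)))"
    by (intro hull_mono) auto
  then have "stolz \<alpha> \<subseteq> convex hull (insert 1 (cball 0 (sin \<alpha>)))"
    using interior_subset unfolding stolz_def by blast
  moreover have "closed (convex hull (insert (1::complex) (cball 0 (sin \<alpha>))))"
    by (intro compact_imp_closed compact_convex_hull compact_insert compact_cball)
  ultimately have "z \<in> convex hull (insert 1 (cball 0 (sin \<alpha>)))"
    using assms(1) closure_minimal by blast
  then show thesis using stolz_hull_cases that sin_angle[OF \<alpha>] by (metis less_imp_le)
qed

lemma one_in_closure_stolz: "\<gamma> \<in> {0<..<pi/2} \<Longrightarrow> 1 \<in> closure (stolz \<gamma>)"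
proof -
  assume \<gamma>: "\<gamma> \<in> {0<..<pi/2}"
  show ?thesis unfolding closure_approachable
  proof (intro allI impI)
    fix e :: real assume e: "0 < e"
    define u where "u = min 1 (e / 2)"
    have "(1 - of_real u) + of_real u * 0 \<in> stolz \<gamma>"
      using e sin_angle[OF \<gamma>] by (intro stolz_segment_point) (auto simp: u_def)
    moreover have "dist ((1 - of_real u) + of_real u * 0) (1::complex) < e"
      using e by (simp add: dist_norm u_def)
    ultimately show "\<exists>y\<in>stolz \<gamma>. dist y 1 < e" by blast
  qed
qed

text \<open>The nontangential approach condition at \<open>1\<close>. Both sides are compared with
  the segment parameter \<open>u\<close>: \<open>cmod (1 - z) <= 2u\<close> and
  \<open>1 - cmod z >= u (1 - sin \<gamma>)\<close>.\<close>

lemma stolz_estimate: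
  assumes z: "z \<in> closure (stolz \<gamma>)" and \<gamma>: "\<gamma> \<in> {0<..<pi/2}"
  shows "(1 - sin \<gamma>) * cmod (1 - z) \<le> 2 * (1 - cmod z)"
proof -
  obtain u w where uw: "0 \<le> u" "u \<le> 1" "cmod w \<le> sin \<gamma>" "z = (1 - of_real u) + of_real u * w"
    using closure_stolz_cases[OF z \<gamma>] .
  have s: "0 < sin \<gamma>" "sin \<gamma> < 1" using sin_angle[OF \<gamma>] by auto
  have "1 - z = of_real u * (1 - w)" unfolding uw by (simp add: algebra_simps)
  then have "cmod (1 - z) = u * cmod (1 - w)" using uw by (simp add: norm_mult)
  also have "\<dots> \<le> u * 2"
    using norm_triangle_ineq4[of 1 w] uw s by (intro mult_left_mono) auto
  finally have 1: "cmod (1 - z) \<le> 2 * u" by simp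
  have "cmod (1 - of_real u) = 1 - u"
    using uw(2) by (metis abs_of_nonneg diff_ge_0_iff_ge norm_of_real of_real_1 of_real_diff)
  moreover have "cmod (of_real u * w) \<le> u * sin \<gamma>"
    using uw by (simp add: norm_mult mult_left_mono)
  ultimately have "cmod z \<le> (1 - u) + u * sin \<gamma>"
    unfolding uw(4) by (metis norm_triangle_mono order_refl)
  then have *: "u * (1 - sin \<gamma>) \<le> 1 - cmod z" by (simp add: algebra_simps)
  have "(1 - sin \<gamma>) * cmod (1 - z) \<le> (1 - sin \<gamma>) * (2 * u)"
    using 1 s by (intro mult_left_mono) auto
  also have "\<dots> = 2 * (u * (1 - sin \<gamma>))" by simp
  also have "\<dots> \<le> 2 * (1 - cmod z)" using * by simp
  finally show ?thesis .
qed

text \<open>The Stolz estimate leaves only \<open>z = 1\<close> to exclude: were it interior, a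
  point \<open>1 + e/2\<close> of modulus above one would satisfy that estimate.\<close>

lemma cmod_less_one_stolz:
  assumes z: "z \<in> stolz \<gamma>" and \<gamma>: "\<gamma> \<in> {0<..<pi/2}"
  shows "cmod z < 1"
proof -
  have zc: "z \<in> closure (stolz \<gamma>)" using z closure_subset by blast
  have "z \<noteq> 1"
  proof
    assume "z = 1"
    then obtain e where e: "0 < e" "ball 1 e \<subseteq> stolz \<gamma>"
      using open_contains_ball[of "stolz \<gamma>"] open_stolz z by metis
    have "1 + of_real (e / 2) \<in> ball (1::complex) e" using e by (simp add: dist_norm)
    then have "(1 - sin \<gamma>) * cmod (1 - (1 + of_real (e / 2))) \<le> 2 * (1 - cmod (1 + of_real (e / 2)))"
      using e closure_subset by (intro stolz_estimate[OF _ \<gamma>]) blast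
    moreover have "0 < (1 - sin \<gamma>) * cmod (1 - (1 + of_real (e / 2)))"
      using e sin_angle[OF \<gamma>] by (intro mult_pos_pos) auto
    moreover have "cmod (1 + of_real (e / 2)) = 1 + e / 2"
      using e by (metis abs_of_pos add_pos_pos half_gt_zero norm_of_real of_real_1 of_real_add zero_less_one)
    ultimately show False using e by simp
  qed
  then have "0 < (1 - sin \<gamma>) * cmod (1 - z)" using sin_angle[OF \<gamma>] by (intro mult_pos_pos) auto
  from less_le_trans[OF this stolz_estimate[OF zc \<gamma>]] show ?thesis by simp
qed

subsection \<open>The boundary curve\<close>

text \<open>Every point of the curve is \<open>(1 - u) + u sin \<beta> e\<^sup>i\<^sup>\<theta>\<close> with \<open>e\<^sup>i\<^sup>\<theta>\<close> the outer normal of a supporting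
  line at distance \<open>sin \<beta>\<close> from the origin.\<close>

lemma stolz_boundary_cases:
  assumes \<beta>: "\<beta> \<in> {0<..<pi/2}" and t: "t \<in> {0..1}"
  obtains u \<theta> where "min t (1 - t) \<le> u" "0 \<le> u" "u \<le> 1" "cos \<theta> \<le> sin \<beta>"
    "stolz_boundary \<beta> t = (1 - of_real u) + of_real u * (of_real (sin \<beta>) * cis \<theta>)"
    "u = 1 \<or> cos \<theta> = sin \<beta>"
proof (cases "t \<le> 1/2")
  case True
  show thesis
  proof (rule that[of "2 * t" "pi/2 - \<beta>"])
    show "stolz_boundary \<beta> t = (1 - of_real (2 * t)) + of_real (2 * t) * (of_real (sin \<beta>) * cis (pi/2 - \<beta>))"
      using True by (simp add: stolz_boundary_def joinpaths_def linepath_def scaleR_conv_of_real)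
  qed (use t True in \<open>auto simp: cos_diff\<close>)
next
  case F1: False
  show thesis
  proof (cases "t \<le> 3/4")
    case True
    define \<theta> where "\<theta> = linepath (pi/2 - \<beta>) (3*pi/2 + \<beta>) (2 * (2 * t - 1))"
    have th: "\<theta> = (pi/2 - \<beta>) + (4 * t - 2) * (pi + 2 * \<beta>)"
      by (simp add: \<theta>_def linepath_def field_simps)
    have l: "pi/2 - \<beta> \<le> \<theta>" unfolding th using F1 \<beta> by simp
    have "(4 * t - 2) * (pi + 2 * \<beta>) \<le> 1 * (pi + 2 * \<beta>)"
      using True \<beta> by (intro mult_right_mono) auto
    then have r: "\<theta> \<le> 3*pi/2 + \<beta>" unfolding th by simp
    have "cos \<theta> \<le> cos (pi/2 - \<beta>)"
    proof (cases "\<theta> \<le> pi")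
      case True
      then show ?thesis using l \<beta> by (intro cos_monotone_0_pi_le) auto
    next
      case False
      then have "cos (2 * pi - \<theta>) \<le> cos (pi/2 - \<beta>)"
        using r \<beta> by (intro cos_monotone_0_pi_le) auto
      then show ?thesis by (simp add: cos_diff)
    qed
    then have c: "cos \<theta> \<le> sin \<beta>" by (simp add: cos_diff)
    show thesis
    proof (rule that[of 1 \<theta>])
      show "stolz_boundary \<beta> t = (1 - of_real 1) + of_real 1 * (of_real (sin \<beta>) * cis \<theta>)"
        using F1 True by (simp add: stolz_boundary_def joinpaths_def part_circlepath_def \<theta>_def cis_conv_exp)
    qed (use t c in auto)
  next
    case False
    show thesis
    proof (rule that[of "4 * (1 - t)" "- (pi/2 - \<beta>)"])
      show "stolz_boundary \<beta> t = (1 - of_real (4 * (1 - t))) +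
          of_real (4 * (1 - t)) * (of_real (sin \<beta>) * cis (- (pi/2 - \<beta>)))"
        using F1 False by (simp add: stolz_boundary_def joinpaths_def linepath_def scaleR_conv_of_real algebra_simps)
    qed (use t F1 False in \<open>auto simp: cos_diff cos_add\<close>)
  qed
qed

lemma cmod_segment_le:
  assumes "0 \<le> u" "u \<le> 1" "cmod w \<le> r"
  shows "cmod ((1 - of_real u) + of_real u * w) \<le> 1 - (1 - r) * u"
proof -
  have "cmod (1 - of_real u) = 1 - u"
    using assms(2) by (metis abs_of_nonneg diff_ge_0_iff_ge norm_of_real of_real_1 of_real_diff)
  moreover have "cmod (of_real u * w) \<le> u * r"
    using assms by (simp add: norm_mult mult_left_mono)
  ultimately have "cmod ((1 - of_real u) + of_real u * w) \<le> (1 - u) + u * r"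
    by (metis norm_triangle_mono order_refl)
  then show ?thesis by (simp add: algebra_simps)
qed

text \<open>\<open>min t (1 - t)\<close> is the parameter distance to the vertex. The linear rate
  turns powers of \<open>z\<close> and resolvent singularities on the curve into explicit integrals
  over the parameter.\<close>

lemma cmod_stolz_boundary_le:
  assumes \<beta>: "\<beta> \<in> {0<..<pi/2}" and t: "t \<in> {0..1}"
  shows "cmod (stolz_boundary \<beta> t) \<le> 1 - (1 - sin \<beta>) * min t (1 - t)"
proof -
  have s: "0 < sin \<beta>" "sin \<beta> < 1" using sin_angle[OF \<beta>] by auto
  obtain u \<theta> where u: "min t (1 - t) \<le> u" "0 \<le> u" "u \<le> 1"
    "stolz_boundary \<beta> t = (1 - of_real u) + of_real u * (of_real (sin \<beta>) * cis \<theta>)"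
    using stolz_boundary_cases[OF \<beta> t] by metis
  have "cmod (stolz_boundary \<beta> t) \<le> 1 - (1 - sin \<beta>) * u"
    unfolding u(4) using u s by (intro cmod_segment_le) (auto simp: norm_mult)
  also have "\<dots> \<le> 1 - (1 - sin \<beta>) * min t (1 - t)"
    using mult_left_mono[OF u(1), of "1 - sin \<beta>"] s by linarith
  finally show ?thesis .
qed

lemma cmod_one_minus_stolz_boundary_ge:
  assumes \<beta>: "\<beta> \<in> {0<..<pi/2}" and t: "t \<in> {0..1}"
  shows "(1 - sin \<beta>) * min t (1 - t) \<le> cmod (1 - stolz_boundary \<beta> t)"
  using cmod_stolz_boundary_le[OF assms] norm_triangle_ineq2[of 1 "stolz_boundary \<beta> t"] by simp

lemma stolz_boundary_in_stolz:
  assumes \<beta>: "\<beta> \<in> {0<..<\<gamma>}" "\<gamma> < pi/2" and t: "t \<in> {0<..<1}"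
  shows "stolz_boundary \<beta> t \<in> stolz \<gamma>"
proof -
  have \<beta>': "\<beta> \<in> {0<..<pi/2}" and t': "t \<in> {0..1}" using \<beta> t by auto
  obtain u \<theta> where u: "min t (1 - t) \<le> u" "0 \<le> u" "u \<le> 1"
    "stolz_boundary \<beta> t = (1 - of_real u) + of_real u * (of_real (sin \<beta>) * cis \<theta>)"
    using stolz_boundary_cases[OF \<beta>' t'] by metis
  show ?thesis unfolding u(4)
    by (rule stolz_segment_point)
      (use u t sin_angle_mono[OF \<beta>] sin_angle[OF \<beta>'] in \<open>auto simp: norm_mult\<close>)
qed

lemma stolz_boundary_in_hull:
  assumes \<beta>: "\<beta> \<in> {0<..<pi/2}" and t: "t \<in> {0..1}"
  shows "stolz_boundary \<beta> t \<in> convex hull (insert 1 (cball 0 (sin \<beta>)))"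
proof -
  obtain u \<theta> where u: "0 \<le> u" "u \<le> 1"
    "stolz_boundary \<beta> t = (1 - of_real u) + of_real u * (of_real (sin \<beta>) * cis \<theta>)"
    using stolz_boundary_cases[OF \<beta> t] by metis
  have "(1 - u) *\<^sub>R 1 + u *\<^sub>R (of_real (sin \<beta>) * cis \<theta>) \<in> convex hull (insert 1 (cball 0 (sin \<beta>)))"
    using u sin_angle[OF \<beta>] by (intro convexD[OF convex_convex_hull] hull_inc) (auto simp: norm_mult)
  then show ?thesis unfolding u(3) by (simp add: scaleR_conv_of_real)
qed

lemma hull_minus_one_subset_stolz:
  assumes \<beta>: "\<beta> \<in> {0<..<\<gamma>}" "\<gamma> < pi/2"
  shows "convex hull (insert (1::complex) (cball 0 (sin \<beta>))) - {1} \<subseteq> stolz \<gamma>"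
proof
  fix z :: complex assume z: "z \<in> convex hull (insert 1 (cball 0 (sin \<beta>))) - {1}"
  have s: "0 < sin \<beta>" using sin_angle[of \<beta>] \<beta> by auto
  obtain u w where u: "0 \<le> u" "u \<le> 1" "cmod w \<le> sin \<beta>" "z = (1 - of_real u) + of_real u * w"
    using stolz_hull_cases[of z "sin \<beta>"] z s by (metis DiffD1 less_imp_le)
  have "u \<noteq> 0" using z u(4) by auto
  then show "z \<in> stolz \<gamma>" unfolding u(4)
    by (intro stolz_segment_point) (use u sin_angle_mono[OF \<beta>] in auto)
qed

text \<open>The functional \<open>h\<close>, the real part after rotation by
  \<open>-\<theta>\<close>, equals \<open>sin \<beta>\<close> at the curve point. On the closed
  domain of the smaller angle it is at most \<open>sin \<beta>\<close>, with equality only at the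
  vertex; dilation by \<open>\<rho> >= 1\<close> can only increase it.\<close>

lemma scaled_stolz_boundary_supporting:
  assumes \<alpha>: "0 < \<alpha>" "\<alpha> < \<beta>" "\<beta> < pi/2" and t: "t \<in> {0..1}" and \<rho>: "1 \<le> \<rho>"
    and z: "of_real \<rho> * stolz_boundary \<beta> t \<in> closure (stolz \<alpha>)"
  shows "\<rho> = 1" "stolz_boundary \<beta> t = 1"
proof -
  have \<beta>': "\<beta> \<in> {0<..<pi/2}" and \<alpha>': "\<alpha> \<in> {0<..<pi/2}" using \<alpha> by auto
  have s: "0 < sin \<beta>" "sin \<beta> < 1" "sin \<alpha> < sin \<beta>"
    using sin_angle[OF \<beta>'] sin_angle_mono[of \<alpha> \<beta>] \<alpha> by auto
  obtain u \<theta> where u: "0 \<le> u" "u \<le> 1" "cos \<theta> \<le> sin \<beta>"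
    "stolz_boundary \<beta> t = (1 - of_real u) + of_real u * (of_real (sin \<beta>) * cis \<theta>)"
    "u = 1 \<or> cos \<theta> = sin \<beta>"
    using stolz_boundary_cases[OF \<beta>' t] by metis
  define h where "h x = Re (x * cis (- \<theta>))" for x
  have hB: "h (stolz_boundary \<beta> t) = sin \<beta>"
  proof -
    have "stolz_boundary \<beta> t * cis (-\<theta>) = of_real (1 - u) * cis (-\<theta>) + of_real (u * sin \<beta>)"
      unfolding u(4) by (simp add: algebra_simps cis_mult)
    then have "h (stolz_boundary \<beta> t) = Re (of_real (1 - u) * cis (-\<theta>) + of_real (u * sin \<beta>))"
      unfolding h_def by (rule arg_cong)
    then have "h (stolz_boundary \<beta> t) = (1 - u) * cos \<theta> + u * sin \<beta>" by simp
    then show ?thesis using u(5) by (auto simp: algebra_simps)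
  qed
  obtain v w where v: "0 \<le> v" "v \<le> 1" "cmod w \<le> sin \<alpha>"
    "of_real \<rho> * stolz_boundary \<beta> t = (1 - of_real v) + of_real v * w"
    using closure_stolz_cases[OF z \<alpha>'] by metis
  have "of_real \<rho> * stolz_boundary \<beta> t * cis (-\<theta>) = of_real (1 - v) * cis (-\<theta>) + of_real v * (w * cis (-\<theta>))"
    unfolding v(4) by (simp add: algebra_simps)
  then have "Re (of_real \<rho> * stolz_boundary \<beta> t * cis (-\<theta>))
      = Re (of_real (1 - v) * cis (-\<theta>) + of_real v * (w * cis (-\<theta>)))" by (rule arg_cong)
  moreover have Re_scale: "Re (of_real r * x) = r * Re x" for r x by simp
  have "Re (of_real \<rho> * stolz_boundary \<beta> t * cis (-\<theta>)) = \<rho> * h (stolz_boundary \<beta> t)"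
    unfolding h_def mult.assoc Re_scale ..
  moreover have "Re (of_real (1 - v) * cis (-\<theta>) + of_real v * (w * cis (-\<theta>))) = (1 - v) * cos \<theta> + v * h w"
    unfolding h_def plus_complex.simps Re_scale by simp
  ultimately have eq: "\<rho> * sin \<beta> = (1 - v) * cos \<theta> + v * h w" by (simp only: hB)
  have "h w \<le> sin \<alpha>"
    unfolding h_def using complex_Re_le_cmod[of "w * cis (-\<theta>)"] v(3) by (simp add: norm_mult)
  then have "(1 - v) * cos \<theta> + v * h w \<le> (1 - v) * sin \<beta> + v * sin \<alpha>"
    using u v by (intro add_mono mult_left_mono) auto
  then have "(\<rho> - 1) * sin \<beta> + v * (sin \<beta> - sin \<alpha>) \<le> 0" using eq by (simp add: algebra_simps)
  moreover have "0 \<le> (\<rho> - 1) * sin \<beta>" "0 \<le> v * (sin \<beta> - sin \<alpha>)" using \<rho> s v by auto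
  ultimately have "(\<rho> - 1) * sin \<beta> = 0" "v * (sin \<beta> - sin \<alpha>) = 0" by linarith+
  then show "\<rho> = 1" "stolz_boundary \<beta> t = 1" using s v(4) by auto
qed

lemma scaled_stolz_boundary_notin_closure:
  assumes "0 < \<alpha>" "\<alpha> < \<beta>" "\<beta> < pi/2" "t \<in> {0..1}" "1 < \<rho>"
  shows "of_real \<rho> * stolz_boundary \<beta> t \<notin> closure (stolz \<alpha>)"
  using scaled_stolz_boundary_supporting[of \<alpha> \<beta> t \<rho>] assms by auto

lemma stolz_boundary_notin_closure:
  assumes "0 < \<alpha>" "\<alpha> < \<beta>" "\<beta> < pi/2" "t \<in> {0<..<1}"
  shows "stolz_boundary \<beta> t \<notin> closure (stolz \<alpha>)"
proof
  assume "stolz_boundary \<beta> t \<in> closure (stolz \<alpha>)"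
  then have "stolz_boundary \<beta> t = 1"
    using scaled_stolz_boundary_supporting[of \<alpha> \<beta> t 1] assms by auto
  moreover have "0 < (1 - sin \<beta>) * min t (1 - t)"
    using assms sin_angle[of \<beta>] by (intro mult_pos_pos) auto
  moreover have "cmod (stolz_boundary \<beta> t) \<le> 1 - (1 - sin \<beta>) * min t (1 - t)"
    using assms by (intro cmod_stolz_boundary_le) auto
  ultimately show False by simp
qed

text \<open>The same supporting line keeps the curve away from the origin, so its dilates tend to
  infinity uniformly.\<close>

lemma cmod_stolz_boundary_ge:
  assumes \<beta>: "\<beta> \<in> {0<..<pi/2}" and t: "t \<in> {0..1}"
  shows "sin \<beta> \<le> cmod (stolz_boundary \<beta> t)"
proof -
  obtain u \<theta> where u: "0 \<le> u" "u \<le> 1" 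
    "stolz_boundary \<beta> t = (1 - of_real u) + of_real u * (of_real (sin \<beta>) * cis \<theta>)"
    "u = 1 \<or> cos \<theta> = sin \<beta>"
    using stolz_boundary_cases[OF \<beta> t] by metis
  have "stolz_boundary \<beta> t * cis (-\<theta>) = of_real (1 - u) * cis (-\<theta>) + of_real (u * sin \<beta>)"
    unfolding u(3) by (simp add: algebra_simps cis_mult)
  then have "Re (stolz_boundary \<beta> t * cis (-\<theta>)) = Re (of_real (1 - u) * cis (-\<theta>) + of_real (u * sin \<beta>))"
    by (rule arg_cong)
  also have "\<dots> = sin \<beta>" using u(4) by (auto simp: algebra_simps)
  finally have "Re (stolz_boundary \<beta> t * cis (-\<theta>)) = sin \<beta>" .
  then show ?thesis
    using complex_Re_le_cmod[of "stolz_boundary \<beta> t * cis (-\<theta>)"] by (simp add: norm_mult)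
qed

section \<open>The boundary as a closed piecewise smooth path\<close>

lemma stolz_boundary_endpoints [simp]:
  "pathstart (stolz_boundary \<beta>) = 1" "pathfinish (stolz_boundary \<beta>) = 1"
  by (simp_all add: stolz_boundary_def)

lemma cis_lower_tangent: "cis (- (pi/2 - \<beta>)) = cis (3*pi/2 + \<beta>)"
proof -
  have "cis (3*pi/2 + \<beta>) = cis (- (pi/2 - \<beta>) + 2 * pi)" by (rule arg_cong[of _ _ cis]) simp
  then show ?thesis by (simp only: cis_mult[symmetric] cis_2pi mult_1_right)
qed

lemma valid_path_stolz_boundary: "valid_path (stolz_boundary \<beta>)"
  unfolding stolz_boundary_def
  by (intro valid_path_join valid_path_linepath valid_path_part_circlepath)
    (simp_all only: pathstart_join pathfinish_linepath pathstart_linepath pathstart_part_circlepath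
      pathfinish_part_circlepath add_0_left cis_lower_tangent[unfolded cis_conv_exp] cis_conv_exp)

lemma path_stolz_boundary: "path (stolz_boundary \<beta>)"
  by (rule valid_path_imp_path[OF valid_path_stolz_boundary])

lemma continuous_on_stolz_boundary: "continuous_on {0..1} (stolz_boundary \<beta>)"
  using path_stolz_boundary unfolding path_def .

subsection \<open>Integrals along the boundary curve\<close>

abbreviation unit_measure :: "real measure"
  where "unit_measure \<equiv> restrict_space lborel {0<..<1}"

abbreviation stolz_velocity :: "real \<Rightarrow> real \<Rightarrow> complex"
  where "stolz_velocity \<beta> t \<equiv> vector_derivative (stolz_boundary \<beta>) (at t)"

lemma space_unit_measure [simp]: "space unit_measure = {0<..<1}"
  by (simp add: space_restrict_space)

interpretation unit_measure: finite_measure unit_measure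
  by (rule finite_measureI) (simp add: emeasure_restrict_space)

interpretation unit_product: product_sigma_finite "\<lambda>_::nat. unit_measure"
  by unfold_locales

lemma measurable_unit_continuous:
  fixes f :: "real \<Rightarrow> 'b::topological_space"
  assumes "continuous_on {0<..<1} f"
  shows "f \<in> borel_measurable unit_measure"
  using borel_measurable_continuous_on_restrict[OF assms]
  by (simp add: measurable_cong_sets[OF sets_restrict_space_cong[OF sets_lborel] refl])

lemma measurable_unit_borel: "f \<in> borel_measurable borel \<Longrightarrow> f \<in> borel_measurable unit_measure"
  by (intro measurable_restrict_space1) simp

lemma AE_unit_measure_neq: "AE t in unit_measure. t \<noteq> c"
  by (subst AE_restrict_space_iff) (use AE_lborel_singleton[of c] in auto)

lemma integral_unit_measure:
  fixes f :: "real \<Rightarrow> complex"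
  assumes "integrable unit_measure f"
  shows "integral\<^sup>L unit_measure f = integral {0..1} f"
proof -
  have "set_integrable lborel {0<..<1} f"
    using assms unfolding set_integrable_def by (subst (asm) integrable_restrict_space) auto
  from set_borel_integral_eq_integral(2)[OF this] show ?thesis
    unfolding integral_open_interval_real set_lebesgue_integral_def
    by (subst integral_restrict_space) auto
qed

text \<open>Turns gauge integrals obtained from antiderivatives into Lebesgue integrals, using that
  nonnegative gauge integrable functions are absolutely integrable.\<close>

lemma has_integral_unit_measure:
  fixes f :: "real \<Rightarrow> real"
  assumes f: "f \<in> borel_measurable borel" "\<And>t. t \<in> {0<..<1} \<Longrightarrow> 0 \<le> f t"
    and I: "(f has_integral I) {0..1}"
  shows "integrable unit_measure f" "integral\<^sup>L unit_measure f = I"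
proof -
  have I': "(f has_integral I) {0<..<1}"
    using I has_integral_open_interval[of f I 0 1] by simp
  then have "f absolutely_integrable_on {0<..<1}"
    by (intro nonnegative_absolutely_integrable_1) (use f(2) in auto)
  then have *: "set_integrable lborel {0<..<1} f"
    unfolding set_integrable_def
    by (subst (asm) integrable_completion) (use f(1) in simp_all)
  then show "integrable unit_measure f"
    unfolding set_integrable_def by (subst integrable_restrict_space) auto
  have "(LINT t:{0<..<1}|lborel. f t) = I"
    using set_borel_integral_eq_integral(2)[OF *] I' by (simp add: integral_unique)
  then show "integral\<^sup>L unit_measure f = I"
    unfolding set_lebesgue_integral_def by (subst integral_restrict_space) auto
qed

text \<open>The exponent is what remains of decay \<open>s\<close> of the function against the
  singularity of order one of the resolvent at the vertex.\<close>

lemma integrable_min_powr: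
  assumes s: "0 < s"
  shows "integrable unit_measure (\<lambda>t. min t (1 - t) powr (s - 1))"
proof -
  have 1: "((\<lambda>t. t powr (s - 1)) has_integral (1 powr s / s - 0 powr s / s)) {0..1}"
  proof (rule fundamental_theorem_of_calculus_interior_strong[of "{}"])
    show "((\<lambda>t. t powr s / s) has_vector_derivative t powr (s - 1)) (at t)" if "t \<in> {0<..<1} - {}" for t
      unfolding has_real_derivative_iff_has_vector_derivative[symmetric]
      using that s by (auto intro!: derivative_eq_intros)
    show "continuous_on {0..1} (\<lambda>t. t powr s / s)"
      by (intro continuous_on_divide continuous_on_powr' continuous_intros) (use s in auto)
  qed auto
  have 2: "((\<lambda>t. (1 - t) powr (s - 1)) has_integral (- ((1 - 1) powr s / s) - - ((1 - 0) powr s / s))) {0..1}"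
  proof (rule fundamental_theorem_of_calculus_interior_strong[of "{}"])
    show "((\<lambda>t. - ((1 - t) powr s / s)) has_vector_derivative (1 - t) powr (s - 1)) (at t)"
      if "t \<in> {0<..<1} - {}" for t
      unfolding has_real_derivative_iff_has_vector_derivative[symmetric]
      using that s by (auto intro!: derivative_eq_intros)
    show "continuous_on {0..1} (\<lambda>t. - ((1 - t) powr s / s))"
      by (intro continuous_on_minus continuous_on_divide continuous_on_powr' continuous_intros) (use s in auto)
  qed auto
  have "integrable unit_measure (\<lambda>t. t powr (s - 1) + (1 - t) powr (s - 1))"
    by (intro Bochner_Integration.integrable_add has_integral_unit_measure(1)[OF _ _ 1]
        has_integral_unit_measure(1)[OF _ _ 2]) auto
  then show ?thesis
  proof (rule Bochner_Integration.integrable_bound)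
    show "(\<lambda>t. min t (1 - t) powr (s - 1)) \<in> borel_measurable unit_measure"
      by (intro measurable_unit_borel) measurable
    show "AE t in unit_measure. norm (min t (1 - t) powr (s - 1)) \<le> norm (t powr (s - 1) + (1 - t) powr (s - 1))"
      by (auto simp: min_def)
  qed
qed

text \<open>The source of the gain \<open>1/(k+1)\<close> in contour integrals of
  \<open>z^k\<close>. The integrand is the larger of two one-sided powers, hence at most their sum,
  and each integrates to at most \<open>1/(c (k+1))\<close>.\<close>

lemma integral_power_min_le:
  assumes c: "0 < c" "c \<le> 1"
  shows "integrable unit_measure (\<lambda>t. (1 - c * min t (1 - t)) ^ k)"
    and "integral\<^sup>L unit_measure (\<lambda>t. (1 - c * min t (1 - t)) ^ k) \<le> 2 / (c * real (Suc k))"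
proof -
  define K where "K = c * real (Suc k)"
  have K: "0 < K" using c by (simp add: K_def)
  have 1: "((\<lambda>t. (1 - c * t) ^ k) has_integral (- ((1 - c * 1) ^ Suc k / K) - - ((1 - c * 0) ^ Suc k / K))) {0..1}"
  proof (rule fundamental_theorem_of_calculus_interior_strong[of "{}"])
    show "((\<lambda>t. - ((1 - c * t) ^ Suc k / K)) has_vector_derivative (1 - c * t) ^ k) (at t)" for t
    proof -
      have "((\<lambda>t. 1 - c * t) has_real_derivative - c) (at t)" by (auto intro!: derivative_eq_intros)
      from DERIV_minus[OF DERIV_cdivide[OF DERIV_power[OF this, of "Suc k"], of K]]
      show ?thesis unfolding has_real_derivative_iff_has_vector_derivative[symmetric]
        using c by (simp add: K_def del: power_Suc)
    qed
  qed (use K in \<open>auto intro!: continuous_intros\<close>)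
  have 2: "((\<lambda>t. (1 - c * (1 - t)) ^ k) has_integral ((1 - c * (1 - 1)) ^ Suc k / K - (1 - c * (1 - 0)) ^ Suc k / K)) {0..1}"
  proof (rule fundamental_theorem_of_calculus_interior_strong[of "{}"])
    show "((\<lambda>t. (1 - c * (1 - t)) ^ Suc k / K) has_vector_derivative (1 - c * (1 - t)) ^ k) (at t)" for t
    proof -
      have "((\<lambda>t. 1 - c * (1 - t)) has_real_derivative c) (at t)" by (auto intro!: derivative_eq_intros)
      from DERIV_cdivide[OF DERIV_power[OF this, of "Suc k"], of K]
      show ?thesis unfolding has_real_derivative_iff_has_vector_derivative[symmetric]
        using c by (simp add: K_def del: power_Suc)
    qed
  qed (use K in \<open>auto intro!: continuous_intros\<close>)
  have nn: "0 \<le> 1 - c * t" if "t \<in> {0<..<1}" for t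
    using c that mult_mono[of c 1 t 1] by auto
  have nn': "0 \<le> 1 - c * (1 - t)" if "t \<in> {0<..<1}" for t
    using nn[of "1 - t"] that by auto
  have m: "(\<lambda>t. (1 - c * t) ^ k) \<in> borel_measurable borel" "(\<lambda>t. (1 - c * (1 - t)) ^ k) \<in> borel_measurable borel"
    by measurable
  note i1 = has_integral_unit_measure[OF m(1) _ 1] and i2 = has_integral_unit_measure[OF m(2) _ 2]
  have i1': "integrable unit_measure (\<lambda>t. (1 - c * t) ^ k)"
    "(\<integral>t. (1 - c * t) ^ k \<partial>unit_measure) \<le> 1 / K"
    using i1 nn K c by (auto intro!: divide_nonneg_nonneg)
  have i2': "integrable unit_measure (\<lambda>t. (1 - c * (1 - t)) ^ k)"
    "(\<integral>t. (1 - c * (1 - t)) ^ k \<partial>unit_measure) \<le> 1 / K"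
    using i2 nn' K c by (auto intro!: divide_nonneg_nonneg)
  have sum: "integrable unit_measure (\<lambda>t. (1 - c * t) ^ k + (1 - c * (1 - t)) ^ k)"
    by (intro Bochner_Integration.integrable_add i1' i2')
  have le: "(1 - c * min t (1 - t)) ^ k \<le> (1 - c * t) ^ k + (1 - c * (1 - t)) ^ k"
    and ge: "0 \<le> (1 - c * min t (1 - t)) ^ k" if "t \<in> {0<..<1}" for t
    using nn[OF that] nn'[OF that] by (auto simp: min_def)
  show int: "integrable unit_measure (\<lambda>t. (1 - c * min t (1 - t)) ^ k)"
  proof (rule Bochner_Integration.integrable_bound[OF sum])
    show "(\<lambda>t. (1 - c * min t (1 - t)) ^ k) \<in> borel_measurable unit_measure"
      by (intro measurable_unit_borel) measurable
    show "AE t in unit_measure. norm ((1 - c * min t (1 - t)) ^ k) \<le> norm ((1 - c * t) ^ k + (1 - c * (1 - t)) ^ k)"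
    proof (rule AE_I2)
      fix t assume "t \<in> space unit_measure"
      then have t: "t \<in> {0<..<1}" by simp
      show "norm ((1 - c * min t (1 - t)) ^ k) \<le> norm ((1 - c * t) ^ k + (1 - c * (1 - t)) ^ k)"
        unfolding real_norm_def using le[OF t] ge[OF t] by linarith
    qed
  qed
  have "integral\<^sup>L unit_measure (\<lambda>t. (1 - c * min t (1 - t)) ^ k)
      \<le> (\<integral>t. (1 - c * t) ^ k + (1 - c * (1 - t)) ^ k \<partial>unit_measure)"
    by (intro integral_mono int sum) (use le in auto)
  also have "\<dots> \<le> 1 / K + 1 / K"
    by (subst Bochner_Integration.integral_add) (use i1' i2' in auto)
  finally show "integral\<^sup>L unit_measure (\<lambda>t. (1 - c * min t (1 - t)) ^ k) \<le> 2 / (c * real (Suc k))"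
    by (simp add: K_def)
qed

text \<open>The nested \<open>+++\<close> puts the corners at the parameters \<open>1/2\<close> and
  \<open>3/4\<close> and gives the pieces the speed factors 2, 4 and 4.\<close>

definition stolz_velocity_formula :: "real \<Rightarrow> real \<Rightarrow> complex"
  where "stolz_velocity_formula \<beta> t =
    (if t < 1/2 then 2 * (of_real (sin \<beta>) * cis (pi/2 - \<beta>) - 1)
     else if t < 3/4 then of_real (4 * (pi + 2 * \<beta>) * sin \<beta>) * \<i> *
       exp (\<i> * of_real ((pi/2 - \<beta>) + (4 * t - 2) * (pi + 2 * \<beta>)))
     else 4 * (1 - of_real (sin \<beta>) * cis (- (pi/2 - \<beta>))))"

lemma stolz_boundary_has_vector_derivative:
  assumes t: "t \<noteq> 1/2" "t \<noteq> 3/4"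
  shows "(stolz_boundary \<beta> has_vector_derivative stolz_velocity_formula \<beta> t) (at t)"
proof -
  define a where "a = of_real (sin \<beta>) * cis (pi/2 - \<beta>)"
  define b where "b = of_real (sin \<beta>) * cis (- (pi/2 - \<beta>))"
  consider "t < 1/2" | "1/2 < t" "t < 3/4" | "3/4 < t" using t by linarith
  then show ?thesis
  proof cases
    case 1
    have "((\<lambda>t. 1 + of_real t * (2 * (a - 1))) has_vector_derivative 2 * (a - 1)) (at t)"
      by (auto intro!: derivative_eq_intros)
    then have "(stolz_boundary \<beta> has_vector_derivative 2 * (a - 1)) (at t)"
      by (rule has_vector_derivative_transform_within_open[of _ _ _ "{..<1/2}"])
        (use 1 in \<open>auto simp: stolz_boundary_def joinpaths_def linepath_def scaleR_conv_of_real
          a_def algebra_simps\<close>)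
    then show ?thesis using 1 by (simp add: stolz_velocity_formula_def a_def)
  next
    case 2
    have lin: "linepath (pi/2 - \<beta>) (3*pi/2 + \<beta>) (4 * t - 2) = (pi/2 - \<beta>) + (4 * t - 2) * (pi + 2 * \<beta>)" for t
      by (simp add: linepath_def field_simps)
    have "((\<lambda>t. 4 * t - 2) has_vector_derivative 4) (at t)"
      unfolding has_real_derivative_iff_has_vector_derivative[symmetric]
      by (auto intro!: derivative_eq_intros)
    from vector_diff_chain_at[OF this has_vector_derivative_part_circlepath[of 0 "sin \<beta>" "pi/2 - \<beta>" "3*pi/2 + \<beta>"]]
    have "((\<lambda>t. of_real (sin \<beta>) * exp (\<i> * of_real ((pi/2 - \<beta>) + (4 * t - 2) * (pi + 2 * \<beta>))))
        has_vector_derivative of_real (4 * (pi + 2 * \<beta>) * sin \<beta>) * \<i> *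
          exp (\<i> * of_real ((pi/2 - \<beta>) + (4 * t - 2) * (pi + 2 * \<beta>)))) (at t)"
      unfolding part_circlepath_def comp_def lin add_0_left
      by (rule has_vector_derivative_eq_rhs) (simp add: scaleR_conv_of_real field_simps)
    then have "(stolz_boundary \<beta> has_vector_derivative of_real (4 * (pi + 2 * \<beta>) * sin \<beta>) * \<i> *
          exp (\<i> * of_real ((pi/2 - \<beta>) + (4 * t - 2) * (pi + 2 * \<beta>)))) (at t)"
    proof (rule has_vector_derivative_transform_within_open[of _ _ _ "{1/2<..<3/4}"])
      fix t :: real assume t: "t \<in> {1/2<..<3/4}"
      have "linepath (pi/2 - \<beta>) (3*pi/2 + \<beta>) (2 * (2 * t - 1)) = (pi/2 - \<beta>) + (4 * t - 2) * (pi + 2 * \<beta>)"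
        by (simp add: linepath_def field_simps)
      then show "of_real (sin \<beta>) * exp (\<i> * of_real ((pi/2 - \<beta>) + (4 * t - 2) * (pi + 2 * \<beta>))) = stolz_boundary \<beta> t"
        using t by (simp add: stolz_boundary_def joinpaths_def part_circlepath_def)
    qed (use 2 in auto)
    then show ?thesis using 2 by (simp add: stolz_velocity_formula_def)
  next
    case 3
    have "((\<lambda>t. (1 - of_real (4 * (1 - t))) + of_real (4 * (1 - t)) * b) has_vector_derivative 4 * (1 - b)) (at t)"
      by (rule has_vector_derivative_eq_rhs, (rule derivative_intros)+) auto
    then have "(stolz_boundary \<beta> has_vector_derivative 4 * (1 - b)) (at t)"
      by (rule has_vector_derivative_transform_within_open[of _ _ _ "{3/4<..}"])
        (use 3 in \<open>auto simp: stolz_boundary_def joinpaths_def linepath_def scaleR_conv_of_real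
          b_def algebra_simps\<close>)
    then show ?thesis using 3 by (simp add: stolz_velocity_formula_def b_def)
  qed
qed

lemma stolz_velocity_eq: "t \<noteq> 1/2 \<Longrightarrow> t \<noteq> 3/4 \<Longrightarrow> stolz_velocity \<beta> t = stolz_velocity_formula \<beta> t"
  by (rule vector_derivative_at[OF stolz_boundary_has_vector_derivative])

text \<open>The arc is the fastest piece, with speed
  \<open>4 (\<pi> + 2 \<beta>) sin \<beta> <= 4 * 8\<close>; the segments have speed at most 8. The
  bound is the same for all angles.\<close>

lemma cmod_stolz_velocity_formula_le:
  assumes \<beta>: "\<beta> \<in> {0<..<pi/2}"
  shows "cmod (stolz_velocity_formula \<beta> t) \<le> 32"
proof -
  have s: "0 < sin \<beta>" "sin \<beta> < 1" using sin_angle[OF \<beta>] by auto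
  have b: "cmod (of_real (sin \<beta>) * cis \<theta> - 1) \<le> 2" for \<theta>
    using norm_triangle_ineq4[of "of_real (sin \<beta>) * cis \<theta>" 1] s by (simp add: norm_mult)
  have p: "0 < pi + 2 * \<beta>" "pi + 2 * \<beta> \<le> 8" using \<beta> pi_less_4 pi_gt_zero by auto
  have "(pi + 2 * \<beta>) * sin \<beta> \<le> 8 * 1" using p s by (intro mult_mono) auto
  then have m: "4 * (pi + 2 * \<beta>) * sin \<beta> \<le> 32" unfolding mult.assoc by linarith
  have m': "cmod (of_real (4 * (pi + 2 * \<beta>) * sin \<beta>) * \<i> * exp (\<i> * of_real x)) \<le> 32" for x
    using m s p unfolding norm_mult norm_exp_i_times norm_of_real by (simp add: abs_mult)
  have b2: "cmod (2 * (of_real (sin \<beta>) * cis \<theta> - 1)) \<le> 32" for \<theta>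
    using b[of \<theta>] unfolding norm_mult by simp
  have b': "cmod (4 * (1 - of_real (sin \<beta>) * cis \<theta>)) \<le> 32" for \<theta>
    using b[of \<theta>] unfolding norm_mult by (simp add: norm_minus_commute)
  show ?thesis
    unfolding stolz_velocity_formula_def
    by (cases "t < 1/2"; cases "t < 3/4") (simp_all only: if_True if_False b2 b' m')
qed

lemma AE_cmod_stolz_velocity_le:
  assumes "\<beta> \<in> {0<..<pi/2}"
  shows "AE t in unit_measure. cmod (stolz_velocity \<beta> t) \<le> 32"
  using AE_unit_measure_neq[of "1/2"] AE_unit_measure_neq[of "3/4"]
  by eventually_elim (use cmod_stolz_velocity_formula_le[OF assms] stolz_velocity_eq in auto)

lemma measurable_stolz_velocity: "stolz_velocity \<beta> \<in> borel_measurable unit_measure"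
proof -
  have eq: "stolz_velocity \<beta> = (\<lambda>t. if t = 1/2 then stolz_velocity \<beta> (1/2)
      else if t = 3/4 then stolz_velocity \<beta> (3/4) else stolz_velocity_formula \<beta> t)"
  proof (rule ext)
    fix t :: real
    consider "t = 1/2" | "t = 3/4" | "t \<noteq> 1/2" "t \<noteq> 3/4" by blast
    then show "stolz_velocity \<beta> t = (if t = 1/2 then stolz_velocity \<beta> (1/2)
      else if t = 3/4 then stolz_velocity \<beta> (3/4) else stolz_velocity_formula \<beta> t)"
    proof cases
      case 3
      then show ?thesis by (simp only: if_False stolz_velocity_eq[OF 3])
    qed (hypsubst, simp)+
  qed
  have [measurable]: "(\<lambda>t. exp (\<i> * of_real ((pi/2 - \<beta>) + (4 * t - 2) * (pi + 2 * \<beta>)))) \<in> borel_measurable borel"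
    by (intro borel_measurable_continuous_onI continuous_intros)
  show ?thesis
    by (intro measurable_unit_borel, subst eq, unfold stolz_velocity_formula_def) measurable
qed

text \<open>At the two corners \<open>vector_derivative\<close> is an unspecified value, so its
  modulus is added to the bound. This version serves where domination at every parameter is
  required.\<close>

lemma stolz_velocity_bounded:
  assumes "\<beta> \<in> {0<..<pi/2}"
  shows "\<exists>L. \<forall>t. cmod (stolz_velocity \<beta> t) \<le> L"
proof (intro exI allI)
  fix t
  show "cmod (stolz_velocity \<beta> t) \<le> 32 + cmod (stolz_velocity \<beta> (1/2)) + cmod (stolz_velocity \<beta> (3/4))"
  proof -
    have nn: "0 \<le> cmod (stolz_velocity \<beta> (1/2))" "0 \<le> cmod (stolz_velocity \<beta> (3/4))" by (rule norm_ge_zero)+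
    consider "t = 1/2" | "t = 3/4" | "t \<noteq> 1/2" "t \<noteq> 3/4" by blast
    then show ?thesis
    proof cases
      case 3
      then show ?thesis
        unfolding stolz_velocity_eq[OF 3]
        using cmod_stolz_velocity_formula_le[OF assms, of t] nn by linarith
    qed (use nn in \<open>hypsubst, linarith\<close>)+
  qed
qed

lemma integrable_times_velocity:
  fixes g :: "real \<Rightarrow> complex"
  assumes \<beta>: "\<beta> \<in> {0<..<pi/2}" and g: "g \<in> borel_measurable unit_measure"
    and B: "\<And>t. t \<in> {0<..<1} \<Longrightarrow> cmod (g t) \<le> B"
  shows "integrable unit_measure (\<lambda>t. g t * stolz_velocity \<beta> t)"
proof (rule unit_measure.integrable_const_bound)
  have B0: "0 \<le> B" using B[of "1/2"] order_trans[OF norm_ge_zero] by simp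
  have "AE t in unit_measure. t \<in> {0<..<1}" by (rule AE_I2) simp
  with AE_cmod_stolz_velocity_le[OF \<beta>]
  show "AE t in unit_measure. norm (g t * stolz_velocity \<beta> t) \<le> B * 32"
    by eventually_elim (unfold norm_mult, intro mult_mono B, use B0 in auto)
  show "(\<lambda>t. g t * stolz_velocity \<beta> t) \<in> borel_measurable unit_measure"
    by (intro borel_measurable_times g measurable_stolz_velocity)
qed

lemma contour_integral_scaled_stolz_boundary:
  assumes \<beta>: "\<beta> \<in> {0<..<pi/2}" and f: "continuous_on ((\<lambda>t. of_real \<rho> * stolz_boundary \<beta> t) ` {0..1}) f"
  shows "contour_integral (\<lambda>t. of_real \<rho> * stolz_boundary \<beta> t) f
    = (\<integral>t. f (of_real \<rho> * stolz_boundary \<beta> t) * of_real \<rho> * stolz_velocity \<beta> t \<partial>unit_measure)"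
    and "integrable unit_measure (\<lambda>t. f (of_real \<rho> * stolz_boundary \<beta> t) * of_real \<rho> * stolz_velocity \<beta> t)"
proof -
  define g where "g t = f (of_real \<rho> * stolz_boundary \<beta> t) * of_real \<rho>" for t
  have cg: "continuous_on {0..1} g"
    unfolding g_def
    by (intro continuous_intros continuous_on_compose2[OF f] continuous_on_stolz_boundary) auto
  then obtain B where B: "\<And>t. t \<in> {0..1} \<Longrightarrow> cmod (g t) \<le> B"
    using compact_continuous_image[OF cg compact_Icc] compact_imp_bounded bounded_pos
    by (metis image_eqI)
  have int: "integrable unit_measure (\<lambda>t. g t * stolz_velocity \<beta> t)"
    by (intro integrable_times_velocity[OF \<beta>, of _ B] measurable_unit_continuous
        continuous_on_subset[OF cg] B) auto
  show "integrable unit_measure (\<lambda>t. f (of_real \<rho> * stolz_boundary \<beta> t) * of_real \<rho> * stolz_velocity \<beta> t)"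
    using int by (simp add: g_def)
  have "contour_integral (\<lambda>t. of_real \<rho> * stolz_boundary \<beta> t) f = integral {0..1} (\<lambda>t. g t * stolz_velocity \<beta> t)"
    unfolding contour_integral_integral
  proof (rule integral_spike[of "{1/2, 3/4}"])
    fix t :: real assume t: "t \<in> {0..1} - {1/2, 3/4}"
    have "((\<lambda>t. of_real \<rho> * stolz_boundary \<beta> t) has_vector_derivative of_real \<rho> * stolz_velocity_formula \<beta> t) (at t)"
      using t by (intro has_vector_derivative_mult_right stolz_boundary_has_vector_derivative) auto
    then have "vector_derivative (\<lambda>t. of_real \<rho> * stolz_boundary \<beta> t) (at t) = of_real \<rho> * stolz_velocity \<beta> t"
      using t by (simp add: vector_derivative_at stolz_velocity_eq)
    then show "g t * stolz_velocity \<beta> t = f (of_real \<rho> * stolz_boundary \<beta> t) *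
        vector_derivative (\<lambda>t. of_real \<rho> * stolz_boundary \<beta> t) (at t)"
      by (simp add: g_def)
  qed simp
  also have "\<dots> = integral\<^sup>L unit_measure (\<lambda>t. g t * stolz_velocity \<beta> t)"
    by (rule integral_unit_measure[OF int, symmetric])
  finally show "contour_integral (\<lambda>t. of_real \<rho> * stolz_boundary \<beta> t) f
    = (\<integral>t. f (of_real \<rho> * stolz_boundary \<beta> t) * of_real \<rho> * stolz_velocity \<beta> t \<partial>unit_measure)"
    by (simp add: g_def)
qed

text \<open>Cauchy's theorem with the vertex \<open>1\<close> on the boundary of the domain: the decay at \<open>1\<close> makes the
  integrand continuous on the closed convex hull.\<close>

lemma cauchy_stolz_boundary:
  assumes \<beta>: "\<beta> \<in> {0<..<\<gamma>}" "\<gamma> < pi/2" and g: "g holomorphic_on stolz \<gamma>"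
    and bound: "\<And>z. z \<in> stolz \<gamma> \<Longrightarrow> cmod (g z) \<le> c * cmod (1 - z) powr s" and s: "0 < s"
  shows "(\<integral>t. g (stolz_boundary \<beta> t) * stolz_velocity \<beta> t \<partial>unit_measure) = 0"
proof -
  have \<beta>': "\<beta> \<in> {0<..<pi/2}" using \<beta> by auto
  define K where "K = convex hull (insert (1::complex) (cball 0 (sin \<beta>)))"
  define f where "f z = (if z = 1 then 0 else g z)" for z
  have K: "K - {1} \<subseteq> stolz \<gamma>" unfolding K_def by (rule hull_minus_one_subset_stolz[OF \<beta>])
  have "z \<noteq> 1" if "z \<in> stolz \<gamma>" for z
    using cmod_less_one_stolz[OF that] \<beta> by auto
  then have f_eq: "f z = g z" if "z \<in> stolz \<gamma>" for z using that by (auto simp: f_def)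
  have f_hol: "f holomorphic_on stolz \<gamma>" using g holomorphic_transform[OF g] f_eq by metis
  have f_cont: "continuous_on K f"
    unfolding continuous_on_def
  proof
    fix z assume z: "z \<in> K"
    show "(f \<longlongrightarrow> f z) (at z within K)"
    proof (cases "z = 1")
      case False
      then have "z \<in> stolz \<gamma>" using z K by blast
      then have "continuous (at z) f"
        using f_hol open_stolz by (metis continuous_on_eq_continuous_at holomorphic_on_imp_continuous_on)
      then show ?thesis using continuous_at_imp_continuous_at_within continuous_within by blast
    next
      case True
      have "((\<lambda>z. c * cmod (1 - z) powr s) \<longlongrightarrow> c * cmod (1 - 1) powr s) (at 1 within K)"
        using s by (intro tendsto_intros tendsto_powr') auto
      then have lim: "((\<lambda>z. c * cmod (1 - z) powr s) \<longlongrightarrow> 0) (at 1 within K)" by simp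
      have "(f \<longlongrightarrow> 0) (at 1 within K)"
      proof (rule tendsto_0_le[OF lim, of _ 1])
        have "cmod (f z) \<le> norm (c * cmod (1 - z) powr s) * 1" if "z \<in> K" "z \<noteq> 1" for z
        proof -
          have "z \<in> stolz \<gamma>" using that K by blast
          then show ?thesis using bound[of z] f_eq[of z] by simp
        qed
        then show "\<forall>\<^sub>F z in at 1 within K. norm (f z) \<le> norm (c * cmod (1 - z) powr s) * 1"
          unfolding eventually_at_filter by (intro always_eventually) auto
      qed
      then show ?thesis using True by (simp add: f_def)
    qed
  qed
  have image: "(\<lambda>t. of_real 1 * stolz_boundary \<beta> t) ` {0..1} \<subseteq> K"
    using stolz_boundary_in_hull[OF \<beta>'] by (auto simp: K_def)
  have "(f has_contour_integral 0) (stolz_boundary \<beta>)"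
  proof (rule Cauchy_theorem_convex[OF f_cont, of "{1}"])
    show "convex K" by (simp add: K_def)
    show "f field_differentiable at z" if "z \<in> interior K - {1}" for z
      using that K interior_subset f_hol open_stolz holomorphic_on_imp_differentiable_at by blast
    show "path_image (stolz_boundary \<beta>) \<subseteq> K"
      using image by (auto simp: path_image_def)
  qed (simp_all add: valid_path_stolz_boundary)
  then have "0 = contour_integral (stolz_boundary \<beta>) f" by (simp add: contour_integral_unique)
  also have "\<dots> = (\<integral>t. f (stolz_boundary \<beta> t) * stolz_velocity \<beta> t \<partial>unit_measure)"
    using contour_integral_scaled_stolz_boundary(1)[OF \<beta>' continuous_on_subset[OF f_cont image]] by simp
  also have "\<dots> = (\<integral>t. g (stolz_boundary \<beta> t) * stolz_velocity \<beta> t \<partial>unit_measure)"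
    by (rule Bochner_Integration.integral_cong) (use f_eq stolz_boundary_in_stolz[OF \<beta>] in auto)
  finally show ?thesis by simp
qed

text \<open>The segments lie in the right half-plane, where \<open>Ln\<close> is a primitive, and
  the arc is integrated directly. The angles \<open>(\<pi>/2 - \<beta>) + (\<pi> + 2 \<beta>) +
  (\<pi>/2 - \<beta>)\<close> add up to a full turn and the real logarithms cancel.\<close>

lemma contour_integral_inverse_stolz_boundary:
  assumes \<beta>: "\<beta> \<in> {0<..<pi/2}"
  shows "((\<lambda>z. 1 / z) has_contour_integral 2 * of_real pi * \<i>) (stolz_boundary \<beta>)"
proof -
  have s: "0 < sin \<beta>" using sin_angle[OF \<beta>] by auto
  define a where "a = of_real (sin \<beta>) * cis (pi/2 - \<beta>)"
  define b where "b = of_real (sin \<beta>) * cis (- (pi/2 - \<beta>))"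
  have Ln_polar: "Ln (of_real (sin \<beta>) * cis \<theta>) = of_real (ln (sin \<beta>)) + \<i> * of_real \<theta>"
    if "- pi < \<theta>" "\<theta> \<le> pi" for \<theta>
  proof (rule Ln_unique)
    show "exp (of_real (ln (sin \<beta>)) + \<i> * of_real \<theta>) = of_real (sin \<beta>) * cis \<theta>"
      using s by (simp add: exp_add cis_conv_exp exp_of_real)
  qed (use that in auto)
  have Re: "0 < Re a" "0 < Re b"
    using s \<beta> by (auto simp: a_def b_def cos_diff intro!: mult_pos_pos)
  have der: "(Ln has_field_derivative 1 / z) (at z within {z. 0 < Re z})" if "z \<in> {z. 0 < Re z}" for z
  proof -
    have "z \<notin> \<real>\<^sub>\<le>\<^sub>0" using that by (auto simp: complex_nonpos_Reals_iff)
    then show ?thesis using has_field_derivative_at_within[OF has_field_derivative_Ln]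
      by (simp add: inverse_eq_divide)
  qed
  have conv: "convex {z. 0 < Re z}" by (rule convex_halfspace_Re_gt)
  have 1: "((\<lambda>z. 1 / z) has_contour_integral (Ln a - Ln 1)) (linepath 1 a)"
    using contour_integral_primitive[OF der valid_path_linepath, of 1 a] closed_segment_subset[OF _ _ conv, of 1 a] Re
    by auto
  have 3: "((\<lambda>z. 1 / z) has_contour_integral (Ln 1 - Ln b)) (linepath b 1)"
    using contour_integral_primitive[OF der valid_path_linepath, of b 1] closed_segment_subset[OF _ _ conv, of b 1] Re
    by auto
  have 2: "((\<lambda>z. 1 / z) has_contour_integral \<i> * of_real (pi + 2 * \<beta>))
      (part_circlepath 0 (sin \<beta>) (pi/2 - \<beta>) (3*pi/2 + \<beta>))"
    unfolding has_contour_integral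
  proof -
    have eq: "1 / part_circlepath 0 (sin \<beta>) (pi/2 - \<beta>) (3*pi/2 + \<beta>) x *
        vector_derivative (part_circlepath 0 (sin \<beta>) (pi/2 - \<beta>) (3*pi/2 + \<beta>)) (at x) = \<i> * of_real (pi + 2 * \<beta>)" for x
    proof -
      define e where "e = exp (\<i> * of_real (linepath (pi/2 - \<beta>) (3*pi/2 + \<beta>) x))"
      have "e \<noteq> 0" by (simp add: e_def)
      moreover have "part_circlepath 0 (sin \<beta>) (pi/2 - \<beta>) (3*pi/2 + \<beta>) x = of_real (sin \<beta>) * e"
        by (simp add: part_circlepath_def e_def)
      moreover have "vector_derivative (part_circlepath 0 (sin \<beta>) (pi/2 - \<beta>) (3*pi/2 + \<beta>)) (at x)
          = \<i> * of_real (sin \<beta>) * of_real (pi + 2 * \<beta>) * e"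
        unfolding vector_derivative_part_circlepath e_def by (simp add: field_simps)
      ultimately show ?thesis using s by (simp add: field_simps)
    qed
    show "((\<lambda>x. 1 / part_circlepath 0 (sin \<beta>) (pi/2 - \<beta>) (3*pi/2 + \<beta>) x *
        vector_derivative (part_circlepath 0 (sin \<beta>) (pi/2 - \<beta>) (3*pi/2 + \<beta>)) (at x)) has_integral
        \<i> * of_real (pi + 2 * \<beta>)) {0..1}"
      unfolding eq using has_integral_const_real[of "\<i> * of_real (pi + 2 * \<beta>)" 0 1] by simp
  qed
  have "((\<lambda>z. 1 / z) has_contour_integral ((Ln a - Ln 1) + (\<i> * of_real (pi + 2 * \<beta>) + (Ln 1 - Ln b)))) (stolz_boundary \<beta>)"
    unfolding stolz_boundary_def a_def[symmetric] b_def[symmetric]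
  proof (intro has_contour_integral_join 1 2 3 valid_path_join valid_path_linepath valid_path_part_circlepath)
    show "pathfinish (part_circlepath 0 (sin \<beta>) (pi/2 - \<beta>) (3*pi/2 + \<beta>)) = pathstart (linepath b 1)"
      unfolding b_def by (simp only: pathstart_linepath pathfinish_part_circlepath add_0_left
          cis_lower_tangent[unfolded cis_conv_exp] cis_conv_exp)
  qed
  moreover have "(Ln a - Ln 1) + (\<i> * of_real (pi + 2 * \<beta>) + (Ln 1 - Ln b)) = 2 * of_real pi * \<i>"
    unfolding a_def b_def using \<beta> pi_gt_zero by (simp add: Ln_polar algebra_simps)
  ultimately show ?thesis by simp
qed

section \<open>Resolvents of Ritt operators\<close>

text \<open>The Ritt condition at one fixed angle with a named constant. Type \<alpha> gives
  resolvent bounds only at larger angles, so this form is reached after a slight increase of the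
  angle.\<close>

definition resolvent_bound :: "real \<Rightarrow> real \<Rightarrow> ('a::complex_hilbert_space \<Rightarrow>\<^sub>L 'a) \<Rightarrow> bool"
  where "resolvent_bound \<alpha> C T \<longleftrightarrow> T \<in> bounded_ops \<and> \<alpha> \<in> {0<..<pi/2} \<and> 0 \<le> C \<and>
    (\<forall>z. z \<notin> closure (stolz \<alpha>) \<longrightarrow> op_invertible (scale_op z id_blinfun - T) \<and>
      cmod (1 - z) * norm (resolvent z T) \<le> C)"

lemma ritt_of_type_mono:
  assumes T: "ritt_of_type \<alpha> T" and \<alpha>: "\<alpha> < \<alpha>'" "\<alpha>' < pi/2"
  shows "ritt_of_type \<alpha>' T"
proof -
  have "\<alpha> \<in> {0<..\<alpha>'}" using T \<alpha> unfolding ritt_of_type_def by auto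
  from closure_mono[OF stolz_mono[OF this \<alpha>(2)]] show ?thesis
    using T \<alpha> unfolding ritt_of_type_def by auto
qed

lemma ritt_of_type_resolvent_bound:
  assumes T: "ritt_of_type \<alpha> T" and \<alpha>: "\<alpha> < \<alpha>'" "\<alpha>' < pi/2"
  shows "\<exists>C. resolvent_bound \<alpha>' C T"
proof -
  have \<alpha>0: "\<alpha> \<in> {0<..\<alpha>'}" and \<alpha>': "\<alpha>' \<in> {\<alpha><..<pi/2}" using T \<alpha> unfolding ritt_of_type_def by auto
  have "bounded ((\<lambda>z. scale_op (1 - z) (resolvent z T)) ` (- closure (stolz \<alpha>')))"
    using T \<alpha>' unfolding ritt_of_type_def by blast
  then obtain C where C: "0 < C"
    "\<And>A. A \<in> (\<lambda>z. scale_op (1 - z) (resolvent z T)) ` (- closure (stolz \<alpha>')) \<Longrightarrow> norm A \<le> C"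
    unfolding bounded_pos by blast
  have "op_invertible (scale_op z id_blinfun - T) \<and> cmod (1 - z) * norm (resolvent z T) \<le> C"
    if z: "z \<notin> closure (stolz \<alpha>')" for z
  proof
    have "z \<notin> closure (stolz \<alpha>)" using closure_mono[OF stolz_mono[OF \<alpha>0 \<alpha>(2)]] z by blast
    then show "op_invertible (scale_op z id_blinfun - T)"
      using T unfolding ritt_of_type_def op_spectrum_def by blast
    show "cmod (1 - z) * norm (resolvent z T) \<le> C"
      using C(2)[of "scale_op (1 - z) (resolvent z T)"] z by (auto simp: norm_scale_op)
  qed
  then show ?thesis using T C(1) \<alpha>0 \<alpha>(2) unfolding resolvent_bound_def ritt_of_type_def
    by (intro exI[of _ C]) auto
qed

context
  fixes \<alpha> C :: real and T :: "'a::complex_hilbert_space \<Rightarrow>\<^sub>L 'a"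
  assumes rb: "resolvent_bound \<alpha> C T"
begin

lemma resolvent_bound_basic: "T \<in> bounded_ops" "\<alpha> \<in> {0<..<pi/2}" "0 \<le> C"
  using rb unfolding resolvent_bound_def by auto

lemma resolvent_invertible: "z \<notin> closure (stolz \<alpha>) \<Longrightarrow> op_invertible (scale_op z id_blinfun - T)"
  using rb unfolding resolvent_bound_def by auto

lemma resolvent_in_bounded_ops: "z \<notin> closure (stolz \<alpha>) \<Longrightarrow> resolvent z T \<in> bounded_ops"
  unfolding resolvent_def by (rule op_invertibleD(1)[OF resolvent_invertible])

lemma T_resolvent:
  assumes "z \<notin> closure (stolz \<alpha>)"
  shows "T (resolvent z T x) = z *\<^sub>C resolvent z T x - x"
  using op_invertible_apply(1)[OF resolvent_invertible[OF assms], of x]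
  by (simp add: resolvent_def[symmetric] blinfun.diff_left algebra_simps)

lemma resolvent_T:
  assumes "z \<notin> closure (stolz \<alpha>)"
  shows "resolvent z T (T x) = z *\<^sub>C resolvent z T x - x"
  using op_invertible_apply(2)[OF resolvent_invertible[OF assms], of x]
  by (simp add: resolvent_def[symmetric] blinfun.diff_left blinfun.diff_right
      bounded_ops_scaleC[OF resolvent_in_bounded_ops[OF assms]] algebra_simps)

lemma resolvent_commute:
  assumes z: "z \<notin> closure (stolz \<alpha>)" and B: "B \<in> bounded_ops" and BT: "\<And>x. B (T x) = T (blinfun_apply B x)"
  shows "resolvent z T (B x) = B (resolvent z T x)"
proof -
  have "(scale_op z id_blinfun - T) o\<^sub>L B = B o\<^sub>L (scale_op z id_blinfun - T)"
    by (rule blinfun_eqI) (simp add: blinfun.diff_left blinfun.diff_right BT bounded_ops_scaleC[OF B])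
  from op_inverse_commute[OF resolvent_invertible[OF z] this]
  show ?thesis unfolding resolvent_def by (metis blinfun_apply_blinfun_compose)
qed

lemma resolvent_identity:
  assumes z: "z \<notin> closure (stolz \<alpha>)" and w: "w \<notin> closure (stolz \<alpha>)"
  shows "resolvent z T x - resolvent w T x = (w - z) *\<^sub>C resolvent z T (resolvent w T x)"
proof -
  have "resolvent z T (T (resolvent w T x)) = z *\<^sub>C resolvent z T (resolvent w T x) - resolvent w T x"
    by (rule resolvent_T[OF z])
  moreover have "resolvent z T (T (resolvent w T x)) = w *\<^sub>C resolvent z T (resolvent w T x) - resolvent z T x"
    by (simp add: T_resolvent[OF w] blinfun.diff_right bounded_ops_scaleC[OF resolvent_in_bounded_ops[OF z]])
  ultimately show ?thesis by (simp add: scaleC_diff_left algebra_simps)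
qed

lemma notin_closure_neq_one: "z \<notin> closure (stolz \<alpha>) \<Longrightarrow> z \<noteq> 1"
  using one_in_closure_stolz resolvent_bound_basic by blast

lemma norm_resolvent_le:
  assumes z: "z \<notin> closure (stolz \<alpha>)"
  shows "norm (resolvent z T) \<le> C / cmod (1 - z)"
  using rb z notin_closure_neq_one[OF z] unfolding resolvent_bound_def by (auto simp: field_simps)

lemma norm_resolvent_apply_le:
  assumes z: "z \<notin> closure (stolz \<alpha>)"
  shows "norm (resolvent z T x) \<le> C / cmod (1 - z) * norm x"
  by (rule order_trans[OF norm_blinfun mult_right_mono[OF norm_resolvent_le[OF z]]]) simp

lemma continuous_on_resolvent: "continuous_on (- closure (stolz \<alpha>)) (\<lambda>z. resolvent z T)"
  unfolding continuous_on_def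
proof
  fix w assume w: "w \<in> - closure (stolz \<alpha>)"
  then have w1: "w \<noteq> 1" using notin_closure_neq_one by blast
  have "((\<lambda>z. cmod (w - z) * (C / cmod (1 - z) * norm (resolvent w T))) \<longlongrightarrow>
      cmod (w - w) * (C / cmod (1 - w) * norm (resolvent w T))) (at w within - closure (stolz \<alpha>))"
    by (intro tendsto_intros) (use w1 in auto)
  then have lim: "((\<lambda>z. cmod (w - z) * (C / cmod (1 - z) * norm (resolvent w T))) \<longlongrightarrow> 0)
      (at w within - closure (stolz \<alpha>))" by simp
  have "norm (resolvent z T - resolvent w T) \<le> cmod (w - z) * (C / cmod (1 - z) * norm (resolvent w T))"
    if z: "z \<notin> closure (stolz \<alpha>)" for z
  proof (rule norm_blinfun_bound)
    show "0 \<le> cmod (w - z) * (C / cmod (1 - z) * norm (resolvent w T))"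
      using resolvent_bound_basic by auto
    fix x
    have "norm ((resolvent z T - resolvent w T) x) = cmod (w - z) * norm (resolvent z T (resolvent w T x))"
      using resolvent_identity[OF z, of w x] w by (simp add: blinfun.diff_left norm_scaleC)
    also have "\<dots> \<le> cmod (w - z) * (C / cmod (1 - z) * (norm (resolvent w T) * norm x))"
      using resolvent_bound_basic
      by (intro mult_left_mono order_trans[OF norm_resolvent_apply_le[OF z]] norm_blinfun) auto
    finally show "norm ((resolvent z T - resolvent w T) x)
        \<le> cmod (w - z) * (C / cmod (1 - z) * norm (resolvent w T)) * norm x"
      by (simp add: mult_ac)
  qed
  then have "((\<lambda>z. resolvent z T - resolvent w T) \<longlongrightarrow> 0) (at w within - closure (stolz \<alpha>))"
    by (intro Lim_null_comparison[OF _ lim]) (auto simp: eventually_at_filter)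
  then show "((\<lambda>z. resolvent z T) \<longlongrightarrow> resolvent w T) (at w within - closure (stolz \<alpha>))"
    by (simp add: LIM_zero_iff)
qed

text \<open>The difference quotient at \<open>w\<close> equals \<open>- <R(z) R(w) x, y>\<close> by
  the resolvent identity, and \<open>R\<close> is norm continuous.\<close>

lemma holomorphic_on_resolvent: "(\<lambda>z. cinner (resolvent z T x) y) holomorphic_on - closure (stolz \<alpha>)"
  unfolding holomorphic_on_def
proof
  fix w assume w: "w \<in> - closure (stolz \<alpha>)"
  have op: "open (- closure (stolz \<alpha>))" by (rule open_Compl[OF closed_closure])
  have "continuous_on (- closure (stolz \<alpha>)) (\<lambda>z. - cinner (resolvent z T (resolvent w T x)) y)"
    by (intro continuous_intros bounded_bilinear.continuous_on[OF bounded_bilinear_cinner] continuous_on_resolvent)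
  then have "((\<lambda>z. - cinner (resolvent z T (resolvent w T x)) y) \<longlongrightarrow> - cinner (resolvent w T (resolvent w T x)) y) (at w)"
    using w by (metis (no_types, lifting) at_within_open op continuous_on_def)
  then have "((\<lambda>z. (cinner (resolvent z T x) y - cinner (resolvent w T x) y) / (z - w)) \<longlongrightarrow>
      - cinner (resolvent w T (resolvent w T x)) y) (at w)"
  proof (rule Lim_transform_within_open[OF _ op w])
    fix z assume z: "z \<in> - closure (stolz \<alpha>)" "z \<noteq> w"
    have "cinner (resolvent z T x) y - cinner (resolvent w T x) y = (w - z) * cinner (resolvent z T (resolvent w T x)) y"
      using resolvent_identity[of z w x] z w by (simp add: cinner.diff_left[symmetric] cinner_scaleC_left)
    then show "- cinner (resolvent z T (resolvent w T x)) y
        = (cinner (resolvent z T x) y - cinner (resolvent w T x) y) / (z - w)"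
      using z(2) by (simp add: field_simps)
  qed
  then have "((\<lambda>z. cinner (resolvent z T x) y) has_field_derivative - cinner (resolvent w T (resolvent w T x)) y) (at w)"
    by (simp add: has_field_derivative_iff)
  then show "(\<lambda>z. cinner (resolvent z T x) y) field_differentiable at w within - closure (stolz \<alpha>)"
    using field_differentiable_at_within field_differentiable_def by blast
qed

text \<open>Cauchy's formula on the dilated curves \<open>\<rho> \<Gamma>\<close>: the integral does not depend on \<open>\<rho> > 1\<close>; it tends to
  the left-hand side for \<open>\<rho> \<rightarrow> 1\<close>, and for \<open>\<rho> \<rightarrow> \<infinity>\<close> it is computed from
  \<open>(1 - z) R(z) = -I + (I - T)/z + O(z\<^sup>-\<^sup>2)\<close>.\<close>

lemma resolvent_cauchy_integral:
  assumes \<beta>: "\<alpha> < \<beta>" "\<beta> < pi/2"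
  shows "(\<integral>t. (1 - stolz_boundary \<beta> t) * cinner (resolvent (stolz_boundary \<beta> t) T x) y * stolz_velocity \<beta> t
    \<partial>unit_measure) = 2 * of_real pi * \<i> * cinner (x - T x) y"
proof -
  have \<alpha>: "0 < \<alpha>" and C0: "0 \<le> C" using resolvent_bound_basic by auto
  have \<beta>': "\<beta> \<in> {0<..<pi/2}" using \<alpha> \<beta> by auto
  have s: "0 < sin \<beta>" using sin_angle[OF \<beta>'] by auto
  let ?\<Gamma> = "\<lambda>\<rho> t. of_real \<rho> * stolz_boundary \<beta> t"
  define f where "f z = (1 - z) * cinner (resolvent z T x) y" for z
  have f_hol: "f holomorphic_on - closure (stolz \<alpha>)"
    unfolding f_def by (intro holomorphic_intros holomorphic_on_resolvent)
  have f_bound: "cmod (f z) \<le> C * norm x * norm y" if z: "z \<notin> closure (stolz \<alpha>)" for z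
  proof -
    have "cmod (f z) \<le> cmod (1 - z) * (C / cmod (1 - z) * norm x * norm y)"
      unfolding f_def norm_mult
      by (intro mult_left_mono order_trans[OF cmod_cinner_le] mult_right_mono norm_resolvent_apply_le z) auto
    then show ?thesis using notin_closure_neq_one[OF z] by simp
  qed
  have out: "?\<Gamma> \<rho> t \<notin> closure (stolz \<alpha>)" if "1 < \<rho>" "t \<in> {0..1}" for \<rho> t
    using scaled_stolz_boundary_notin_closure[OF \<alpha> \<beta> that(2,1)] .
  have comp: "?\<Gamma> \<rho> = (*) (of_real \<rho>) \<circ> stolz_boundary \<beta>" for \<rho> by (simp add: fun_eq_iff)
  have vp: "valid_path (?\<Gamma> \<rho>)" if "1 < \<rho>" for \<rho>
    unfolding comp using that by (subst valid_path_times) (auto simp: valid_path_stolz_boundary)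
  have f_cont: "continuous_on (?\<Gamma> \<rho> ` {0..1}) f" if "1 < \<rho>" for \<rho>
    by (rule continuous_on_subset[OF holomorphic_on_imp_continuous_on[OF f_hol]]) (use out[OF that] in auto)
  define F where "F \<rho> = contour_integral (?\<Gamma> \<rho>) f" for \<rho>
  \<comment> \<open>The straight homotopy between two dilates runs through dilates with factors
    above one, all outside the closed domain.\<close>
  have F_const: "F \<rho> = F \<sigma>" if "1 < \<rho>" "1 < \<sigma>" for \<rho> \<sigma>
    unfolding F_def
  proof (rule Cauchy_theorem_homotopic_loops[OF _ _ f_hol vp[OF that(1)] vp[OF that(2)]])
    show "homotopic_loops (- closure (stolz \<alpha>)) (?\<Gamma> \<rho>) (?\<Gamma> \<sigma>)"
    proof (rule homotopic_loops_linear)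
      fix t :: real assume t: "t \<in> {0..1}"
      show "closed_segment (?\<Gamma> \<rho> t) (?\<Gamma> \<sigma> t) \<subseteq> - closure (stolz \<alpha>)"
      proof
        fix z assume "z \<in> closed_segment (?\<Gamma> \<rho> t) (?\<Gamma> \<sigma> t)"
        then obtain u where u: "0 \<le> u" "u \<le> 1" "z = (1 - u) *\<^sub>R ?\<Gamma> \<rho> t + u *\<^sub>R ?\<Gamma> \<sigma> t"
          unfolding closed_segment_def by blast
        have "z = ?\<Gamma> ((1 - u) * \<rho> + u * \<sigma>) t"
          unfolding u(3) by (simp add: scaleR_conv_of_real algebra_simps)
        moreover have "1 < (1 - u) * \<rho> + u * \<sigma>"
          using convex_bound_lt[of "- \<rho>" "- 1" "- \<sigma>" "1 - u" u] that u by (simp add: algebra_simps)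
        ultimately show "z \<in> - closure (stolz \<alpha>)" using out[OF _ t] by (metis ComplI)
      qed
    qed (use vp that valid_path_imp_path stolz_boundary_endpoints in
        \<open>auto simp: pathstart_def pathfinish_def\<close>)
  qed (rule open_Compl[OF closed_closure])
  have F_int: "F \<rho> = (\<integral>t. f (?\<Gamma> \<rho> t) * of_real \<rho> * stolz_velocity \<beta> t \<partial>unit_measure)" if "1 < \<rho>" for \<rho>
    unfolding F_def by (rule contour_integral_scaled_stolz_boundary(1)[OF \<beta>' f_cont[OF that]])
  obtain V where V: "\<And>t. cmod (stolz_velocity \<beta> t) \<le> V" using stolz_velocity_bounded[OF \<beta>'] by blast
  have V0: "0 \<le> V" using V[of 0] order_trans[OF norm_ge_zero] by blast
  define \<rho> where "\<rho> n = 1 + 1 / real (Suc n)" for n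
  have \<rho>: "1 < \<rho> n" "\<rho> n \<le> 2" for n by (simp_all add: \<rho>_def)
  have \<rho>_lim: "\<rho> \<longlonglongrightarrow> 1"
    unfolding \<rho>_def using tendsto_add[OF tendsto_const[of 1] LIMSEQ_Suc[OF lim_1_over_n]] by simp
  have cont: "continuous_on {0<..<1} (\<lambda>t. f (?\<Gamma> r t))" if "1 \<le> r" for r
  proof (rule continuous_on_compose2[OF holomorphic_on_imp_continuous_on[OF f_hol]])
    show "continuous_on {0<..<1} (?\<Gamma> r)"
      by (intro continuous_intros continuous_on_subset[OF continuous_on_stolz_boundary]) auto
    show "?\<Gamma> r ` {0<..<1} \<subseteq> - closure (stolz \<alpha>)"
      using out[of r] stolz_boundary_notin_closure[OF \<alpha> \<beta>] that by (cases "r = 1") auto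
  qed
  have "(\<lambda>n. \<integral>t. f (?\<Gamma> (\<rho> n) t) * of_real (\<rho> n) * stolz_velocity \<beta> t \<partial>unit_measure)
      \<longlonglongrightarrow> (\<integral>t. f (?\<Gamma> 1 t) * of_real 1 * stolz_velocity \<beta> t \<partial>unit_measure)"
  proof (rule integral_dominated_convergence)
    have m: "(\<lambda>t. f (?\<Gamma> r t) * of_real r * stolz_velocity \<beta> t) \<in> borel_measurable unit_measure" if "1 \<le> r" for r
      by (intro borel_measurable_times borel_measurable_const measurable_stolz_velocity
          measurable_unit_continuous cont that)
    show "(\<lambda>t. f (?\<Gamma> 1 t) * of_real 1 * stolz_velocity \<beta> t) \<in> borel_measurable unit_measure" by (rule m) simp
    show "(\<lambda>t. f (?\<Gamma> (\<rho> n) t) * of_real (\<rho> n) * stolz_velocity \<beta> t) \<in> borel_measurable unit_measure" for n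
      using \<rho>(1)[of n] by (intro m) simp
    show "integrable unit_measure (\<lambda>t. C * norm x * norm y * 2 * V)" by simp
    show "AE t in unit_measure. (\<lambda>n. f (?\<Gamma> (\<rho> n) t) * of_real (\<rho> n) * stolz_velocity \<beta> t)
        \<longlonglongrightarrow> f (?\<Gamma> 1 t) * of_real 1 * stolz_velocity \<beta> t"
    proof (rule AE_I2)
      fix t assume "t \<in> space unit_measure"
      then have t: "t \<in> {0<..<1}" by simp
      have "continuous (at (?\<Gamma> 1 t)) f"
        using holomorphic_on_imp_continuous_on[OF f_hol] stolz_boundary_notin_closure[OF \<alpha> \<beta> t]
        by (simp add: continuous_on_eq_continuous_at[OF open_Compl[OF closed_closure]])
      then have "(\<lambda>n. f (?\<Gamma> (\<rho> n) t)) \<longlonglongrightarrow> f (?\<Gamma> 1 t)"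
        by (rule isCont_tendsto_compose) (intro tendsto_intros \<rho>_lim)
      then show "(\<lambda>n. f (?\<Gamma> (\<rho> n) t) * of_real (\<rho> n) * stolz_velocity \<beta> t)
        \<longlonglongrightarrow> f (?\<Gamma> 1 t) * of_real 1 * stolz_velocity \<beta> t"
        by (intro tendsto_intros \<rho>_lim)
    qed
    show "AE t in unit_measure. norm (f (?\<Gamma> (\<rho> n) t) * of_real (\<rho> n) * stolz_velocity \<beta> t)
        \<le> C * norm x * norm y * 2 * V" for n
    proof (rule AE_I2)
      fix t assume "t \<in> space unit_measure"
      then have "t \<in> {0..1}" by simp
      then show "norm (f (?\<Gamma> (\<rho> n) t) * of_real (\<rho> n) * stolz_velocity \<beta> t) \<le> C * norm x * norm y * 2 * V"
        unfolding norm_mult using \<rho>[of n] C0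
        by (intro mult_mono f_bound out V) auto
    qed
  qed
  then have lim1: "(\<lambda>n. F (\<rho> n)) \<longlonglongrightarrow> (\<integral>t. f (stolz_boundary \<beta> t) * stolz_velocity \<beta> t \<partial>unit_measure)"
    by (simp add: F_int \<rho>)
  define K where "K = norm (T o\<^sub>L (id_blinfun - T)) * C * norm x * norm y"
  have K0: "0 \<le> K" unfolding K_def using C0 by auto
  have F_asymp: "cmod (F r - 2 * of_real pi * \<i> * cinner (x - T x) y) \<le> r * V * (K / (r * sin \<beta> * (r * sin \<beta> - 1)))"
    if r: "1 < r" "1 < r * sin \<beta>" for r
  proof -
    define e where "e z = cinner (T (resolvent z T x) - T (T (resolvent z T x))) y / z" for z
    have ne: "?\<Gamma> r t \<noteq> 0" if "t \<in> {0..1}" for t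
      using cmod_stolz_boundary_ge[OF \<beta>' that] s r by auto
    \<comment> \<open>Insert \<open>R = (I + T R)/z\<close> into
      \<open>(1 - z) R = -I + (I - T) R\<close>. The constant integrates to zero, \<open>1/z\<close>
      gives the winding number, and \<open>e\<close> is of order \<open>z^-2\<close> against a curve
      of length of order \<open>r\<close>.\<close>
    have expand: "f z = - cinner x y + (cinner (x - T x) y * (1 / z) + e z)" if z: "z \<notin> closure (stolz \<alpha>)" "z \<noteq> 0" for z
    proof -
      define v where "v = cinner (resolvent z T x) y"
      have Tv: "cinner (T (resolvent z T x)) y = z * v - cinner x y"
        unfolding T_resolvent[OF z(1)] by (simp add: cinner.diff_left cinner_scaleC_left v_def)
      have TTv: "cinner (T (T (resolvent z T x))) y = z * (z * v - cinner x y) - cinner (T x) y"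
        unfolding T_resolvent[OF z(1)] blinfun.diff_right bounded_ops_scaleC[OF resolvent_bound_basic(1)]
        by (simp add: T_resolvent[OF z(1)] cinner.diff_left cinner_scaleC_left v_def)
      show ?thesis using z(2)
        unfolding f_def e_def cinner.diff_left Tv TTv v_def[symmetric] by (simp add: field_simps)
    qed
    have e_bound: "cmod (e (?\<Gamma> r t)) \<le> K / (r * sin \<beta> * (r * sin \<beta> - 1))" if t: "t \<in> {0..1}" for t
    proof -
      let ?z = "?\<Gamma> r t"
      have z: "?z \<notin> closure (stolz \<alpha>)" by (rule out[OF r(1) t])
      have g: "r * sin \<beta> \<le> cmod ?z"
        using cmod_stolz_boundary_ge[OF \<beta>' t] r by (simp add: norm_mult)
      have g': "r * sin \<beta> - 1 \<le> cmod (1 - ?z)" using norm_triangle_ineq2[of ?z 1] g by (simp add: norm_minus_commute)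
      have "norm (T (resolvent ?z T x) - T (T (resolvent ?z T x))) = norm ((T o\<^sub>L (id_blinfun - T)) (resolvent ?z T x))"
        by (simp add: blinfun.diff_left blinfun.diff_right)
      also have "\<dots> \<le> norm (T o\<^sub>L (id_blinfun - T)) * (C / cmod (1 - ?z) * norm x)"
        by (rule order_trans[OF norm_blinfun mult_left_mono[OF norm_resolvent_apply_le[OF z]]]) simp
      finally have "cmod (cinner (T (resolvent ?z T x) - T (T (resolvent ?z T x))) y)
          \<le> norm (T o\<^sub>L (id_blinfun - T)) * (C / cmod (1 - ?z) * norm x) * norm y"
        by (intro order_trans[OF cmod_cinner_le] mult_right_mono) auto
      also have "\<dots> = K / cmod (1 - ?z)" by (simp add: K_def)
      also have "\<dots> \<le> K / (r * sin \<beta> - 1)" using g' r K0 by (intro divide_left_mono) (auto intro!: mult_pos_pos)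
      finally have 1: "cmod (cinner (T (resolvent ?z T x) - T (T (resolvent ?z T x))) y) \<le> K / (r * sin \<beta> - 1)" .
      have "cmod (e ?z) = cmod (cinner (T (resolvent ?z T x) - T (T (resolvent ?z T x))) y) / cmod ?z"
        by (simp only: e_def norm_divide)
      also have "\<dots> \<le> K / (r * sin \<beta> - 1) / (r * sin \<beta>)"
        using 1 g r s K0 by (intro frac_le) auto
      finally show ?thesis by (simp add: field_simps)
    qed
    have cont_inv: "continuous_on (?\<Gamma> r ` {0..1}) (\<lambda>z. 1 / z)"
      by (intro continuous_intros) (use ne in auto)
    have "continuous_on (?\<Gamma> r ` {0..1}) (\<lambda>z. f z + cinner x y - cinner (x - T x) y * (1 / z))"
      by (intro continuous_intros f_cont r cont_inv)
    then have e_cont: "continuous_on (?\<Gamma> r ` {0..1}) e"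
      by (rule continuous_on_eq) (use expand out[OF r(1)] ne in auto)
    note I = contour_integral_scaled_stolz_boundary[OF \<beta>', of r]
    note Ic = I[OF continuous_on_const] note Ii = I[OF cont_inv] note Ie = I[OF e_cont]
    have c0: "(\<integral>t. c * of_real r * stolz_velocity \<beta> t \<partial>unit_measure) = 0" for c
    proof -
      have "((\<lambda>_. c) has_contour_integral 0) (?\<Gamma> r)"
        using contour_integral_primitive[of UNIV "\<lambda>z. c * z" "\<lambda>_. c" "?\<Gamma> r"] vp[OF r(1)]
        by (auto intro!: derivative_eq_intros simp: pathstart_def pathfinish_def
            stolz_boundary_endpoints[unfolded pathstart_def pathfinish_def])
      then show ?thesis using Ic(1)[of c] by (simp add: contour_integral_unique)
    qed
    have i1: "(\<integral>t. 1 / ?\<Gamma> r t * of_real r * stolz_velocity \<beta> t \<partial>unit_measure) = 2 * of_real pi * \<i>"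
    proof -
      have "continuous_on ((\<lambda>t. of_real 1 * stolz_boundary \<beta> t) ` {0..1}) (\<lambda>z. 1 / z)"
        by (intro continuous_intros) (use ne r in auto)
      from contour_integral_scaled_stolz_boundary(1)[OF \<beta>' this]
      have "2 * of_real pi * \<i> = (\<integral>t. 1 / stolz_boundary \<beta> t * stolz_velocity \<beta> t \<partial>unit_measure)"
        using contour_integral_unique[OF contour_integral_inverse_stolz_boundary[OF \<beta>']] by simp
      then show ?thesis using r by simp
    qed
    have "F r = (\<integral>t. (- cinner x y) * of_real r * stolz_velocity \<beta> t +
        (cinner (x - T x) y * (1 / ?\<Gamma> r t * of_real r * stolz_velocity \<beta> t) +
          e (?\<Gamma> r t) * of_real r * stolz_velocity \<beta> t) \<partial>unit_measure)"
      unfolding F_int[OF r(1)]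
    proof (rule Bochner_Integration.integral_cong[OF refl])
      fix t assume "t \<in> space unit_measure"
      then have t: "t \<in> {0..1}" by simp
      show "f (?\<Gamma> r t) * of_real r * stolz_velocity \<beta> t = (- cinner x y) * of_real r * stolz_velocity \<beta> t +
        (cinner (x - T x) y * (1 / ?\<Gamma> r t * of_real r * stolz_velocity \<beta> t) +
          e (?\<Gamma> r t) * of_real r * stolz_velocity \<beta> t)"
        unfolding expand[OF out[OF r(1) t] ne[OF t]] by (simp only: distrib_right mult.assoc)
    qed
    also have "\<dots> = 0 + (cinner (x - T x) y * (2 * of_real pi * \<i>) +
        (\<integral>t. e (?\<Gamma> r t) * of_real r * stolz_velocity \<beta> t \<partial>unit_measure))"
    proof -
      have "(\<integral>t. A t + (k * B t + E t) \<partial>unit_measure)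
          = (\<integral>t. A t \<partial>unit_measure) + (k * (\<integral>t. B t \<partial>unit_measure) + (\<integral>t. E t \<partial>unit_measure))"
        if "integrable unit_measure A" "integrable unit_measure B" "integrable unit_measure E"
        for A B E :: "real \<Rightarrow> complex" and k using that by simp
      from this[OF Ic(2) Ii(2) Ie(2)] show ?thesis unfolding c0 i1 .
    qed
    finally have "F r - 2 * of_real pi * \<i> * cinner (x - T x) y
        = (\<integral>t. e (?\<Gamma> r t) * of_real r * stolz_velocity \<beta> t \<partial>unit_measure)" by simp
    also have "cmod \<dots> \<le> (\<integral>t. r * V * (K / (r * sin \<beta> * (r * sin \<beta> - 1))) \<partial>unit_measure)"
    proof (rule Bochner_Integration.integral_norm_bound_integral[OF Ie(2)])
      fix t assume "t \<in> space unit_measure"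
      then have t: "t \<in> {0..1}" by simp
      have "norm (e (?\<Gamma> r t) * of_real r * stolz_velocity \<beta> t) \<le> K / (r * sin \<beta> * (r * sin \<beta> - 1)) * r * V"
        unfolding norm_mult using r K0 V0 s
        by (intro mult_mono e_bound t V) (auto intro!: divide_nonneg_nonneg mult_nonneg_nonneg)
      then show "norm (e (?\<Gamma> r t) * of_real r * stolz_velocity \<beta> t) \<le> r * V * (K / (r * sin \<beta> * (r * sin \<beta> - 1)))"
        by (simp only: mult_ac)
    qed simp
    also have "\<dots> = r * V * (K / (r * sin \<beta> * (r * sin \<beta> - 1)))"
      by (simp add: measure_def emeasure_restrict_space)
    finally show ?thesis .
  qed
  have "F 2 = 2 * of_real pi * \<i> * cinner (x - T x) y"
  proof -
    have "((\<lambda>r. V * (K / (sin \<beta> * (r * sin \<beta> - 1)))) \<longlongrightarrow> 0) at_top"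
      using s by real_asymp
    moreover have "\<forall>\<^sub>F r in at_top. norm (F 2 - 2 * of_real pi * \<i> * cinner (x - T x) y)
        \<le> V * (K / (sin \<beta> * (r * sin \<beta> - 1)))"
      using eventually_gt_at_top[of "max 1 (1 / sin \<beta>)"]
    proof eventually_elim
      case (elim r)
      then have "1 < r" "1 / sin \<beta> < r" by simp_all
      then have r: "1 < r" "1 < r * sin \<beta>" using s by (simp_all add: field_simps)
      then show ?case using F_asymp[OF r] F_const[of 2 r] by simp
    qed
    ultimately have "((\<lambda>r::real. F 2 - 2 * of_real pi * \<i> * cinner (x - T x) y) \<longlongrightarrow> 0) at_top"
      by (rule Lim_null_comparison[rotated])
    then have "F 2 - 2 * of_real pi * \<i> * cinner (x - T x) y = 0"
      by (simp add: tendsto_const_iff)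
    then show ?thesis by simp
  qed
  moreover have "(\<lambda>n. F (\<rho> n)) = (\<lambda>n. F 2)" using F_const[OF \<rho>(1)] by auto
  ultimately have "(\<integral>t. f (stolz_boundary \<beta> t) * stolz_velocity \<beta> t \<partial>unit_measure)
      = 2 * of_real pi * \<i> * cinner (x - T x) y"
    using LIMSEQ_unique[OF lim1] by simp
  then show ?thesis by (simp add: f_def)
qed

end

section \<open>Operator-valued integrals\<close>

lemma bounded_bilinear_scale_op: "bounded_bilinear (scale_op :: complex \<Rightarrow> ('a::complex_hilbert_space \<Rightarrow>\<^sub>L 'a) \<Rightarrow> _)"
proof (rule bounded_bilinear.intro)
  show "scale_op (r *\<^sub>R a) B = r *\<^sub>R scale_op a B" for r a and B :: "'a \<Rightarrow>\<^sub>L 'a"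
    by (rule blinfun_eqI)
      (simp add: blinfun.scaleR_left scaleR_conv_of_real scaleC_scaleC[symmetric] scaleC_of_real)
  show "scale_op a (r *\<^sub>R B) = r *\<^sub>R scale_op a B" for r a and B :: "'a \<Rightarrow>\<^sub>L 'a"
    by (rule blinfun_eqI) (simp add: blinfun.scaleR_left scaleR_scaleC_commute)
  show "\<exists>K. \<forall>a B. norm (scale_op a B :: 'a \<Rightarrow>\<^sub>L 'a) \<le> norm a * norm B * K"
    by (rule exI[of _ 1]) (simp add: norm_scale_op)
qed (auto intro!: blinfun_eqI simp: blinfun.add_left scaleC_add_left scaleC_add_right)

lemma bounded_linear_cinner_apply:
  fixes x y :: "'a::complex_hilbert_space"
  shows "bounded_linear (\<lambda>A. cinner (blinfun_apply A x) y)"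
  by (rule bounded_linear_compose[OF bounded_bilinear.bounded_linear_left[OF bounded_bilinear_cinner]
        bounded_bilinear.bounded_linear_left[OF bounded_bilinear_blinfun_apply]])

text \<open>In a nonseparable space the difference of two measurable maps need not be measurable.
  Here one of them has finitely many values, so on each piece only a fixed vector is
  subtracted.\<close>

lemma measurable_norm_diff_simple:
  fixes f s :: "'b \<Rightarrow> 'c::real_normed_vector"
  assumes f: "f \<in> borel_measurable M" and s: "simple_function M s"
  shows "(\<lambda>t. norm (f t - s t)) \<in> borel_measurable M"
proof (rule measurable_compose_countable'[of "s ` space M" "\<lambda>c t. norm (f t - c)"])
  have "(\<lambda>v. norm (v - c)) \<in> borel_measurable borel" for c :: 'c
    by (intro borel_measurable_continuous_onI continuous_intros)
  from measurable_compose[OF f this] show "(\<lambda>t. norm (f t - c)) \<in> borel_measurable M" for c .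
  have fin: "finite (s ` space M)" using s unfolding simple_function_def by blast
  then show "countable (s ` space M)" by (rule countable_finite)
  show "s \<in> M \<rightarrow>\<^sub>M count_space (s ` space M)"
    unfolding measurable_count_space_eq2[OF fin] using s unfolding simple_function_def by auto
qed

text \<open>The bridge to scalar integration: the functional is applied to the approximating simple
  functions, and its norm controls the error.\<close>

lemma has_op_integral_functional:
  fixes L :: "'c::real_normed_vector \<Rightarrow> complex"
  assumes X: "has_op_integral M f X" and L: "bounded_linear L"
  shows "has_bochner_integral M (\<lambda>t. L (f t)) (L X)"
proof -
  obtain s where f: "f \<in> borel_measurable M"
    and s: "\<And>i. Bochner_Integration.simple_bochner_integrable M (s i)"
    and lim: "(\<lambda>i. \<integral>\<^sup>+t. ennreal (norm (f t - s i t)) \<partial>M) \<longlonglongrightarrow> 0"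
    and X: "(\<lambda>i. Bochner_Integration.simple_bochner_integral M (s i)) \<longlonglongrightarrow> X"
    using X unfolding has_op_integral_def by blast
  obtain K where K: "0 < K" "\<And>v. norm (L v) \<le> norm v * K"
    using bounded_linear.pos_bounded[OF L] by blast
  have Lb: "L \<in> borel_measurable borel"
    by (intro borel_measurable_continuous_onI linear_continuous_on L)
  have m: "(\<lambda>t. L (f t)) \<in> borel_measurable M" by (rule measurable_compose[OF f Lb])
  have sm: "s i \<in> borel_measurable M" for i
    using s[of i] by (auto intro: borel_measurable_simple_function elim: Bochner_Integration.simple_bochner_integrable.cases)
  show ?thesis
  proof (rule has_bochner_integral.intros)
    show "Bochner_Integration.simple_bochner_integrable M (\<lambda>t. L (s i t))" for i
      using simple_bochner_integrable_compose2[of "\<lambda>x y. L x", OF _ s s] linear_0[OF bounded_linear.linear[OF L]]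
      by simp
    show "(\<lambda>i. Bochner_Integration.simple_bochner_integral M (\<lambda>t. L (s i t))) \<longlonglongrightarrow> L X"
      unfolding simple_bochner_integral_linear[OF bounded_linear.linear[OF L] s]
      by (rule bounded_linear.tendsto[OF L X])
    show "(\<lambda>i. \<integral>\<^sup>+t. ennreal (norm (L (f t) - L (s i t))) \<partial>M) \<longlonglongrightarrow> 0"
    proof (rule tendsto_sandwich[OF _ _ tendsto_const])
      have "(\<integral>\<^sup>+t. ennreal (norm (L (f t) - L (s i t))) \<partial>M) \<le> ennreal K * (\<integral>\<^sup>+t. ennreal (norm (f t - s i t)) \<partial>M)" for i
      proof -
        have "(\<integral>\<^sup>+t. ennreal (norm (L (f t) - L (s i t))) \<partial>M) \<le> (\<integral>\<^sup>+t. ennreal K * ennreal (norm (f t - s i t)) \<partial>M)"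
          using K by (intro nn_integral_mono)
            (simp add: ennreal_mult[symmetric] linear_diff[OF bounded_linear.linear[OF L], symmetric] mult.commute)
        also have "\<dots> \<le> ennreal K * (\<integral>\<^sup>+t. ennreal (norm (f t - s i t)) \<partial>M)"
        proof (cases "\<integral>\<^sup>+t. ennreal (norm (f t - s i t)) \<partial>M = top")
          case True then show ?thesis using K by (simp add: ennreal_mult_top)
        next
          case False
          show ?thesis
          proof -
            have "(\<lambda>t. ennreal (norm (f t - s i t))) \<in> borel_measurable M"
              using measurable_norm_diff_simple[OF f] s[of i]
              by (auto elim!: Bochner_Integration.simple_bochner_integrable.cases)
            then show ?thesis by (simp add: nn_integral_cmult)
          qed
        qed
        finally show ?thesis .
      qed
      then show "\<forall>\<^sub>F i in sequentially. (\<integral>\<^sup>+t. ennreal (norm (L (f t) - L (s i t))) \<partial>M)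
          \<le> ennreal K * (\<integral>\<^sup>+t. ennreal (norm (f t - s i t)) \<partial>M)" by simp
      show "(\<lambda>i. ennreal K * (\<integral>\<^sup>+t. ennreal (norm (f t - s i t)) \<partial>M)) \<longlonglongrightarrow> 0"
        using ennreal_tendsto_cmult[OF _ lim, of "ennreal K"] by simp
    qed simp
  qed (rule m)
qed

lemma has_op_integral_unique:
  fixes f :: "'b \<Rightarrow> 'a::complex_hilbert_space \<Rightarrow>\<^sub>L 'a"
  assumes X: "has_op_integral M f X" and Y: "has_op_integral M f Y"
  shows "X = Y"
proof (rule blinfun_eqI, rule cinner_ext)
  fix x y
  show "cinner (X x) y = cinner (Y x) y"
    using has_bochner_integral_eq[OF has_op_integral_functional[OF X bounded_linear_cinner_apply]
        has_op_integral_functional[OF Y bounded_linear_cinner_apply]] .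
qed

lemma op_integral_eq:
  fixes f :: "'b \<Rightarrow> 'a::complex_hilbert_space \<Rightarrow>\<^sub>L 'a"
  assumes "has_op_integral M f X"
  shows "op_integral M f = X"
  unfolding op_integral_def using assms has_op_integral_unique by (intro the_equality) blast+

text \<open>Existence without separability, from explicit simple approximants. Dominated convergence
  with majorant \<open>2 w\<close> sends the errors \<open>a i\<close> to zero, and the simple
  integrals with indices \<open>i\<close> and \<open>j\<close> differ by at most
  \<open>a i + a j\<close>.\<close>

lemma has_op_integral_dominated_limit:
  fixes f :: "'b \<Rightarrow> 'c::banach"
  assumes M: "finite_measure M" and s: "\<And>i. simple_function M (s i)"
    and lim: "\<And>t. t \<in> space M \<Longrightarrow> (\<lambda>i. s i t) \<longlonglongrightarrow> f t"
    and bound: "\<And>i t. t \<in> space M \<Longrightarrow> norm (s i t) \<le> w t" and w: "integrable M w"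
  shows "\<exists>X. has_op_integral M f X"
proof -
  interpret finite_measure M by (rule M)
  have sm: "s i \<in> borel_measurable M" for i by (rule borel_measurable_simple_function[OF s])
  have f: "f \<in> borel_measurable M" by (rule borel_measurable_LIMSEQ_metric[OF sm lim])
  have sb: "Bochner_Integration.simple_bochner_integrable M (s i)" for i
    by (rule Bochner_Integration.simple_bochner_integrable.intros[OF s]) simp
  define a where "a i = (\<integral>\<^sup>+t. ennreal (norm (f t - s i t)) \<partial>M)" for i
  have w0: "0 \<le> w t" if "t \<in> space M" for t using bound[OF that] order_trans[OF norm_ge_zero] by blast
  have fw: "norm (f t) \<le> w t" if "t \<in> space M" for t
    by (rule Lim_bounded[OF tendsto_norm[OF lim[OF that]]]) (use bound[OF that] in auto)
  have "(\<lambda>i. a i) \<longlonglongrightarrow> (\<integral>\<^sup>+t. 0 \<partial>M)"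
    unfolding a_def
  proof (rule nn_integral_dominated_convergence[where w = "\<lambda>t. ennreal (2 * w t)"])
    show "(\<lambda>t. ennreal (norm (f t - s i t))) \<in> borel_measurable M" for i
      using measurable_norm_diff_simple[OF f s] by simp
    show "(\<lambda>t. ennreal (2 * w t)) \<in> borel_measurable M" using w by simp
    show "AE t in M. ennreal (norm (f t - s i t)) \<le> ennreal (2 * w t)" for i
    proof (rule AE_I2)
      fix t assume t: "t \<in> space M"
      have "norm (f t - s i t) \<le> 2 * w t"
        using norm_triangle_ineq4[of "f t" "s i t"] fw[OF t] bound[OF t, of i] by linarith
      then show "ennreal (norm (f t - s i t)) \<le> ennreal (2 * w t)" by (rule ennreal_leI)
    qed
    have "(\<integral>\<^sup>+t. ennreal (2 * w t) \<partial>M) = ennreal (\<integral>t. 2 * w t \<partial>M)"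
      using w w0 by (intro nn_integral_eq_integral) auto
    then show "(\<integral>\<^sup>+t. ennreal (2 * w t) \<partial>M) < \<infinity>" by simp
    show "AE t in M. (\<lambda>i. ennreal (norm (f t - s i t))) \<longlonglongrightarrow> 0"
    proof (rule AE_I2)
      fix t assume "t \<in> space M"
      from tendsto_norm[OF tendsto_diff[OF tendsto_const lim[OF this]], of "f t"]
      show "(\<lambda>i. ennreal (norm (f t - s i t))) \<longlonglongrightarrow> 0"
        by (simp flip: ennreal_0)
    qed
  qed simp
  then have a: "a \<longlonglongrightarrow> 0" by simp
  have diff: "ennreal (norm (Bochner_Integration.simple_bochner_integral M (s i) - Bochner_Integration.simple_bochner_integral M (s j))) \<le> a i + a j" for i j
  proof -
    have *: "Bochner_Integration.simple_bochner_integrable M (\<lambda>t. s i t - s j t)"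
      by (rule simple_bochner_integrable_compose2[of "\<lambda>x y. x - y"]) (simp_all add: sb)
    have **: "Bochner_Integration.simple_bochner_integrable M (\<lambda>t. norm (s i t - s j t))"
      by (rule simple_bochner_integrable_compose2[of "\<lambda>x y. norm (x - y)"]) (simp_all add: sb)
    have "norm (Bochner_Integration.simple_bochner_integral M (s i) - Bochner_Integration.simple_bochner_integral M (s j))
        \<le> Bochner_Integration.simple_bochner_integral M (\<lambda>t. norm (s i t - s j t))"
      unfolding simple_bochner_integral_diff[OF sb sb, symmetric] by (rule simple_bochner_integral_norm_bound[OF *])
    then have "ennreal (norm (Bochner_Integration.simple_bochner_integral M (s i) - Bochner_Integration.simple_bochner_integral M (s j)))
        \<le> (\<integral>\<^sup>+t. ennreal (norm (s i t - s j t)) \<partial>M)"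
      unfolding simple_bochner_integral_eq_nn_integral[OF ** norm_ge_zero, symmetric] by (rule ennreal_leI)
    also have "\<dots> \<le> (\<integral>\<^sup>+t. ennreal (norm (f t - s i t)) + ennreal (norm (f t - s j t)) \<partial>M)"
    proof (rule nn_integral_mono)
      fix t
      have "norm (s i t - s j t) \<le> norm (f t - s i t) + norm (f t - s j t)"
        using norm_triangle_ineq4[of "f t - s j t" "f t - s i t"] by (simp add: add.commute)
      then show "ennreal (norm (s i t - s j t)) \<le> ennreal (norm (f t - s i t)) + ennreal (norm (f t - s j t))"
        unfolding ennreal_plus[OF norm_ge_zero norm_ge_zero, symmetric] by (rule ennreal_leI)
    qed
    also have "\<dots> = a i + a j"
      unfolding a_def using measurable_norm_diff_simple[OF f s] by (intro nn_integral_add) simp_all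
    finally show ?thesis .
  qed
  have "Cauchy (\<lambda>i. Bochner_Integration.simple_bochner_integral M (s i))"
  proof (rule metric_CauchyI)
    fix e :: real assume e: "0 < e"
    then have "\<forall>\<^sub>F i in sequentially. a i < ennreal (e / 2)"
      by (intro order_tendstoD(2)[OF a]) simp
    then obtain N where N: "\<And>i. N \<le> i \<Longrightarrow> a i < ennreal (e / 2)" unfolding eventually_sequentially by blast
    have "dist (Bochner_Integration.simple_bochner_integral M (s i)) (Bochner_Integration.simple_bochner_integral M (s j)) < e"
      if "N \<le> i" "N \<le> j" for i j
    proof -
      have "a i + a j < ennreal (e / 2) + ennreal (e / 2)" by (intro add_strict_mono N that)
      also have "\<dots> = ennreal e" using e by (simp flip: ennreal_plus)
      finally have "ennreal (norm (Bochner_Integration.simple_bochner_integral M (s i) - Bochner_Integration.simple_bochner_integral M (s j))) < ennreal e"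
        using diff[of i j] by (rule le_less_trans[rotated])
      then show ?thesis using e by (simp add: dist_norm ennreal_less_iff)
    qed
    then show "\<exists>N. \<forall>i\<ge>N. \<forall>j\<ge>N. dist (Bochner_Integration.simple_bochner_integral M (s i)) (Bochner_Integration.simple_bochner_integral M (s j)) < e"
      by blast
  qed
  then obtain X where "(\<lambda>i. Bochner_Integration.simple_bochner_integral M (s i)) \<longlonglongrightarrow> X"
    using Cauchy_convergent_iff convergent_def by blast
  then have "has_op_integral M f X"
    unfolding has_op_integral_def using f sb a unfolding a_def by blast
  then show ?thesis by blast
qed

section \<open>The joint functional calculus\<close>

lemma tendsto_fun_componentwise:
  fixes f :: "'b \<Rightarrow> 'i \<Rightarrow> 'c::topological_space"
  assumes "\<And>i. ((\<lambda>k. f k i) \<longlongrightarrow> l i) F"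
  shows "(f \<longlongrightarrow> l) F"
proof -
  have "limitin (product_topology (\<lambda>_. euclidean) UNIV) f l F"
    unfolding limitin_componentwise using assms by simp
  then show ?thesis unfolding euclidean_product_topology limitin_canonical_iff .
qed

text \<open>The midpoint of the dyadic cell of length \<open>2^-k\<close> containing
  \<open>t\<close>. Midpoints stay strictly inside the unit interval, and their distance to its ends
  is at least half that of \<open>t\<close>, so singular bounds survive sampling up to a
  constant.\<close>

definition dyadic :: "nat \<Rightarrow> real \<Rightarrow> real"
  where "dyadic k t = (of_int \<lfloor>2 ^ k * t\<rfloor> + 1/2) / 2 ^ k"

lemma dyadic_measurable [measurable]: "dyadic k \<in> borel_measurable borel"
  unfolding dyadic_def by measurable

lemma dyadic_tendsto: "(\<lambda>k. dyadic k t) \<longlonglongrightarrow> t"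
proof -
  have lim: "(\<lambda>k. inverse (2::real) ^ k) \<longlonglongrightarrow> 0" by (intro LIMSEQ_power_zero) simp
  have le: "norm (dyadic k t - t) \<le> inverse 2 ^ k" for k
  proof -
    have "\<bar>of_int \<lfloor>2 ^ k * t\<rfloor> + 1/2 - 2 ^ k * t\<bar> \<le> 1" by linarith
    moreover have "dyadic k t - t = (of_int \<lfloor>2 ^ k * t\<rfloor> + 1/2 - 2 ^ k * t) / 2 ^ k"
      by (simp add: dyadic_def field_simps)
    ultimately have "norm (dyadic k t - t) \<le> 1 / 2 ^ k" by (simp add: abs_divide divide_right_mono)
    then show ?thesis by (simp add: inverse_eq_divide power_one_over)
  qed
  have "(\<lambda>k. dyadic k t - t) \<longlonglongrightarrow> 0"
    by (rule Lim_null_comparison[OF always_eventually[OF allI[OF le]] lim])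
  then show ?thesis by (rule LIM_zero_cancel)
qed

lemma dyadic_bounds:
  assumes t: "t \<in> {0<..<1}"
  shows "dyadic k t \<in> {0<..<1}" "min t (1 - t) / 2 \<le> min (dyadic k t) (1 - dyadic k t)"
    "dyadic k t \<in> (\<lambda>j. (of_int j + 1/2) / 2 ^ k) ` {0..<2 ^ k}"
proof -
  define N :: real where "N = 2 ^ k"
  define n where "n = \<lfloor>N * t\<rfloor>"
  have N: "0 < N" by (simp add: N_def)
  have Nt: "0 < N * t" "N * t < N" using t N by (auto simp: mult_less_cancel_left2)
  have n0: "0 \<le> n" unfolding n_def using Nt by simp
  have n1: "n < 2 ^ k"
    unfolding n_def floor_less_iff using Nt by (simp add: N_def)
  then have n1': "of_int n \<le> N - 1"
  proof -
    have "n \<le> 2 ^ k - 1" using n1 by simp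
    then have "real_of_int n \<le> real_of_int (2 ^ k - 1)" by (rule of_int_le_iff[THEN iffD2])
    then show ?thesis by (simp add: N_def)
  qed
  have fl: "of_int n \<le> N * t" "N * t < of_int n + 1" unfolding n_def by linarith+
  have d: "dyadic k t = (of_int n + 1/2) / N" by (simp add: dyadic_def n_def N_def)
  then show "dyadic k t \<in> (\<lambda>j. (of_int j + 1/2) / 2 ^ k) ` {0..<2 ^ k}"
    using n0 n1 by (auto simp: N_def)
  have n0': "0 \<le> real_of_int n" using n0 by simp
  show "dyadic k t \<in> {0<..<1}" using N n0' n1' by (simp add: d field_simps)
  have 1: "t / 2 \<le> dyadic k t" using N fl n0' by (simp add: d field_simps)
  have 2: "(1 - t) / 2 \<le> 1 - dyadic k t" using N fl n1' by (simp add: d field_simps)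
  have "min t (1 - t) / 2 \<le> t / 2" "min t (1 - t) / 2 \<le> (1 - t) / 2"
    by (simp_all only: divide_right_mono min.cobounded1 min.cobounded2 zero_le_numeral)
  with 1 2 show "min t (1 - t) / 2 \<le> min (dyadic k t) (1 - dyadic k t)"
    by (meson min.boundedI order_trans)
qed

text \<open>Arbitrary index lists allow a single resolvent to be removed from the product.\<close>

fun resolvent_list :: "nat list \<Rightarrow> (nat \<Rightarrow> complex) \<Rightarrow> (nat \<Rightarrow> 'a::complex_hilbert_space \<Rightarrow>\<^sub>L 'a) \<Rightarrow> 'a \<Rightarrow>\<^sub>L 'a"
  where "resolvent_list [] z T = id_blinfun"
  | "resolvent_list (i # is) z T = resolvent (z i) (T i) o\<^sub>L resolvent_list is z T"

lemma resolvent_prod_list: "resolvent_prod m z T = resolvent_list [1..<Suc m] z T"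
proof -
  have "foldr (\<lambda>i A. resolvent (z i) (T i) o\<^sub>L A) is id_blinfun = resolvent_list is z T" for "is"
    by (induction "is") auto
  then show ?thesis by (simp add: resolvent_prod_def)
qed

lemma resolvent_list_cong: "(\<And>i. i \<in> set is \<Longrightarrow> z i = w i) \<Longrightarrow> resolvent_list is z T = resolvent_list is w T"
  by (induction "is") auto

section \<open>Holomorphic functions on products of Stolz domains and the class
  \<open>H0_infty\<close>\<close>

lemma holomorphic_on_stolz_prodD:
  assumes "holomorphic_on_stolz_prod \<phi> m \<gamma>"
  shows "continuous_on (stolz_prod m \<gamma>) \<phi>"
    "z \<in> stolz_prod m \<gamma> \<Longrightarrow> i \<in> {1..m} \<Longrightarrow> (\<lambda>w. \<phi> (z(i := w))) holomorphic_on stolz (\<gamma> i)"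
  using assms unfolding holomorphic_on_stolz_prod_def by auto

lemma holomorphic_on_stolz_prod_mult:
  "holomorphic_on_stolz_prod \<phi> m \<gamma> \<Longrightarrow> holomorphic_on_stolz_prod \<psi> m \<gamma> \<Longrightarrow>
    holomorphic_on_stolz_prod (\<lambda>z. \<phi> z * \<psi> z) m \<gamma>"
  unfolding holomorphic_on_stolz_prod_def
  by (auto intro: continuous_on_mult holomorphic_on_mult)

lemma holomorphic_on_stolz_prod_coordinate:
  assumes g: "g holomorphic_on stolz (\<gamma> i)" and i: "i \<in> {1..m}"
  shows "holomorphic_on_stolz_prod (\<lambda>z. g (z i)) m \<gamma>"
  unfolding holomorphic_on_stolz_prod_def
proof (intro conjI ballI)
  have "continuous_on (stolz_prod m \<gamma>) (\<lambda>z. z i)"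
    by (rule continuous_on_product_then_coordinatewise[OF continuous_on_id])
  moreover have "(\<lambda>z. z i) ` stolz_prod m \<gamma> \<subseteq> stolz (\<gamma> i)" using i by (auto simp: stolz_prod_def)
  ultimately show "continuous_on (stolz_prod m \<gamma>) (\<lambda>z. g (z i))"
    using continuous_on_compose2[OF holomorphic_on_imp_continuous_on[OF g]] by blast
  show "(\<lambda>w. g ((z(j := w)) i)) holomorphic_on stolz (\<gamma> j)" if "j \<in> {1..m}" for z j
    using g by (cases "i = j") auto
qed

lemma holomorphic_on_stolz_prod_const: "holomorphic_on_stolz_prod (\<lambda>_. c) m \<gamma>"
  unfolding holomorphic_on_stolz_prod_def by auto

lemma holomorphic_on_stolz_prod_prod:
  assumes "\<And>i. i \<in> I \<Longrightarrow> holomorphic_on_stolz_prod (\<phi> i) m \<gamma>"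
  shows "holomorphic_on_stolz_prod (\<lambda>z. \<Prod>i\<in>I. \<phi> i z) m \<gamma>"
  using assms
proof (induction I rule: infinite_finite_induct)
  case (insert i I)
  then show ?case using holomorphic_on_stolz_prod_mult[of "\<phi> i" m \<gamma> "\<lambda>z. \<Prod>i\<in>I. \<phi> i z"] by simp
qed (simp_all add: holomorphic_on_stolz_prod_const)

lemma H0_infty_mult:
  assumes \<phi>: "\<phi> \<in> H0_infty m \<gamma>" and \<psi>: "holomorphic_on_stolz_prod \<psi> m \<gamma>"
    and B: "\<And>z. z \<in> stolz_prod m \<gamma> \<Longrightarrow> cmod (\<psi> z) \<le> B"
  shows "(\<lambda>z. \<phi> z * \<psi> z) \<in> H0_infty m \<gamma>"
proof -
  have hol: "holomorphic_on_stolz_prod \<phi> m \<gamma>" and bd: "bounded (\<phi> ` stolz_prod m \<gamma>)"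
    using \<phi> unfolding H0_infty_def by auto
  obtain c s where cs: "0 < c" "0 < s"
    "\<And>z. z \<in> stolz_prod m \<gamma> \<Longrightarrow> cmod (\<phi> z) \<le> c * (\<Prod>i=1..m. cmod (1 - z i) powr s)"
    using \<phi> unfolding H0_infty_def by auto
  obtain b where b: "\<And>z. z \<in> stolz_prod m \<gamma> \<Longrightarrow> cmod (\<phi> z) \<le> b"
    using bd unfolding bounded_iff by auto
  \<comment> \<open>\<open>H0_infty\<close> asks for a positive constant, while \<open>B\<close> may
    vanish.\<close>
  define B' where "B' = \<bar>B\<bar> + 1"
  have B': "0 < B'" "z \<in> stolz_prod m \<gamma> \<Longrightarrow> cmod (\<psi> z) \<le> B'" for z
    unfolding B'_def using B[of z] by linarith+
  have "bounded ((\<lambda>z. \<phi> z * \<psi> z) ` stolz_prod m \<gamma>)"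
    unfolding bounded_iff
  proof (intro exI ballI)
    fix v assume "v \<in> (\<lambda>z. \<phi> z * \<psi> z) ` stolz_prod m \<gamma>"
    then obtain z where z: "z \<in> stolz_prod m \<gamma>" "v = \<phi> z * \<psi> z" by blast
    have "cmod (\<phi> z) * cmod (\<psi> z) \<le> b * B'"
      using b[OF z(1)] B'(2)[OF z(1)] order_trans[OF norm_ge_zero b[OF z(1)]] by (intro mult_mono) auto
    then show "norm v \<le> b * B'" by (simp add: z(2) norm_mult)
  qed
  moreover have "cmod (\<phi> z * \<psi> z) \<le> (c * B') * (\<Prod>i=1..m. cmod (1 - z i) powr s)"
    if z: "z \<in> stolz_prod m \<gamma>" for z
  proof -
    have "cmod (\<phi> z) * cmod (\<psi> z) \<le> (c * (\<Prod>i=1..m. cmod (1 - z i) powr s)) * B'"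
      using cs B' z by (intro mult_mono) (auto intro!: mult_nonneg_nonneg prod_nonneg)
    then show ?thesis by (simp add: norm_mult mult_ac)
  qed
  moreover have "0 < c * B'" using cs B' by simp
  ultimately show ?thesis
    unfolding H0_infty_def using cs(2) holomorphic_on_stolz_prod_mult[OF hol \<psi>] by blast
qed

text \<open>Since \<open>cmod (1 - z) < 2\<close> on the domain, an excess exponent is absorbed into
  the constant. With \<open>s <= 1\<close> the remaining exponent \<open>s - 1\<close> is
  nonpositive, so lower bounds for \<open>cmod (1 - z)\<close> give upper bounds.\<close>

lemma H0_infty_small_exponent:
  assumes \<phi>: "\<phi> \<in> H0_infty m \<gamma>" and \<gamma>: "\<And>i. i \<in> {1..m} \<Longrightarrow> \<gamma> i \<in> {0<..<pi/2}"
  obtains c s where "0 < c" "0 < s" "s \<le> 1"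
    "\<And>z. z \<in> stolz_prod m \<gamma> \<Longrightarrow> cmod (\<phi> z) \<le> c * (\<Prod>i=1..m. cmod (1 - z i) powr s)"
proof -
  obtain c s where cs: "0 < c" "0 < s"
    "\<And>z. z \<in> stolz_prod m \<gamma> \<Longrightarrow> cmod (\<phi> z) \<le> c * (\<Prod>i=1..m. cmod (1 - z i) powr s)"
    using \<phi> unfolding H0_infty_def by auto
  define s' where "s' = min s 1"
  have s': "0 < s'" "s' \<le> 1" "s' \<le> s" using cs by (auto simp: s'_def)
  show thesis
  proof (rule that[of "c * (\<Prod>i=1..m. 2 powr (s - s'))" s'])
    fix z assume z: "z \<in> stolz_prod m \<gamma>"
    have "(\<Prod>i=1..m. cmod (1 - z i) powr s) \<le> (\<Prod>i=1..m. 2 powr (s - s') * cmod (1 - z i) powr s')"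
    proof (intro prod_mono conjI)
      fix i assume i: "i \<in> {1..m}"
      have "cmod (z i) < 1"
        using PiE_mem[OF z[unfolded stolz_prod_def] i] by (rule cmod_less_one_stolz[OF _ \<gamma>[OF i]])
      then have le: "cmod (1 - z i) \<le> 2" using norm_triangle_ineq4[of 1 "z i"] by simp
      have "cmod (1 - z i) powr s = cmod (1 - z i) powr (s - s') * cmod (1 - z i) powr s'"
        by (simp add: powr_add[symmetric])
      also have "\<dots> \<le> 2 powr (s - s') * cmod (1 - z i) powr s'"
        using s' le by (intro mult_right_mono powr_mono2) auto
      finally show "cmod (1 - z i) powr s \<le> 2 powr (s - s') * cmod (1 - z i) powr s'" .
    qed auto
    then have "c * (\<Prod>i=1..m. cmod (1 - z i) powr s) \<le> c * (\<Prod>i=1..m. 2 powr (s - s') * cmod (1 - z i) powr s')"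
      using cs by (intro mult_left_mono) auto
    then show "cmod (\<phi> z) \<le> c * (\<Prod>i=1..m. 2 powr (s - s')) * (\<Prod>i=1..m. cmod (1 - z i) powr s')"
      unfolding prod.distrib mult.assoc using cs(3)[OF z] by (rule order_trans[rotated])
  qed (use cs s' in auto)
qed

text \<open>The resolvent estimates, with constants \<open>C\<close>, hold outside the domains of
  angle \<alpha>; the contours have angle \<beta>; the functions live on angle \<gamma>.\<close>

locale stolz_calculus =
  fixes m :: nat and T :: "nat \<Rightarrow> 'a::complex_hilbert_space \<Rightarrow>\<^sub>L 'a" and \<alpha> \<beta> \<gamma> C :: "nat \<Rightarrow> real"
  assumes rb: "i \<in> {1..m} \<Longrightarrow> resolvent_bound (\<alpha> i) (C i) (T i)"
    and angles: "i \<in> {1..m} \<Longrightarrow> \<alpha> i < \<beta> i \<and> \<beta> i < \<gamma> i \<and> \<gamma> i < pi/2"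
    and comm: "i \<in> {1..m} \<Longrightarrow> j \<in> {1..m} \<Longrightarrow> op_commute (T i) (T j)"
begin

definition curve :: "(nat \<Rightarrow> real) \<Rightarrow> nat \<Rightarrow> complex"
  where "curve t = (\<lambda>i\<in>{1..m}. stolz_boundary (\<beta> i) (t i))"

definition velocity :: "(nat \<Rightarrow> real) \<Rightarrow> complex"
  where "velocity t = (\<Prod>i=1..m. stolz_velocity (\<beta> i) (t i))"

abbreviation cube :: "(nat \<Rightarrow> real) measure"
  where "cube \<equiv> \<Pi>\<^sub>M i\<in>{1..m}. unit_measure"

text \<open>The pairing \<open><\<phi>(T) x, y>\<close> without the power of
  \<open>1/(2 \<pi> i)\<close>. That factor has modulus at most one, so bounds for
  \<open>form\<close> suffice.\<close>

definition form :: "((nat \<Rightarrow> complex) \<Rightarrow> complex) \<Rightarrow> 'a \<Rightarrow> 'a \<Rightarrow> complex"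
  where "form \<phi> x y = (\<integral>t. \<phi> (curve t) * velocity t * cinner (resolvent_prod m (curve t) T x) y \<partial>cube)"

lemma T_bounded_ops: "i \<in> {1..m} \<Longrightarrow> T i \<in> bounded_ops"
  using resolvent_bound_basic[OF rb] by blast

lemma \<alpha>_pos: "i \<in> {1..m} \<Longrightarrow> 0 < \<alpha> i" and C_nonneg: "i \<in> {1..m} \<Longrightarrow> 0 \<le> C i"
  using resolvent_bound_basic[OF rb] by auto

lemma \<beta>_angle: "i \<in> {1..m} \<Longrightarrow> \<beta> i \<in> {0<..<pi/2}" and \<gamma>_angle: "i \<in> {1..m} \<Longrightarrow> \<gamma> i \<in> {0<..<pi/2}"
  and \<beta>_lt_\<gamma>: "i \<in> {1..m} \<Longrightarrow> \<beta> i \<in> {0<..<\<gamma> i}"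
  using \<alpha>_pos[of i] angles[of i] by auto

lemma T_commute: "i \<in> {1..m} \<Longrightarrow> j \<in> {1..m} \<Longrightarrow> T i (T j x) = T j (T i x)"
  using comm unfolding op_commute_def by (metis blinfun_apply_blinfun_compose)

lemma space_cube: "t \<in> space cube \<longleftrightarrow> t \<in> (\<Pi>\<^sub>E i\<in>{1..m}. {0<..<1})"
  by (simp add: space_PiM)

lemma space_cubeD: "t \<in> space cube \<Longrightarrow> i \<in> {1..m} \<Longrightarrow> t i \<in> {0<..<1}"
  unfolding space_cube by (rule PiE_mem)

lemma curve_eq: "i \<in> {1..m} \<Longrightarrow> curve t i = stolz_boundary (\<beta> i) (t i)"
  by (simp add: curve_def)

lemma curve_in_stolz_prod: "t \<in> space cube \<Longrightarrow> curve t \<in> stolz_prod m \<gamma>"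
  unfolding stolz_prod_def curve_def
  using stolz_boundary_in_stolz[OF \<beta>_lt_\<gamma>] angles space_cubeD by (intro restrict_PiE_iff[THEN iffD2]) blast

lemma curve_notin_closure: "t \<in> space cube \<Longrightarrow> i \<in> {1..m} \<Longrightarrow> curve t i \<notin> closure (stolz (\<alpha> i))"
  unfolding curve_eq using stolz_boundary_notin_closure[OF \<alpha>_pos] angles[of i] \<beta>_angle[of i] space_cubeD[of t i] by auto

lemma finite_measure_cube: "finite_measure cube"
proof (rule finite_measureI)
  have "emeasure cube (space cube) = (\<Prod>i\<in>{1..m}. emeasure unit_measure {0<..<1})"
    using unit_product.emeasure_PiM[of "{1..m}" "\<lambda>_. {0<..<1}"]
    by (simp add: space_PiM sets_restrict_space_iff)
  then show "emeasure cube (space cube) \<noteq> \<infinity>"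
    by (simp add: emeasure_restrict_space)
qed

lemma T_resolvent_list:
  assumes "set is \<subseteq> {1..m}" "i \<in> {1..m}" "\<And>j. j \<in> set is \<Longrightarrow> z j \<notin> closure (stolz (\<alpha> j))"
  shows "resolvent_list is z T (T i x) = T i (resolvent_list is z T x)"
  using assms
proof (induction "is")
  case (Cons j "is")
  then have "resolvent (z j) (T j) (T i (resolvent_list is z T x)) = T i (resolvent (z j) (T j) (resolvent_list is z T x))"
    by (intro resolvent_commute[OF rb] T_bounded_ops T_commute) auto
  then show ?case using Cons by simp
qed simp

text \<open>The factor with index \<open>i\<close> absorbs the operator through
  \<open>R(z) T = z R(z) - I\<close>; the identity term leaves the product with that factor
  deleted.\<close>

lemma resolvent_list_T:
  assumes "distinct is" "set is \<subseteq> {1..m}" "i \<in> set is" "\<And>j. j \<in> set is \<Longrightarrow> z j \<notin> closure (stolz (\<alpha> j))"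
  shows "resolvent_list is z T (T i x) = z i *\<^sub>C resolvent_list is z T x - resolvent_list (remove1 i is) z T x"
  using assms
proof (induction "is")
  case (Cons j "is")
  have z: "z j \<notin> closure (stolz (\<alpha> j))" and j: "j \<in> {1..m}" using Cons.prems by auto
  show ?case
  proof (cases "i = j")
    case True
    have "resolvent_list is z T (T i x) = T i (resolvent_list is z T x)"
      using Cons.prems by (intro T_resolvent_list) auto
    then show ?thesis using resolvent_T[OF rb[OF j] z] True by simp
  next
    case False
    then have "resolvent_list is z T (T i x) = z i *\<^sub>C resolvent_list is z T x - resolvent_list (remove1 i is) z T x"
      using Cons.prems by (intro Cons.IH) auto
    then show ?thesis
      using False by (simp add: blinfun.diff_right bounded_ops_scaleC[OF resolvent_in_bounded_ops[OF rb[OF j] z]])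
  qed
qed simp

lemma norm_resolvent_list_le:
  assumes "distinct is" "set is \<subseteq> {1..m}" "\<And>j. j \<in> set is \<Longrightarrow> z j \<notin> closure (stolz (\<alpha> j))"
  shows "norm (resolvent_list is z T) \<le> (\<Prod>i\<in>set is. C i / cmod (1 - z i))"
  using assms
proof (induction "is")
  case Nil
  then show ?case by (simp add: norm_blinfun_id_le)
next
  case (Cons j "is")
  have "norm (resolvent_list (j # is) z T) \<le> (C j / cmod (1 - z j)) * (\<Prod>i\<in>set is. C i / cmod (1 - z i))"
    unfolding resolvent_list.simps
    using Cons by (intro norm_blinfun_compose_le norm_resolvent_le[OF rb]) auto
  then show ?case using Cons.prems by simp
qed

lemma norm_resolvent_prod_le:
  assumes "\<And>j. j \<in> {1..m} \<Longrightarrow> z j \<notin> closure (stolz (\<alpha> j))"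
  shows "norm (resolvent_prod m z T) \<le> (\<Prod>i=1..m. C i / cmod (1 - z i))"
proof -
  have "set [1..<Suc m] = {1..m}" by auto
  then show ?thesis
    using norm_resolvent_list_le[of "[1..<Suc m]" z] assms unfolding resolvent_prod_list by simp
qed

lemma tendsto_resolvent_list:
  assumes "set is \<subseteq> {1..m}" "\<And>j. j \<in> set is \<Longrightarrow> w j \<notin> closure (stolz (\<alpha> j))"
    and "\<And>j k. j \<in> set is \<Longrightarrow> z k j \<notin> closure (stolz (\<alpha> j))" and "\<And>j. j \<in> set is \<Longrightarrow> (\<lambda>k. z k j) \<longlonglongrightarrow> w j"
  shows "(\<lambda>k. resolvent_list is (z k) T) \<longlonglongrightarrow> resolvent_list is w T"
  using assms
proof (induction "is")
  case (Cons j "is")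
  have "(\<lambda>k. resolvent (z k j) (T j)) \<longlonglongrightarrow> resolvent (w j) (T j)"
    by (rule continuous_on_tendsto_compose[OF continuous_on_resolvent[OF rb]]) (use Cons.prems in auto)
  moreover have "(\<lambda>k. resolvent_list is (z k) T) \<longlonglongrightarrow> resolvent_list is w T"
    using Cons by auto
  ultimately show ?case
    unfolding resolvent_list.simps by (rule bounded_bilinear.tendsto[OF bounded_bilinear_blinfun_compose])
qed simp

lemma velocity_measurable: "velocity \<in> borel_measurable cube"
  unfolding velocity_def
  by (intro borel_measurable_prod measurable_PiM_component_rev measurable_stolz_velocity)

lemma velocity_bounded: "\<exists>V. 0 \<le> V \<and> (\<forall>t. cmod (velocity t) \<le> V)"
proof -
  have "\<exists>L. \<forall>i\<in>{1..m}. \<forall>t. cmod (stolz_velocity (\<beta> i) t) \<le> L i"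
    using stolz_velocity_bounded[OF \<beta>_angle] by (intro bchoice ballI) blast
  then obtain L where L: "\<And>i t. i \<in> {1..m} \<Longrightarrow> cmod (stolz_velocity (\<beta> i) t) \<le> L i" by blast
  have "cmod (velocity t) \<le> (\<Prod>i=1..m. L i)" for t
    unfolding velocity_def prod_norm[symmetric] by (intro prod_mono) (auto intro: L)
  moreover have "0 \<le> (\<Prod>i=1..m. L i)"
    by (intro prod_nonneg) (use L order_trans[OF norm_ge_zero] in blast)
  ultimately show ?thesis by blast
qed

text \<open>Coordinatewise, \<open>cmod (1 - z) powr s\<close> against
  \<open>C / cmod (1 - z)\<close> leaves a nonpositive power, which is largest where the curve is
  nearest to the vertex.\<close>

lemma integrand_bound:
  assumes cs: "0 \<le> c" "0 < s" "s \<le> 1"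
    and \<phi>: "\<And>z. z \<in> stolz_prod m \<gamma> \<Longrightarrow> cmod (\<phi> z) \<le> c * (\<Prod>i=1..m. cmod (1 - z i) powr s)"
    and t: "t \<in> space cube"
  shows "cmod (\<phi> (curve t)) * norm (resolvent_prod m (curve t) T)
    \<le> c * (\<Prod>i=1..m. C i * ((1 - sin (\<beta> i)) powr (s - 1) * min (t i) (1 - t i) powr (s - 1)))"
proof -
  have "cmod (\<phi> (curve t)) * norm (resolvent_prod m (curve t) T)
      \<le> (c * (\<Prod>i=1..m. cmod (1 - curve t i) powr s)) * (\<Prod>i=1..m. C i / cmod (1 - curve t i))"
    by (intro mult_mono \<phi> curve_in_stolz_prod[OF t] norm_resolvent_prod_le curve_notin_closure[OF t])
      (use cs in \<open>auto intro!: mult_nonneg_nonneg prod_nonneg\<close>)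
  also have "\<dots> = c * (\<Prod>i=1..m. cmod (1 - curve t i) powr s * (C i / cmod (1 - curve t i)))"
    by (simp only: prod.distrib mult.assoc)
  also have "\<dots> \<le> c * (\<Prod>i=1..m. C i * ((1 - sin (\<beta> i)) powr (s - 1) * min (t i) (1 - t i) powr (s - 1)))"
  proof (intro mult_left_mono prod_mono conjI cs(1))
    fix i assume i: "i \<in> {1..m}"
    have ti: "t i \<in> {0<..<1}" by (rule space_cubeD[OF t i])
    have c: "0 < 1 - sin (\<beta> i)" using sin_angle[OF \<beta>_angle[OF i]] by simp
    let ?d = "cmod (1 - curve t i)"
    have d: "(1 - sin (\<beta> i)) * min (t i) (1 - t i) \<le> ?d"
      unfolding curve_eq[OF i] using ti by (intro cmod_one_minus_stolz_boundary_ge \<beta>_angle i) auto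
    have p: "0 < (1 - sin (\<beta> i)) * min (t i) (1 - t i)" using c ti by (intro mult_pos_pos) auto
    have d0: "0 < ?d" using p d by linarith
    show "0 \<le> ?d powr s * (C i / ?d)" using C_nonneg[OF i] by simp
    have "?d powr s * (C i / ?d) = C i * ?d powr (s - 1)"
      using d0 by (simp add: powr_diff)
    also have "\<dots> \<le> C i * ((1 - sin (\<beta> i)) * min (t i) (1 - t i)) powr (s - 1)"
      using cs d p by (intro mult_left_mono C_nonneg[OF i] powr_mono2') auto
    also have "\<dots> = C i * ((1 - sin (\<beta> i)) powr (s - 1) * min (t i) (1 - t i) powr (s - 1))"
      using c ti by (subst powr_mult) auto
    finally show "?d powr s * (C i / ?d) \<le> C i * ((1 - sin (\<beta> i)) powr (s - 1) * min (t i) (1 - t i) powr (s - 1))" .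
  qed
  finally show ?thesis .
qed

definition grid :: "nat \<Rightarrow> (nat \<Rightarrow> real) \<Rightarrow> nat \<Rightarrow> real"
  where "grid k t = (\<lambda>i\<in>{1..m}. dyadic k (t i))"

lemma grid_in_space: "t \<in> space cube \<Longrightarrow> grid k t \<in> space cube"
  unfolding space_cube grid_def using dyadic_bounds(1) by (auto simp: PiE_iff)

lemma simple_function_grid: "simple_function cube (grid k)"
  unfolding simple_function_def
proof (intro conjI ballI)
  have "grid k ` space cube \<subseteq> (\<Pi>\<^sub>E i\<in>{1..m}. (\<lambda>j. (of_int j + 1/2) / 2 ^ k) ` {0..<2 ^ k})"
    unfolding grid_def using dyadic_bounds(3) space_cubeD by (intro image_subsetI restrict_PiE_iff[THEN iffD2]) blast
  then show "finite (grid k ` space cube)"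
    by (rule finite_subset) (intro finite_PiE finite_imageI; simp)
  fix p assume "p \<in> grid k ` space cube"
  then have p: "p \<in> extensional {1..m}" by (auto simp: grid_def)
  have "grid k -` {p} \<inter> space cube = {t \<in> space cube. \<forall>i\<in>{1..m}. dyadic k (t i) = p i}"
    using p by (auto simp: grid_def extensional_def fun_eq_iff)
  also have "\<dots> \<in> sets cube"
  proof (intro sets.sets_Collect_finite_All)
    fix i assume i: "i \<in> {1..m}"
    have "(\<lambda>t. dyadic k (t i)) \<in> borel_measurable cube"
      by (intro measurable_PiM_component_rev i measurable_unit_borel dyadic_measurable)
    then show "{t \<in> space cube. dyadic k (t i) = p i} \<in> sets cube"
      by (intro borel_measurable_eq) auto
  qed auto
  finally show "grid k -` {p} \<inter> space cube \<in> sets cube" .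
qed

text \<open>The function and the resolvents are sampled on dyadic grids, which gives finitely many
  values and converges by continuity. The velocity is discontinuous at the corners, so general
  simple approximants are taken for it.\<close>

lemma has_op_integral_calculus:
  assumes \<phi>: "\<phi> \<in> H0_infty m \<gamma>"
  shows "\<exists>X. has_op_integral cube (\<lambda>t. scale_op (\<phi> (curve t) * velocity t) (resolvent_prod m (curve t) T)) X"
proof -
  obtain c s where cs: "0 < c" "0 < s" "s \<le> 1"
    and decay: "\<And>z. z \<in> stolz_prod m \<gamma> \<Longrightarrow> cmod (\<phi> z) \<le> c * (\<Prod>i=1..m. cmod (1 - z i) powr s)"
    using H0_infty_small_exponent[OF \<phi> \<gamma>_angle] by metis
  have cont: "continuous_on (stolz_prod m \<gamma>) \<phi>"
    using \<phi> holomorphic_on_stolz_prodD(1) unfolding H0_infty_def by blast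
  obtain V where V: "0 \<le> V" "\<And>t. cmod (velocity t) \<le> V" using velocity_bounded by blast
  have "\<exists>v. (\<forall>k. simple_function cube (v k)) \<and> (\<forall>t\<in>space cube. (\<lambda>k. v k t) \<longlonglongrightarrow> velocity t) \<and>
      (\<forall>k. \<forall>t\<in>space cube. cmod (v k t) \<le> 2 * cmod (velocity t))"
    using borel_measurable_implies_sequence_metric[OF velocity_measurable, of 0] by (simp only: dist_norm diff_zero)
  then obtain v where v: "\<And>k. simple_function cube (v k)"
    and v_lim: "\<And>t. t \<in> space cube \<Longrightarrow> (\<lambda>k. v k t) \<longlonglongrightarrow> velocity t"
    and v_bd: "\<And>k t. t \<in> space cube \<Longrightarrow> cmod (v k t) \<le> 2 * cmod (velocity t)"
    by blast
  define f where "f k t = scale_op (v k t) (scale_op (\<phi> (curve (grid k t))) (resolvent_prod m (curve (grid k t)) T))" for k t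
  \<comment> \<open>The leading 2 comes from the simple approximants of the velocity, and
    \<open>2 powr (1 - s)\<close> from the halved distance to the ends after dyadic
    sampling.\<close>
  define w where "w t = 2 * V * (c * (\<Prod>i=1..m. C i * ((1 - sin (\<beta> i)) powr (s - 1)
      * (2 powr (1 - s) * min (t i) (1 - t i) powr (s - 1)))))" for t
  show ?thesis
  proof (rule has_op_integral_dominated_limit[OF finite_measure_cube, of f _ w])
    show "simple_function cube (f k)" for k
      unfolding f_def
      by (rule simple_function_compose2[OF v simple_function_compose1[OF simple_function_grid],
            of scale_op _ "\<lambda>p. scale_op (\<phi> (curve p)) (resolvent_prod m (curve p) T)"])
    have lim_grid: "(\<lambda>k. curve (grid k t) i) \<longlonglongrightarrow> curve t i" if t: "t \<in> space cube" for t i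
    proof (cases "i \<in> {1..m}")
      case True
      have "isCont (stolz_boundary (\<beta> i)) (t i)"
        using continuous_on_interior[OF continuous_on_stolz_boundary, of "t i"] space_cubeD[OF t True] by simp
      from isCont_tendsto_compose[OF this dyadic_tendsto]
      show ?thesis using True by (simp add: curve_eq grid_def)
    next
      case False
      then have "curve t i = undefined" for t unfolding curve_def by (rule restrict_apply[THEN trans, OF if_not_P])
      then show ?thesis by simp
    qed
    show "(\<lambda>k. f k t) \<longlonglongrightarrow> scale_op (\<phi> (curve t) * velocity t) (resolvent_prod m (curve t) T)"
      if t: "t \<in> space cube" for t
    proof -
      have "(\<lambda>k. \<phi> (curve (grid k t))) \<longlonglongrightarrow> \<phi> (curve t)"
        by (rule continuous_on_tendsto_compose[OF cont tendsto_fun_componentwise[OF lim_grid[OF t]]])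
          (use curve_in_stolz_prod grid_in_space t in auto)
      moreover have "(\<lambda>k. resolvent_prod m (curve (grid k t)) T) \<longlonglongrightarrow> resolvent_prod m (curve t) T"
        unfolding resolvent_prod_list
      proof (rule tendsto_resolvent_list)
        have set_upt: "set [1..<Suc m] = {1..m}" by auto
        show "curve t j \<notin> closure (stolz (\<alpha> j))" "curve (grid k t) j \<notin> closure (stolz (\<alpha> j))"
          if "j \<in> set [1..<Suc m]" for j k
          using that unfolding set_upt by (intro curve_notin_closure t grid_in_space; assumption)+
      qed (auto intro: lim_grid[OF t])
      ultimately have "(\<lambda>k. f k t) \<longlonglongrightarrow> scale_op (velocity t) (scale_op (\<phi> (curve t)) (resolvent_prod m (curve t) T))"
        unfolding f_def
        by (intro bounded_bilinear.tendsto[OF bounded_bilinear_scale_op] v_lim[OF t])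
      moreover have "scale_op (velocity t) (scale_op (\<phi> (curve t)) (resolvent_prod m (curve t) T))
          = scale_op (\<phi> (curve t) * velocity t) (resolvent_prod m (curve t) T)"
        by (rule blinfun_eqI) (simp add: scaleC_scaleC mult.commute)
      ultimately show ?thesis by simp
    qed
    show "norm (f k t) \<le> w t" if t: "t \<in> space cube" for k t
    proof -
      have g: "grid k t \<in> space cube" by (rule grid_in_space[OF t])
      have "norm (f k t) = cmod (v k t) * (cmod (\<phi> (curve (grid k t))) * norm (resolvent_prod m (curve (grid k t)) T))"
        by (simp add: f_def norm_scale_op)
      also have "\<dots> \<le> (2 * V) * (c * (\<Prod>i=1..m. C i * ((1 - sin (\<beta> i)) powr (s - 1)
          * min (grid k t i) (1 - grid k t i) powr (s - 1))))"
        using v_bd[OF t, of k] V(2)[of t] V(1) cs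
        by (intro mult_mono integrand_bound decay g) (auto intro: order_trans)
      also have "\<dots> \<le> w t"
        unfolding w_def
      proof (intro mult_left_mono prod_mono conjI)
        fix i assume i: "i \<in> {1..m}"
        show "0 \<le> C i * ((1 - sin (\<beta> i)) powr (s - 1) * min (grid k t i) (1 - grid k t i) powr (s - 1))"
          using C_nonneg[OF i] by simp
        have ti: "t i \<in> {0<..<1}" by (rule space_cubeD[OF t i])
        then have p: "0 < min (t i) (1 - t i) / 2" by simp
        have "min (grid k t i) (1 - grid k t i) powr (s - 1) \<le> (min (t i) (1 - t i) / 2) powr (s - 1)"
          using dyadic_bounds(2)[OF ti, of k] p cs i by (intro powr_mono2') (auto simp: grid_def)
        also have "\<dots> = 2 powr (1 - s) * min (t i) (1 - t i) powr (s - 1)"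
          using p by (simp add: powr_divide powr_minus_divide[of 2 "s - 1", simplified] field_simps powr_diff)
        finally show "min (grid k t i) (1 - grid k t i) powr (s - 1) \<le> 2 powr (1 - s) * min (t i) (1 - t i) powr (s - 1)" .
        show "0 \<le> C i" by (rule C_nonneg[OF i])
      qed (use V cs in auto)
      finally show ?thesis .
    qed
    show "integrable cube w"
      unfolding w_def
      by (intro integrable_mult_right unit_product.product_integrable_prod integrable_min_powr cs) auto
  qed
qed

lemma form_properties:
  assumes \<phi>: "\<phi> \<in> H0_infty m \<gamma>"
  shows form_integrable: "integrable cube (\<lambda>t. \<phi> (curve t) * velocity t * cinner (resolvent_prod m (curve t) T x) y)"
    and joint_calculus_form: "cinner (joint_calculus m \<beta> T \<phi> x) y = (1 / (2 * of_real pi * \<i>)) ^ m * form \<phi> x y"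
proof -
  obtain X where X: "has_op_integral cube (\<lambda>t. scale_op (\<phi> (curve t) * velocity t) (resolvent_prod m (curve t) T)) X"
    using has_op_integral_calculus[OF \<phi>] by blast
  have b: "has_bochner_integral cube (\<lambda>t. \<phi> (curve t) * velocity t * cinner (resolvent_prod m (curve t) T x) y) (cinner (X x) y)"
    using has_op_integral_functional[OF X bounded_linear_cinner_apply[of x y]] by (simp add: cinner_scaleC_left)
  then show "integrable cube (\<lambda>t. \<phi> (curve t) * velocity t * cinner (resolvent_prod m (curve t) T x) y)"
    by (rule integrable.intros)
  have "joint_calculus m \<beta> T \<phi> = scale_op ((1 / (2 * of_real pi * \<i>)) ^ m) X"
    unfolding joint_calculus_def Let_def curve_def[symmetric] velocity_def[symmetric]
    by (simp only: op_integral_eq[OF X])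
  then show "cinner (joint_calculus m \<beta> T \<phi> x) y = (1 / (2 * of_real pi * \<i>)) ^ m * form \<phi> x y"
    unfolding form_def using has_bochner_integral_integral_eq[OF b] by (simp add: cinner_scaleC_left)
qed

end

section \<open>Multiplicativity and size of the form\<close>

context stolz_calculus
begin

lemma stolz_prod_cmod_less: "z \<in> stolz_prod m \<gamma> \<Longrightarrow> i \<in> {1..m} \<Longrightarrow> cmod (z i) < 1"
  unfolding stolz_prod_def
  by (rule cmod_less_one_stolz[OF PiE_mem[where T = "\<lambda>i. stolz (\<gamma> i)"] \<gamma>_angle])

lemma H0_infty_times_coordinate:
  assumes \<phi>: "\<phi> \<in> H0_infty m \<gamma>" and i: "i \<in> {1..m}"
  shows "(\<lambda>z. \<phi> z * z i) \<in> H0_infty m \<gamma>" "(\<lambda>z. \<phi> z * z i ^ k) \<in> H0_infty m \<gamma>"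
    "(\<lambda>z. \<phi> z * (1 - z i)) \<in> H0_infty m \<gamma>"
proof -
  have le1: "cmod (z i) \<le> 1" if "z \<in> stolz_prod m \<gamma>" for z
    using stolz_prod_cmod_less[OF that i] by simp
  have hol: "holomorphic_on_stolz_prod (\<lambda>z. z i) m \<gamma>" "holomorphic_on_stolz_prod (\<lambda>z. z i ^ k) m \<gamma>"
    "holomorphic_on_stolz_prod (\<lambda>z. 1 - z i) m \<gamma>"
    by (rule holomorphic_on_stolz_prod_coordinate[OF _ i], intro holomorphic_intros)+
  show "(\<lambda>z. \<phi> z * z i) \<in> H0_infty m \<gamma>" by (rule H0_infty_mult[OF \<phi> hol(1)]) (rule le1)
  have "cmod (z i ^ k) \<le> 1" if "z \<in> stolz_prod m \<gamma>" for z
    unfolding norm_power by (intro power_le_one le1 that norm_ge_zero)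
  then show "(\<lambda>z. \<phi> z * z i ^ k) \<in> H0_infty m \<gamma>" by (rule H0_infty_mult[OF \<phi> hol(2)])
  have "cmod (1 - z i) \<le> 2" if "z \<in> stolz_prod m \<gamma>" for z
    using norm_triangle_ineq4[of 1 "z i"] le1[OF that] by simp
  then show "(\<lambda>z. \<phi> z * (1 - z i)) \<in> H0_infty m \<gamma>" by (rule H0_infty_mult[OF \<phi> hol(3)])
qed

text \<open>Since \<open>T R(\<lambda>) = \<lambda> R(\<lambda>) - I\<close>, the two sides differ by an integral in which \<open>\<lambda>\<^sub>i\<close> occurs only in \<open>\<phi>\<close>;
  it vanishes by Cauchy's theorem in that variable.\<close>

lemma form_T:
  assumes \<phi>: "\<phi> \<in> H0_infty m \<gamma>" and i: "i \<in> {1..m}"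
  shows "form \<phi> (T i x) y = form (\<lambda>z. \<phi> z * z i) x y"
proof -
  define I where "I = {1..m} - {i}"
  have I: "{1..m} = insert i I" "finite I" "i \<notin> I" using i by (auto simp: I_def)
  define L where "L = remove1 i [1..<Suc m]"
  have L: "set L = I" by (auto simp: L_def I_def)
  define h where "h t = \<phi> (curve t) * velocity t * cinner (resolvent_list L (curve t) T x) y" for t
  define a where "a t = \<phi> (curve t) * velocity t * cinner (resolvent_prod m (curve t) T (T i x)) y" for t
  define b where "b t = \<phi> (curve t) * curve t i * velocity t * cinner (resolvent_prod m (curve t) T x) y" for t
  have set_upt: "set [1..<Suc m] = {1..m}" by auto
  have hab: "h t = b t - a t" if t: "t \<in> space cube" for t
  proof -
    have E: "resolvent_prod m (curve t) T (T i x) = curve t i *\<^sub>C resolvent_prod m (curve t) T x - resolvent_list L (curve t) T x"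
      unfolding resolvent_prod_list L_def
      by (rule resolvent_list_T[of "[1..<Suc m]" i "curve t" x, unfolded set_upt,
            OF distinct_upt subset_refl i curve_notin_closure[OF t]])
    show ?thesis
      unfolding h_def a_def b_def E cinner.diff_left cinner_scaleC_left by (simp add: algebra_simps)
  qed
  have a_int: "integrable cube a" unfolding a_def by (rule form_integrable[OF \<phi>])
  have b_int: "integrable cube b"
    unfolding b_def using form_integrable[OF H0_infty_times_coordinate(1)[OF \<phi> i]] .
  have "integrable cube (\<lambda>t. b t - a t)" by (intro Bochner_Integration.integrable_diff a_int b_int)
  then have h_int: "integrable cube h"
    by (rule Bochner_Integration.integrable_cong[THEN iffD1, rotated 2]) (auto simp: hab)
  have hol: "holomorphic_on_stolz_prod \<phi> m \<gamma>" using \<phi> unfolding H0_infty_def by blast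
  obtain c s where cs: "0 < c" "0 < s"
    and decay: "\<And>z. z \<in> stolz_prod m \<gamma> \<Longrightarrow> cmod (\<phi> z) \<le> c * (\<Prod>i=1..m. cmod (1 - z i) powr s)"
    using \<phi> unfolding H0_infty_def by auto
  have inner: "(\<integral>u. h (t(i := u)) \<partial>unit_measure) = 0" if t: "t \<in> space (\<Pi>\<^sub>M i\<in>I. unit_measure)" for t
  proof -
    have upd: "t(i := u) \<in> space cube" if "u \<in> {0<..<1}" for u
      using t that I(3) unfolding space_cube I(1) by (auto simp: space_PiM PiE_iff extensional_def)
    define z0 where "z0 = curve (t(i := 1/2))"
    have z0: "z0 \<in> stolz_prod m \<gamma>" unfolding z0_def by (intro curve_in_stolz_prod upd) auto
    have curve_upd: "curve (t(i := u)) = z0(i := stolz_boundary (\<beta> i) u)" for u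
      using i by (auto simp: z0_def curve_def fun_eq_iff)
    have vel_upd: "velocity (t(i := u)) = stolz_velocity (\<beta> i) u * (\<Prod>j\<in>I. stolz_velocity (\<beta> j) (t j))" for u
    proof -
      have "(\<Prod>j\<in>I. stolz_velocity (\<beta> j) ((t(i := u)) j)) = (\<Prod>j\<in>I. stolz_velocity (\<beta> j) (t j))"
        by (rule prod.cong) (use I(3) in auto)
      then show ?thesis unfolding velocity_def I(1) using I by simp
    qed
    have res_upd: "resolvent_list L (z0(i := w)) T = resolvent_list L z0 T" for w
      by (rule resolvent_list_cong) (use L I(3) in auto)
    define k where "k = (\<Prod>j\<in>I. stolz_velocity (\<beta> j) (t j)) * cinner (resolvent_list L z0 T x) y"
    have h_upd: "h (t(i := u)) = k * (\<phi> (z0(i := stolz_boundary (\<beta> i) u)) * stolz_velocity (\<beta> i) u)" for u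
      unfolding h_def curve_upd vel_upd res_upd k_def by (simp add: mult_ac)
    have "(\<integral>u. \<phi> (z0(i := stolz_boundary (\<beta> i) u)) * stolz_velocity (\<beta> i) u \<partial>unit_measure) = 0"
    proof (rule cauchy_stolz_boundary[where g = "\<lambda>w. \<phi> (z0(i := w))"])
      show "\<beta> i \<in> {0<..<\<gamma> i}" "\<gamma> i < pi/2" using \<beta>_lt_\<gamma>[OF i] angles[OF i] by auto
      show "(\<lambda>w. \<phi> (z0(i := w))) holomorphic_on stolz (\<gamma> i)" by (rule holomorphic_on_stolz_prodD(2)[OF hol z0 i])
      show "0 < s" by (rule cs(2))
      fix w assume w: "w \<in> stolz (\<gamma> i)"
      have "z0(i := w) \<in> stolz_prod m \<gamma>"
        using z0 w i unfolding stolz_prod_def by (auto simp: PiE_iff extensional_def)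
      from decay[OF this]
      have "cmod (\<phi> (z0(i := w))) \<le> c * (\<Prod>j\<in>insert i I. cmod (1 - (z0(i := w)) j) powr s)"
        unfolding I(1) .
      also have "(\<Prod>j\<in>insert i I. cmod (1 - (z0(i := w)) j) powr s) = cmod (1 - w) powr s * (\<Prod>j\<in>I. cmod (1 - z0 j) powr s)"
      proof -
        have "(\<Prod>j\<in>I. cmod (1 - (z0(i := w)) j) powr s) = (\<Prod>j\<in>I. cmod (1 - z0 j) powr s)"
          by (rule prod.cong) (use I(3) in auto)
        then show ?thesis using I by simp
      qed
      finally show "cmod (\<phi> (z0(i := w))) \<le> (c * (\<Prod>j\<in>I. cmod (1 - z0 j) powr s)) * cmod (1 - w) powr s"
        by (simp only: mult_ac)
    qed
    then show ?thesis unfolding h_upd by simp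
  qed
  have "integral\<^sup>L cube h = (\<integral>t. (\<integral>u. h (t(i := u)) \<partial>unit_measure) \<partial>(\<Pi>\<^sub>M i\<in>I. unit_measure))"
    using unit_product.product_integral_insert[OF I(2,3), of h] h_int unfolding I(1) by blast
  also have "\<dots> = (\<integral>t. 0 \<partial>(\<Pi>\<^sub>M i\<in>I. unit_measure))"
    by (rule Bochner_Integration.integral_cong[OF refl inner])
  finally have "integral\<^sup>L cube h = 0" by simp
  moreover have "integral\<^sup>L cube h = integral\<^sup>L cube (\<lambda>t. b t - a t)"
    by (rule Bochner_Integration.integral_cong[OF refl hab])
  moreover have "\<dots> = integral\<^sup>L cube b - integral\<^sup>L cube a"
    by (rule Bochner_Integration.integral_diff[OF b_int a_int])
  ultimately show ?thesis unfolding form_def a_def b_def by simp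
qed

lemma form_opow:
  assumes \<phi>: "\<phi> \<in> H0_infty m \<gamma>" and i: "i \<in> {1..m}"
  shows "form \<phi> (opow (T i) k x) y = form (\<lambda>z. \<phi> z * z i ^ k) x y"
proof (induction k arbitrary: x)
  case (Suc k)
  have "form \<phi> (opow (T i) (Suc k) x) y = form (\<lambda>z. \<phi> z * z i ^ k) (T i x) y"
    using Suc.IH[of "T i x"] by (simp add: opow_Suc T_opow)
  also have "\<dots> = form (\<lambda>z. (\<phi> z * z i ^ k) * z i) x y"
    by (rule form_T[OF H0_infty_times_coordinate(2)[OF \<phi> i] i])
  finally show ?case by (simp add: mult_ac)
qed simp

lemma form_diff_right:
  assumes \<phi>: "\<phi> \<in> H0_infty m \<gamma>"
  shows "form \<phi> (x - x') y = form \<phi> x y - form \<phi> x' y"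
  unfolding form_def
  by (subst Bochner_Integration.integral_diff[OF form_integrable[OF \<phi>] form_integrable[OF \<phi>], symmetric])
    (simp add: blinfun.diff_right cinner.diff_left right_diff_distrib)

lemma form_pdiff:
  assumes \<phi>: "\<phi> \<in> H0_infty m \<gamma>" and i: "i \<in> {1..m}"
  shows "form \<phi> (pdiff (T i) k x) y = form (\<lambda>z. \<phi> z * (z i ^ k * (1 - z i))) x y"
proof -
  have "form \<phi> (pdiff (T i) k x) y = form (\<lambda>z. \<phi> z * z i ^ k) x y - form (\<lambda>z. \<phi> z * z i ^ Suc k) x y"
    by (simp add: pdiff_apply' form_diff_right[OF \<phi>] form_opow[OF \<phi> i])
  also have "\<dots> = form (\<lambda>z. \<phi> z * (z i ^ k * (1 - z i))) x y"
    unfolding form_def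
    by (subst Bochner_Integration.integral_diff[OF form_integrable[OF H0_infty_times_coordinate(2)[OF \<phi> i]]
          form_integrable[OF H0_infty_times_coordinate(2)[OF \<phi> i]], symmetric])
      (simp add: algebra_simps)
  finally show ?thesis .
qed

lemma AE_cube_component:
  assumes P: "AE u in unit_measure. P u" and i: "i \<in> {1..m}"
  shows "AE t in cube. P (t i)"
proof -
  obtain N where N: "{u \<in> space unit_measure. \<not> P u} \<subseteq> N" "emeasure unit_measure N = 0" "N \<in> sets unit_measure"
    using P by (rule AE_E)
  define A where "A j = (if j = i then N else {0<..<1})" for j
  have A: "A j \<in> sets unit_measure" for j using N(3) by (simp add: A_def sets_restrict_space_iff)
  have "emeasure cube (Pi\<^sub>E {1..m} A) = (\<Prod>j\<in>{1..m}. emeasure unit_measure (A j))"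
    by (rule unit_product.emeasure_PiM) (use A in auto)
  also have "\<dots> = 0" using i N(2) by (intro prod_zero) (auto simp: A_def)
  finally have z: "emeasure cube (Pi\<^sub>E {1..m} A) = 0" .
  show ?thesis
  proof (rule AE_I[of _ _ "Pi\<^sub>E {1..m} A"])
    show "{t \<in> space cube. \<not> P (t i)} \<subseteq> Pi\<^sub>E {1..m} A"
    proof clarify
      fix t assume t: "t \<in> space cube" and nP: "\<not> P (t i)"
      have "t i \<in> N" using N(1) nP space_cubeD[OF t i] by auto
      then show "t \<in> Pi\<^sub>E {1..m} A" using t unfolding space_cube by (auto simp: A_def PiE_iff)
    qed
    show "Pi\<^sub>E {1..m} A \<in> sets cube" by (intro sets_PiM_I_finite) (use A in auto)
  qed (rule z)
qed

text \<open>The assumed factors \<open>cmod (1 - z i)\<close> cancel the resolvent singularities,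
  and the powers integrate to order \<open>1/(k i + 1)\<close>. The number 64 is the velocity bound
  32 times the 2 from \<open>integral_power_min_le\<close>.\<close>

lemma form_bound:
  assumes \<phi>: "\<phi> \<in> H0_infty m \<gamma>" and B: "0 \<le> B"
    and le: "\<And>z. z \<in> stolz_prod m \<gamma> \<Longrightarrow> cmod (\<phi> z) \<le> B * (\<Prod>i=1..m. cmod (z i) ^ k i * cmod (1 - z i))"
  shows "cmod (form \<phi> x y) \<le> B * (\<Prod>i=1..m. 64 * C i / ((1 - sin (\<gamma> i)) * real (Suc (k i)))) * norm x * norm y"
proof -
  \<comment> \<open>The outer angle is used instead of \<open>\<beta> i\<close>, so that the bound
    is the same for all contours.\<close>
  define c where "c i = 1 - sin (\<gamma> i)" for i
  have c: "0 < c i" "c i \<le> 1" if "i \<in> {1..m}" for i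
    using sin_angle[OF \<gamma>_angle[OF that]] by (auto simp: c_def)
  define g where "g i u = 32 * C i * (1 - c i * min u (1 - u)) ^ k i" for i u
  have gI: "integrable unit_measure (g i)" "integral\<^sup>L unit_measure (g i) \<le> 64 * C i / (c i * real (Suc (k i)))"
    if i: "i \<in> {1..m}" for i
  proof -
    note I = integral_power_min_le[OF c[OF i], of "k i"]
    show "integrable unit_measure (g i)" unfolding g_def by (intro integrable_mult_right I)
    have "integral\<^sup>L unit_measure (g i) = 32 * C i * integral\<^sup>L unit_measure (\<lambda>u. (1 - c i * min u (1 - u)) ^ k i)"
      unfolding g_def by simp
    also have "\<dots> \<le> 32 * C i * (2 / (c i * real (Suc (k i))))"
      using C_nonneg[OF i] by (intro mult_left_mono I) auto
    finally show "integral\<^sup>L unit_measure (g i) \<le> 64 * C i / (c i * real (Suc (k i)))" by simp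
  qed
  have pi: "integrable cube (\<lambda>t. B * norm x * norm y * (\<Prod>i=1..m. g i (t i)))"
    by (intro integrable_mult_right unit_product.product_integrable_prod gI) auto
  have ae: "AE t in cube. \<forall>i\<in>{1..m}. cmod (stolz_velocity (\<beta> i) (t i)) \<le> 32"
    by (rule AE_finite_allI) (auto intro!: AE_cube_component AE_cmod_stolz_velocity_le \<beta>_angle)
  have "cmod (form \<phi> x y) \<le> (\<integral>t. norm (\<phi> (curve t) * velocity t * cinner (resolvent_prod m (curve t) T x) y) \<partial>cube)"
    unfolding form_def by (rule integral_norm_bound)
  also have "\<dots> \<le> (\<integral>t. B * norm x * norm y * (\<Prod>i=1..m. g i (t i)) \<partial>cube)"
  proof (rule integral_mono_AE)
    show "AE t in cube. norm (\<phi> (curve t) * velocity t * cinner (resolvent_prod m (curve t) T x) y)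
        \<le> B * norm x * norm y * (\<Prod>i=1..m. g i (t i))"
      using ae AE_space
    proof eventually_elim
      fix t assume v: "\<forall>i\<in>{1..m}. cmod (stolz_velocity (\<beta> i) (t i)) \<le> 32" and t: "t \<in> space cube"
      have Rle: "cmod (cinner (resolvent_prod m (curve t) T x) y) \<le> (\<Prod>i=1..m. C i / cmod (1 - curve t i)) * norm x * norm y"
        by (intro order_trans[OF cmod_cinner_le] mult_right_mono order_trans[OF norm_blinfun]
            norm_resolvent_prod_le curve_notin_closure[OF t]) auto
      have "norm (\<phi> (curve t) * velocity t * cinner (resolvent_prod m (curve t) T x) y)
          \<le> (B * (\<Prod>i=1..m. cmod (curve t i) ^ k i * cmod (1 - curve t i)))
            * (\<Prod>i=1..m. cmod (stolz_velocity (\<beta> i) (t i)))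
            * ((\<Prod>i=1..m. C i / cmod (1 - curve t i)) * norm x * norm y)"
        unfolding norm_mult
        by (intro mult_mono le curve_in_stolz_prod t Rle)
          (auto simp: velocity_def prod_norm[symmetric] intro!: mult_nonneg_nonneg prod_nonneg B)
      also have "\<dots> = B * norm x * norm y * (\<Prod>i=1..m. (cmod (curve t i) ^ k i * cmod (1 - curve t i))
            * cmod (stolz_velocity (\<beta> i) (t i)) * (C i / cmod (1 - curve t i)))"
        unfolding prod.distrib by (simp only: mult_ac)
      also have "\<dots> \<le> B * norm x * norm y * (\<Prod>i=1..m. g i (t i))"
      proof (intro mult_left_mono prod_mono conjI)
        fix i assume i: "i \<in> {1..m}"
        have ti: "t i \<in> {0..1}" using space_cubeD[OF t i] by auto
        show "0 \<le> cmod (curve t i) ^ k i * cmod (1 - curve t i) * cmod (stolz_velocity (\<beta> i) (t i)) * (C i / cmod (1 - curve t i))"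
          using C_nonneg[OF i] by auto
        have ne: "cmod (1 - curve t i) \<noteq> 0"
          using notin_closure_neq_one[OF rb[OF i] curve_notin_closure[OF t i]] by simp
        have "cmod (curve t i) \<le> 1 - (1 - sin (\<beta> i)) * min (t i) (1 - t i)"
          unfolding curve_eq[OF i] by (rule cmod_stolz_boundary_le[OF \<beta>_angle[OF i] ti])
        also have "\<dots> \<le> 1 - c i * min (t i) (1 - t i)"
          using sin_angle_mono[OF \<beta>_lt_\<gamma>[OF i]] angles[OF i] ti
          by (auto simp: c_def intro!: mult_right_mono)
        finally have cu: "cmod (curve t i) \<le> 1 - c i * min (t i) (1 - t i)" .
        have "cmod (curve t i) ^ k i * cmod (1 - curve t i) * cmod (stolz_velocity (\<beta> i) (t i)) * (C i / cmod (1 - curve t i))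
            = cmod (stolz_velocity (\<beta> i) (t i)) * C i * cmod (curve t i) ^ k i"
          using ne by (simp add: field_simps)
        also have "\<dots> \<le> 32 * C i * (1 - c i * min (t i) (1 - t i)) ^ k i"
          using v i C_nonneg[OF i] by (intro mult_mono power_mono cu) auto
        finally show "cmod (curve t i) ^ k i * cmod (1 - curve t i) * cmod (stolz_velocity (\<beta> i) (t i)) * (C i / cmod (1 - curve t i)) \<le> g i (t i)"
          by (simp add: g_def)
      qed (use B in auto)
      finally show "norm (\<phi> (curve t) * velocity t * cinner (resolvent_prod m (curve t) T x) y)
        \<le> B * norm x * norm y * (\<Prod>i=1..m. g i (t i))" .
    qed
  qed (intro integrable_norm form_integrable \<phi>, rule pi)
  also have "\<dots> = B * norm x * norm y * (\<Prod>i=1..m. integral\<^sup>L unit_measure (g i))"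
    using unit_product.product_integral_prod[of "{1..m}" g] gI(1) by simp
  also have "\<dots> \<le> B * norm x * norm y * (\<Prod>i=1..m. 64 * C i / (c i * real (Suc (k i))))"
  proof (intro mult_left_mono prod_mono conjI gI(2))
    fix i assume i: "i \<in> {1..m}"
    have "0 \<le> g i u" if "u \<in> space unit_measure" for u
    proof -
      have "c i * min u (1 - u) \<le> 1 * 1" using c[OF i] that by (intro mult_mono) auto
      then show ?thesis using C_nonneg[OF i] by (simp add: g_def)
    qed
    then show "0 \<le> integral\<^sup>L unit_measure (g i)" by (intro integral_nonneg_AE AE_I2)
  qed (use B in auto)
  finally show ?thesis by (simp add: c_def mult_ac)
qed

end

text \<open>Consistency with polynomials vanishing at \<open>1\<close>: Cauchy's formula settles
  \<open>1 - z\<close>, and multiplication by \<open>z\<close> corresponds to applying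
  \<open>T\<close>.\<close>

lemma single_calculus:
  assumes c: "stolz_calculus 1 (\<lambda>_. T) \<alpha> \<beta> \<gamma> C"
  shows single_H0: "(\<lambda>z. z 1 ^ k * (1 - z 1)) \<in> H0_infty 1 \<gamma>"
    and single_form: "stolz_calculus.form 1 (\<lambda>_. T) \<beta> (\<lambda>z. z 1 ^ k * (1 - z 1)) x y
      = 2 * of_real pi * \<i> * cinner (pdiff T k x) y"
proof -
  interpret stolz_calculus 1 "\<lambda>_. T" \<alpha> \<beta> \<gamma> C by (rule c)
  have one: "(1::nat) \<in> {1..1}" by simp
  have H: "(\<lambda>z. 1 - z 1) \<in> H0_infty 1 \<gamma>"
    unfolding H0_infty_def mem_Collect_eq
  proof (intro conjI exI[of _ 1])
    show "holomorphic_on_stolz_prod (\<lambda>z. 1 - z 1) 1 \<gamma>"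
      by (rule holomorphic_on_stolz_prod_coordinate[where g = "\<lambda>z. 1 - z", OF _ one]) (intro holomorphic_intros)
    show "bounded ((\<lambda>z. 1 - z 1) ` stolz_prod 1 \<gamma>)"
      unfolding bounded_iff
    proof (intro exI[of _ 2] ballI)
      fix v assume "v \<in> (\<lambda>z. 1 - z 1) ` stolz_prod 1 \<gamma>"
      then obtain z where z: "z \<in> stolz_prod 1 \<gamma>" "v = 1 - z 1" by blast
      show "norm v \<le> 2" using norm_triangle_ineq4[of 1 "z 1"] stolz_prod_cmod_less[OF z(1) one] by (simp add: z(2))
    qed
  qed auto
  have "form (\<lambda>z. 1 - z 1) u y = 2 * of_real pi * \<i> * cinner (u - T u) y" for u
  proof -
    have set1: "{1..1} = {1::nat}" by auto
    have meas: "(\<lambda>s. (1 - stolz_boundary (\<beta> 1) s) * cinner (resolvent (stolz_boundary (\<beta> 1) s) T u) y * stolz_velocity (\<beta> 1) s)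
        \<in> borel_measurable unit_measure"
    proof (intro borel_measurable_times measurable_stolz_velocity measurable_unit_continuous)
      have cb: "continuous_on {0<..<1} (stolz_boundary (\<beta> 1))"
        by (rule continuous_on_subset[OF continuous_on_stolz_boundary]) auto
      then show "continuous_on {0<..<1} (\<lambda>s. 1 - stolz_boundary (\<beta> 1) s)" by (intro continuous_intros)
      have "stolz_boundary (\<beta> 1) ` {0<..<1} \<subseteq> - closure (stolz (\<alpha> 1))"
        using stolz_boundary_notin_closure[of "\<alpha> 1" "\<beta> 1"] \<alpha>_pos[OF one] angles[OF one] by auto
      then show "continuous_on {0<..<1} (\<lambda>s. cinner (resolvent (stolz_boundary (\<beta> 1) s) T u) y)"
        by (rule continuous_on_compose2[OF holomorphic_on_imp_continuous_on[OF holomorphic_on_resolvent[OF rb[OF one]]] cb])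
    qed
    have "form (\<lambda>z. 1 - z 1) u y = (\<integral>t. (1 - stolz_boundary (\<beta> 1) (t 1)) * cinner (resolvent (stolz_boundary (\<beta> 1) (t 1)) T u) y
        * stolz_velocity (\<beta> 1) (t 1) \<partial>(\<Pi>\<^sub>M i\<in>{1::nat}. unit_measure))"
      unfolding form_def resolvent_prod_def curve_def velocity_def by (simp add: set1 mult_ac)
    also have "\<dots> = 2 * of_real pi * \<i> * cinner (u - T u) y"
      unfolding unit_product.product_integral_singleton[OF meas]
      by (rule resolvent_cauchy_integral[OF rb[OF one]]) (use angles[OF one] in auto)
    finally show ?thesis .
  qed
  then have "form (\<lambda>z. 1 - z 1) (opow T k x) y = 2 * of_real pi * \<i> * cinner (pdiff T k x) y"
    by (simp add: pdiff_apply T_opow)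
  then have "form (\<lambda>z. (1 - z 1) * z 1 ^ k) x y = 2 * of_real pi * \<i> * cinner (pdiff T k x) y"
    using form_opow[OF H one, of k x y] by simp
  then show "form (\<lambda>z. z 1 ^ k * (1 - z 1)) x y = 2 * of_real pi * \<i> * cinner (pdiff T k x) y"
    by (simp add: mult.commute)
  show "(\<lambda>z. z 1 ^ k * (1 - z 1)) \<in> H0_infty 1 \<gamma>"
    using H0_infty_times_coordinate(2)[OF H one, of k] by (simp add: mult.commute)
qed

lemma norm_blinfun_le_cinner:
  fixes A :: "'a::complex_hilbert_space \<Rightarrow>\<^sub>L 'a"
  assumes c: "0 \<le> c" and le: "\<And>x y. cmod (cinner (A x) y) \<le> c * norm x * norm y"
  shows "norm A \<le> c"
proof (rule norm_blinfun_bound[OF c])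
  show "norm (A x) \<le> c * norm x" for x
    by (rule norm_le_cinner) (use c le in auto)
qed

lemma stolz_calculus_single:
  assumes "resolvent_bound (\<alpha> 1) (C 1) T" "\<alpha> 1 < \<beta> 1" "\<beta> 1 < \<gamma> 1" "\<gamma> (1::nat) < pi/2"
  shows "stolz_calculus 1 (\<lambda>_. T) \<alpha> \<beta> \<gamma> C"
proof
  fix i :: nat assume "i \<in> {1..1}"
  then have i: "i = 1" by simp
  show "resolvent_bound (\<alpha> i) (C i) T" "\<alpha> i < \<beta> i \<and> \<beta> i < \<gamma> i \<and> \<gamma> i < pi/2"
    unfolding i using assms by auto
qed (simp add: op_commute_def)

lemma cmod_two_pi_i: "cmod (2 * of_real pi * \<i> * w) = 2 * pi * cmod w"
  by (simp add: norm_mult)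

text \<open>Contour integral of \<open>z^k (1 - z)\<close>: the factor \<open>1 - z\<close> cancels
  the resolvent and the power yields \<open>1/(k+1)\<close>.\<close>

lemma ritt_pdiff_bound:
  assumes "ritt T"
  shows "\<exists>M. \<forall>k. real (Suc k) * norm (pdiff T k) \<le> M"
proof -
  obtain \<alpha>0 where T: "ritt_of_type \<alpha>0 T" using assms unfolding ritt_def by blast
  then have a0: "0 < \<alpha>0" "\<alpha>0 < pi/2" unfolding ritt_of_type_def by auto
  obtain \<alpha> where \<alpha>: "\<alpha>0 < \<alpha>" "\<alpha> < pi/2" using dense a0 by blast
  obtain \<beta> where \<beta>: "\<alpha> < \<beta>" "\<beta> < pi/2" using dense \<alpha> by blast
  obtain \<gamma> where \<gamma>: "\<beta> < \<gamma>" "\<gamma> < pi/2" using dense \<beta> by blast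
  obtain C where C: "resolvent_bound \<alpha> C T" using ritt_of_type_resolvent_bound[OF T \<alpha>] by blast
  have c: "stolz_calculus 1 (\<lambda>_. T) (\<lambda>_. \<alpha>) (\<lambda>_. \<beta>) (\<lambda>_. \<gamma>) (\<lambda>_. C)"
    by (rule stolz_calculus_single) (use C \<beta> \<gamma> in auto)
  interpret stolz_calculus 1 "\<lambda>_. T" "\<lambda>_. \<alpha>" "\<lambda>_. \<beta>" "\<lambda>_. \<gamma>" "\<lambda>_. C" by (rule c)
  have C0: "0 \<le> C" using resolvent_bound_basic[OF C] by blast
  have \<gamma>': "\<gamma> \<in> {0<..<pi/2}" using a0 \<alpha> \<beta> \<gamma> by auto
  define M where "M = 64 * C / (1 - sin \<gamma>)"
  have M0: "0 \<le> M" using C0 sin_angle[OF \<gamma>'] by (simp add: M_def)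
  have set1: "{1..1} = {1::nat}" by auto
  have "real (Suc k) * norm (pdiff T k) \<le> M" for k
  proof -
    have "norm (pdiff T k) \<le> M / real (Suc k)"
    proof (rule norm_blinfun_le_cinner)
      show "0 \<le> M / real (Suc k)" using M0 by simp
      fix x y
      have "cmod (cinner (pdiff T k x) y) \<le> 2 * pi * cmod (cinner (pdiff T k x) y)"
        using pi_ge_two by (intro mult_right_mono[of 1 "2 * pi", simplified]) auto
      also have "\<dots> = cmod (form (\<lambda>z. z 1 ^ k * (1 - z 1)) x y)"
        unfolding single_form[OF c] cmod_two_pi_i ..
      also have "\<dots> \<le> 1 * (\<Prod>i=1..1::nat. 64 * C / ((1 - sin \<gamma>) * real (Suc k))) * norm x * norm y"
        by (rule form_bound[where k = "\<lambda>_. k", OF single_H0[OF c]]) (simp_all add: norm_mult norm_power)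
      also have "\<dots> = M / real (Suc k) * norm x * norm y" by (simp add: set1 M_def)
      finally show "cmod (cinner (pdiff T k x) y) \<le> M / real (Suc k) * norm x * norm y" .
    qed
    then show ?thesis by (simp add: field_simps)
  qed
  then show ?thesis by blast
qed

text \<open>Carries supremum bounds on the Stolz domain over to operator norms. The common factor
  \<open>1 - z\<close> supplies the decay at the vertex.\<close>

lemma calculus_polynomial_bound:
  assumes c: "stolz_calculus 1 (\<lambda>_. T) \<alpha> \<beta> \<gamma> C" and D: "0 \<le> D"
    and calc: "\<And>\<phi>. \<phi> \<in> H0_infty 1 \<gamma> \<Longrightarrow>
      norm (joint_calculus 1 \<beta> (\<lambda>_. T) \<phi>) \<le> D * (SUP z\<in>stolz_prod 1 \<gamma>. cmod (\<phi> z))"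
    and B: "\<And>z. z \<in> stolz (\<gamma> 1) \<Longrightarrow> cmod (\<Sum>j<N. of_real (a j) * (z ^ e j * (1 - z))) \<le> B"
  shows "norm (\<Sum>j<N. a j *\<^sub>R pdiff T (e j)) \<le> D * B"
proof -
  interpret stolz_calculus 1 "\<lambda>_. T" \<alpha> \<beta> \<gamma> C by (rule c)
  have one: "(1::nat) \<in> {1..1}" by simp
  define \<phi> :: "(nat \<Rightarrow> complex) \<Rightarrow> complex" where "\<phi> z = (\<Sum>j<N. of_real (a j) * (z 1 ^ e j * (1 - z 1)))" for z
  have H: "\<phi> \<in> H0_infty 1 \<gamma>"
  proof -
    have "(\<lambda>z. (z 1 ^ 0 * (1 - z 1)) * (\<Sum>j<N. of_real (a j) * z 1 ^ e j)) \<in> H0_infty 1 \<gamma>"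
    proof (rule H0_infty_mult[OF single_H0[OF c]])
      show "holomorphic_on_stolz_prod (\<lambda>z. \<Sum>j<N. of_real (a j) * z 1 ^ e j) 1 \<gamma>"
        by (rule holomorphic_on_stolz_prod_coordinate[where g = "\<lambda>z. \<Sum>j<N. of_real (a j) * z ^ e j", OF _ one])
          (intro holomorphic_intros)
      show "cmod (\<Sum>j<N. of_real (a j) * z 1 ^ e j) \<le> (\<Sum>j<N. \<bar>a j\<bar>)" if "z \<in> stolz_prod 1 \<gamma>" for z
      proof (rule sum_norm_le)
        fix j
        have "cmod (z 1) ^ e j \<le> 1" using stolz_prod_cmod_less[OF that one] by (intro power_le_one) auto
        then show "cmod (of_real (a j) * z 1 ^ e j) \<le> \<bar>a j\<bar>" by (simp add: norm_mult norm_power mult_left_le)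
      qed
    qed
    moreover have "(\<lambda>z. (z 1 ^ 0 * (1 - z 1)) * (\<Sum>j<N. of_real (a j) * z 1 ^ e j)) = \<phi>"
      by (simp add: \<phi>_def fun_eq_iff sum_distrib_left mult_ac)
    ultimately show ?thesis by simp
  qed
  have "joint_calculus 1 \<beta> (\<lambda>_. T) \<phi> = (\<Sum>j<N. a j *\<^sub>R pdiff T (e j))"
  proof (rule blinfun_eqI, rule cinner_ext)
    fix x y
    have "form \<phi> x y = (\<integral>t. (\<Sum>j<N. of_real (a j) * ((curve t 1 ^ e j * (1 - curve t 1)) * velocity t *
        cinner (resolvent_prod 1 (curve t) (\<lambda>_. T) x) y)) \<partial>cube)"
      unfolding form_def \<phi>_def sum_distrib_right by (simp only: mult.assoc)
    also have "\<dots> = (\<Sum>j<N. of_real (a j) * form (\<lambda>z. z 1 ^ e j * (1 - z 1)) x y)"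
      unfolding form_def
      by (subst Bochner_Integration.integral_sum)
        (use form_integrable[OF single_H0[OF c]] in \<open>auto intro!: integrable_mult_right\<close>)
    also have "\<dots> = 2 * of_real pi * \<i> * (\<Sum>j<N. of_real (a j) * cinner (pdiff T (e j) x) y)"
      unfolding single_form[OF c] sum_distrib_left by (simp only: mult_ac)
    finally have "cinner (joint_calculus 1 \<beta> (\<lambda>_. T) \<phi> x) y = (\<Sum>j<N. of_real (a j) * cinner (pdiff T (e j) x) y)"
      unfolding joint_calculus_form[OF H] by simp
    also have "\<dots> = cinner ((\<Sum>j<N. a j *\<^sub>R pdiff T (e j)) x) y"
      by (simp add: blinfun.sum_left blinfun.scaleR_left cinner.sum_left cinner.scaleR_left scaleR_conv_of_real)
    finally show "cinner (joint_calculus 1 \<beta> (\<lambda>_. T) \<phi> x) y = cinner ((\<Sum>j<N. a j *\<^sub>R pdiff T (e j)) x) y" .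
  qed
  moreover have "(SUP z\<in>stolz_prod 1 \<gamma>. cmod (\<phi> z)) \<le> B"
  proof (rule cSUP_least)
    have "(\<lambda>i\<in>{1..1}. 1/2) \<in> space cube"
      unfolding space_cube by (intro restrict_PiE_iff[THEN iffD2]) auto
    then show "stolz_prod 1 \<gamma> \<noteq> {}" using curve_in_stolz_prod by blast
    show "cmod (\<phi> z) \<le> B" if "z \<in> stolz_prod 1 \<gamma>" for z
      unfolding \<phi>_def using that by (intro B) (auto simp: stolz_prod_def)
  qed
  ultimately show ?thesis using order_trans[OF calc[OF H] mult_left_mono[OF _ D]] by metis
qed

text \<open>Greedy choice of signs: at every step one of the two signs does not decrease the norm.\<close>

lemma signed_sums_square_function:
  fixes A :: "nat \<Rightarrow> 'a::complex_hilbert_space \<Rightarrow>\<^sub>L 'a"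
  assumes D: "\<And>\<epsilon> N. (\<And>j. \<epsilon> j \<in> {1, - 1 :: real}) \<Longrightarrow> norm (\<Sum>j<N. \<epsilon> j *\<^sub>R A j) \<le> D"
  shows "(\<Sum>j<N. (norm (A j x))\<^sup>2) \<le> D\<^sup>2 * (norm x)\<^sup>2"
proof -
  have "\<exists>\<epsilon>. (\<forall>j. \<epsilon> j \<in> {1, - 1 :: real}) \<and> (\<Sum>j<N. (norm (A j x))\<^sup>2) \<le> (norm (\<Sum>j<N. \<epsilon> j *\<^sub>R A j x))\<^sup>2"
  proof (induction N)
    case 0
    show ?case by (rule exI[of _ "\<lambda>_. 1"]) simp
  next
    case (Suc N)
    then obtain \<epsilon> where \<epsilon>: "\<And>j. \<epsilon> j \<in> {1, - 1 :: real}"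
      and le: "(\<Sum>j<N. (norm (A j x))\<^sup>2) \<le> (norm (\<Sum>j<N. \<epsilon> j *\<^sub>R A j x))\<^sup>2" by blast
    define S where "S = (\<Sum>j<N. \<epsilon> j *\<^sub>R A j x)"
    define s :: real where "s = (if 0 \<le> Re (cinner S (A N x)) then 1 else - 1)"
    have s: "0 \<le> s * Re (cinner S (A N x))" "s\<^sup>2 = 1" by (auto simp: s_def)
    have "(\<Sum>j<N. (\<epsilon>(N := s)) j *\<^sub>R A j x) = S" unfolding S_def by (rule sum.cong) auto
    then have "(\<Sum>j<Suc N. (\<epsilon>(N := s)) j *\<^sub>R A j x) = S + s *\<^sub>R A N x" by simp
    moreover have "(norm (S + s *\<^sub>R A N x))\<^sup>2 = (norm S)\<^sup>2 + 2 * (s * Re (cinner S (A N x))) + s\<^sup>2 * (norm (A N x))\<^sup>2"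
      unfolding norm_add_square by (simp add: cinner.scaleR_right power_mult_distrib)
    ultimately have "(\<Sum>j<Suc N. (norm (A j x))\<^sup>2) \<le> (norm (\<Sum>j<Suc N. (\<epsilon>(N := s)) j *\<^sub>R A j x))\<^sup>2"
      using le s by (simp add: S_def[symmetric])
    moreover have "\<forall>j. (\<epsilon>(N := s)) j \<in> {1, - 1}" using \<epsilon> by (auto simp: s_def)
    ultimately show ?case by blast
  qed
  then obtain \<epsilon> where \<epsilon>: "\<And>j. \<epsilon> j \<in> {1, - 1 :: real}"
    and le: "(\<Sum>j<N. (norm (A j x))\<^sup>2) \<le> (norm (\<Sum>j<N. \<epsilon> j *\<^sub>R A j x))\<^sup>2" by blast
  have "(\<Sum>j<N. \<epsilon> j *\<^sub>R A j x) = (\<Sum>j<N. \<epsilon> j *\<^sub>R A j) x" by (simp add: blinfun.sum_left blinfun.scaleR_left)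
  then have "norm (\<Sum>j<N. \<epsilon> j *\<^sub>R A j x) \<le> D * norm x"
    using order_trans[OF norm_blinfun mult_right_mono[OF D[of \<epsilon> N, OF \<epsilon>] norm_ge_zero]] by metis
  then have "(norm (\<Sum>j<N. \<epsilon> j *\<^sub>R A j x))\<^sup>2 \<le> (D * norm x)\<^sup>2" by (intro power_mono) auto
  then show ?thesis using le by (simp add: power_mult_distrib)
qed

text \<open>Cauchy condensation: the term with index \<open>j + 1\<close> is at most twice the block
  \<open>2^j < k <= 2^(j+1)\<close> of the geometric series.\<close>

lemma dyadic_power_sum_le:
  assumes r: "0 \<le> r" "r < (1::real)"
  shows "(\<Sum>j<N. 2 ^ j * r ^ (2 ^ j)) \<le> 2 / (1 - r)"
proof -
  have step: "(\<Sum>j<Suc N. 2 ^ j * r ^ (2 ^ j)) \<le> 2 * (\<Sum>k<Suc (2 ^ N). r ^ k)" for N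
  proof (induction N)
    case 0
    show ?case using r by simp
  next
    case (Suc N)
    have "2 ^ N * r ^ (2 ^ Suc N) = (\<Sum>k\<in>{Suc (2 ^ N)..<Suc (2 ^ Suc N)}. r ^ (2 ^ Suc N))" by simp
    also have "\<dots> \<le> (\<Sum>k\<in>{Suc (2 ^ N)..<Suc (2 ^ Suc N)}. r ^ k)"
      by (intro sum_mono power_decreasing) (use r in auto)
    finally have "2 ^ Suc N * r ^ (2 ^ Suc N) \<le> 2 * (\<Sum>k\<in>{Suc (2 ^ N)..<Suc (2 ^ Suc N)}. r ^ k)" by simp
    moreover have "(\<Sum>k<Suc (2 ^ Suc N). r ^ k)
        = (\<Sum>k<Suc (2 ^ N). r ^ k) + (\<Sum>k\<in>{Suc (2 ^ N)..<Suc (2 ^ Suc N)}. r ^ k)"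
      unfolding lessThan_atLeast0 by (rule sum.atLeastLessThan_concat[symmetric]) auto
    ultimately show ?case using Suc by (simp only: sum.lessThan_Suc[of _ "Suc N"] distrib_left)
  qed
  have "(\<Sum>k<Suc (2 ^ N). r ^ k) \<le> (\<Sum>k. r ^ k)"
    using r by (intro sum_le_suminf summable_geometric) auto
  also have "\<dots> = 1 / (1 - r)" using r by (intro suminf_geometric) auto
  finally have "2 * (\<Sum>k<Suc (2 ^ N). r ^ k) \<le> 2 / (1 - r)" by simp
  moreover have "(\<Sum>j<N. 2 ^ j * r ^ (2 ^ j)) \<le> (\<Sum>j<Suc N. 2 ^ j * r ^ (2 ^ j))" using r by simp
  ultimately show ?thesis using step[of N] by linarith
qed

text \<open>In the block from \<open>2^J\<close> to \<open>2^(J+1)\<close> every difference is a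
  bounded power applied to the first one. There are \<open>2^J\<close> terms of weight at most
  \<open>2^(J+1)\<close>, which matches \<open>2 * 4^J\<close>. The term \<open>k = 0\<close> lies
  in no block and accounts for \<open>pdiff T 0\<close>.\<close>

lemma dyadic_square_function:
  assumes M: "\<And>k. norm (opow T k) \<le> M"
    and D: "\<And>N x. (\<Sum>j<N. (norm (((2 ^ j) *\<^sub>R pdiff T (2 ^ j)) x))\<^sup>2) \<le> D\<^sup>2 * (norm x)\<^sup>2"
  shows "square_function_bounded (norm (pdiff T 0) + 2 * M * \<bar>D\<bar>) T"
  unfolding square_function_bounded_def
proof (intro allI)
  fix x N
  have M0: "0 \<le> M" using M[of 0] norm_ge_zero order_trans by blast
  define d where "d = \<bar>D\<bar>"
  have blk: "(\<Sum>k<2 ^ J. real (Suc k) * (norm (pdiff T k x))\<^sup>2)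
      \<le> (norm (pdiff T 0 x))\<^sup>2 + 2 * M\<^sup>2 * (\<Sum>j<J. (norm (((2 ^ j) *\<^sub>R pdiff T (2 ^ j)) x))\<^sup>2)" for J
  proof (induction J)
    case (Suc J)
    have "(\<Sum>k\<in>{2 ^ J..<2 ^ Suc J}. real (Suc k) * (norm (pdiff T k x))\<^sup>2)
        \<le> (\<Sum>k\<in>{2 ^ J..<(2::nat) ^ Suc J}. 2 ^ Suc J * (M\<^sup>2 * (norm (pdiff T (2 ^ J) x))\<^sup>2))"
    proof (rule sum_mono)
      fix k :: nat assume k: "k \<in> {2 ^ J..<2 ^ Suc J}"
      have "pdiff T k x = opow T (k - 2 ^ J) (pdiff T (2 ^ J) x)" using k by (simp add: opow_pdiff)
      also have "norm \<dots> \<le> M * norm (pdiff T (2 ^ J) x)"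
        by (rule order_trans[OF norm_blinfun mult_right_mono[OF M]]) simp
      finally have "(norm (pdiff T k x))\<^sup>2 \<le> M\<^sup>2 * (norm (pdiff T (2 ^ J) x))\<^sup>2"
        unfolding power_mult_distrib[symmetric] by (intro power_mono) auto
      moreover have "real (Suc k) \<le> 2 ^ Suc J"
      proof -
        have "Suc k \<le> 2 ^ Suc J" using k by simp
        then have "real (Suc k) \<le> real (2 ^ Suc J)" by (rule of_nat_le_iff[THEN iffD2])
        then show ?thesis by simp
      qed
      ultimately show "real (Suc k) * (norm (pdiff T k x))\<^sup>2 \<le> 2 ^ Suc J * (M\<^sup>2 * (norm (pdiff T (2 ^ J) x))\<^sup>2)"
        by (intro mult_mono) auto
    qed
    also have "\<dots> = 2 * M\<^sup>2 * (norm (((2 ^ J) *\<^sub>R pdiff T (2 ^ J)) x))\<^sup>2"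
      by (simp add: blinfun.scaleR_left power_mult_distrib power2_eq_square)
    finally have "(\<Sum>k\<in>{2 ^ J..<2 ^ Suc J}. real (Suc k) * (norm (pdiff T k x))\<^sup>2)
        \<le> 2 * M\<^sup>2 * (norm (((2 ^ J) *\<^sub>R pdiff T (2 ^ J)) x))\<^sup>2" .
    moreover have "(\<Sum>k<2 ^ Suc J. real (Suc k) * (norm (pdiff T k x))\<^sup>2)
        = (\<Sum>k<2 ^ J. real (Suc k) * (norm (pdiff T k x))\<^sup>2)
          + (\<Sum>k\<in>{2 ^ J..<2 ^ Suc J}. real (Suc k) * (norm (pdiff T k x))\<^sup>2)"
      unfolding lessThan_atLeast0 by (rule sum.atLeastLessThan_concat[symmetric]) auto
    ultimately show ?case using Suc by (simp only: sum.lessThan_Suc distrib_left)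
  qed simp
  have "(\<Sum>k<N. real (Suc k) * (norm (pdiff T k x))\<^sup>2) \<le> (\<Sum>k<2 ^ N. real (Suc k) * (norm (pdiff T k x))\<^sup>2)"
  proof (rule sum_mono2)
    have "N < 2 ^ N" by (rule less_exp)
    then show "{..<N} \<subseteq> {..<2 ^ N}" by auto
  qed auto
  also have "\<dots> \<le> (norm (pdiff T 0) * norm x)\<^sup>2 + 2 * M\<^sup>2 * (D\<^sup>2 * (norm x)\<^sup>2)"
    by (rule order_trans[OF blk add_mono[OF power_mono[OF norm_blinfun] mult_left_mono[OF D]]]) auto
  also have "\<dots> \<le> ((norm (pdiff T 0))\<^sup>2 + (2 * M * d)\<^sup>2 + 2 * norm (pdiff T 0) * (2 * M * d)) * (norm x)\<^sup>2"
  proof -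
    have "0 \<le> 2 * M\<^sup>2 * D\<^sup>2 * (norm x)\<^sup>2" "0 \<le> 4 * norm (pdiff T 0) * M * d * (norm x)\<^sup>2" using M0 by (auto simp: d_def)
    moreover have "d\<^sup>2 = D\<^sup>2" by (simp add: d_def)
    ultimately show ?thesis by (simp add: power_mult_distrib algebra_simps)
  qed
  finally show "(\<Sum>k<N. real (Suc k) * (norm (pdiff T k x))\<^sup>2) \<le> (norm (pdiff T 0) + 2 * M * \<bar>D\<bar>)\<^sup>2 * (norm x)\<^sup>2"
    unfolding power2_sum d_def .
qed

lemma calculus_imp_square_op:
  assumes "joint_bounded_calculus 1 (\<lambda>_. T)"
  shows "square_op T"
proof -
  obtain \<alpha>0 \<gamma> D where a: "\<And>i. i \<in> {1..1::nat} \<Longrightarrow> ritt_of_type (\<alpha>0 i) T \<and> \<gamma> i \<in> {\<alpha>0 i<..<pi/2}"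
    and D: "0 < D" and calc: "\<And>\<phi> \<beta>. \<phi> \<in> H0_infty 1 \<gamma> \<Longrightarrow> (\<And>i. i \<in> {1..1} \<Longrightarrow> \<beta> i \<in> {\<alpha>0 i<..<\<gamma> i}) \<Longrightarrow>
        norm (joint_calculus 1 \<beta> (\<lambda>_. T) \<phi>) \<le> D * (SUP z\<in>stolz_prod 1 \<gamma>. cmod (\<phi> z))"
    using assms unfolding joint_bounded_calculus_def by blast
  have T: "ritt_of_type (\<alpha>0 1) T" and \<gamma>: "\<alpha>0 1 < \<gamma> 1" "\<gamma> 1 < pi/2" using a[of 1] by auto
  have Tb: "T \<in> bounded_ops" and a0: "0 < \<alpha>0 1" using T unfolding ritt_of_type_def by auto
  \<comment> \<open>\<beta> is a contour angle for which the calculus estimate is assumed; \<alpha>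
    is placed below it to make room for a resolvent bound.\<close>
  obtain \<beta> where \<beta>: "\<alpha>0 1 < \<beta>" "\<beta> < \<gamma> 1" using dense \<gamma> by blast
  obtain \<alpha> where \<alpha>: "\<alpha>0 1 < \<alpha>" "\<alpha> < \<beta>" using dense \<beta> by blast
  obtain C where C: "resolvent_bound \<alpha> C T" using ritt_of_type_resolvent_bound[OF T \<alpha>(1)] \<alpha> \<beta> \<gamma> by auto
  have c: "stolz_calculus 1 (\<lambda>_. T) (\<lambda>_. \<alpha>) (\<lambda>_. \<beta>) \<gamma> (\<lambda>_. C)"
    by (rule stolz_calculus_single) (use C \<alpha> \<beta> \<gamma> in auto)
  have calc': "norm (joint_calculus 1 (\<lambda>_. \<beta>) (\<lambda>_. T) \<phi>) \<le> D * (SUP z\<in>stolz_prod 1 \<gamma>. cmod (\<phi> z))"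
    if "\<phi> \<in> H0_infty 1 \<gamma>" for \<phi>
    by (rule calc[OF that]) (use \<beta> in auto)
  note poly = calculus_polynomial_bound[OF c less_imp_le[OF D] calc']
  have \<gamma>': "\<gamma> 1 \<in> {0<..<pi/2}" using a0 \<gamma> by auto
  \<comment> \<open>The condensed sum gives \<open>2 cmod (1 - z) / (1 - cmod z)\<close>, and the
    Stolz estimate contributes another \<open>2 / (1 - sin \<gamma>)\<close>.\<close>
  define B where "B = 4 / (1 - sin (\<gamma> 1))"
  have s1: "0 < 1 - sin (\<gamma> 1)" using sin_angle[OF \<gamma>'] by simp
  \<comment> \<open>\<open>I - T^n\<close> is the telescoping sum of the differences, and
    \<open>1 - z^n\<close> is bounded by 2 on the domain.\<close>
  have pow: "norm (opow T n) \<le> 1 + D * 2" for n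
  proof -
    have tele: "(\<Sum>j<n. (1::real) *\<^sub>R pdiff T j) = id_blinfun - opow T n"
    proof (induction n)
      case (Suc n)
      then show ?case
        by (intro blinfun_eqI) (simp add: blinfun.add_left blinfun.diff_left pdiff_apply')
    qed simp
    have "norm (\<Sum>j<n. (1::real) *\<^sub>R pdiff T j) \<le> D * 2"
    proof (rule poly)
      fix z assume z: "z \<in> stolz (\<gamma> 1)"
      have "(\<Sum>j<n. of_real 1 * (z ^ j * (1 - z))) = 1 - z ^ n"
        by (induction n) (simp_all add: algebra_simps)
      moreover have "cmod (z ^ n) \<le> 1"
        unfolding norm_power using cmod_less_one_stolz[OF z \<gamma>'] by (intro power_le_one) auto
      ultimately show "cmod (\<Sum>j<n. of_real 1 * (z ^ j * (1 - z))) \<le> 2"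
        using norm_triangle_ineq4[of 1 "z ^ n"] by simp
    qed
    then have "norm (id_blinfun - opow T n) \<le> D * 2" unfolding tele .
    moreover have "norm (opow T n) \<le> norm (id_blinfun :: 'a \<Rightarrow>\<^sub>L 'a) + norm (id_blinfun - opow T n)"
      using norm_triangle_ineq4[of id_blinfun "id_blinfun - opow T n"] by simp
    ultimately show ?thesis using norm_blinfun_id_le[where 'a = 'a] by linarith
  qed
  have signs: "norm (\<Sum>j<N. \<epsilon> j *\<^sub>R ((2 ^ j) *\<^sub>R pdiff T (2 ^ j))) \<le> D * B"
    if \<epsilon>: "\<And>j. \<epsilon> j \<in> {1, - 1 :: real}" for \<epsilon> N
  proof -
    have "norm (\<Sum>j<N. (\<epsilon> j * 2 ^ j) *\<^sub>R pdiff T (2 ^ j)) \<le> D * B"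
    proof (rule poly)
      fix z assume z: "z \<in> stolz (\<gamma> 1)"
      have z1: "cmod z < 1" by (rule cmod_less_one_stolz[OF z \<gamma>'])
      have zc: "z \<in> closure (stolz (\<gamma> 1))" using z closure_subset by blast
      have "cmod (\<Sum>j<N. of_real (\<epsilon> j * 2 ^ j) * (z ^ (2 ^ j) * (1 - z)))
          \<le> (\<Sum>j<N. 2 ^ j * cmod z ^ (2 ^ j) * cmod (1 - z))"
      proof (rule sum_norm_le)
        fix j
        have "\<bar>\<epsilon> j\<bar> = 1" using \<epsilon>[of j] by auto
        then show "cmod (of_real (\<epsilon> j * 2 ^ j) * (z ^ (2 ^ j) * (1 - z))) \<le> 2 ^ j * cmod z ^ (2 ^ j) * cmod (1 - z)"
          unfolding norm_mult norm_of_real norm_power abs_mult by simp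
      qed
      also have "\<dots> = (\<Sum>j<N. 2 ^ j * cmod z ^ (2 ^ j)) * cmod (1 - z)" by (simp only: sum_distrib_right)
      also have "\<dots> \<le> 2 / (1 - cmod z) * cmod (1 - z)"
        by (intro mult_right_mono dyadic_power_sum_le z1) auto
      also have "\<dots> \<le> B"
        using stolz_estimate[OF zc \<gamma>'] z1 s1 by (simp add: B_def field_simps)
      finally show "cmod (\<Sum>j<N. of_real (\<epsilon> j * 2 ^ j) * (z ^ (2 ^ j) * (1 - z))) \<le> B" .
    qed
    then show ?thesis by simp
  qed
  \<comment> \<open>The signs are real, so these sums are adjoints of the previous ones and have the
    same norms.\<close>
  have signs': "norm (\<Sum>j<N. \<epsilon> j *\<^sub>R ((2 ^ j) *\<^sub>R pdiff (adj T) (2 ^ j))) \<le> D * B"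
    if \<epsilon>: "\<And>j. \<epsilon> j \<in> {1, - 1 :: real}" for \<epsilon> N
  proof -
    define A where "A = (\<Sum>j<N. \<epsilon> j *\<^sub>R ((2 ^ j) *\<^sub>R pdiff T (2 ^ j)))"
    have A: "A \<in> bounded_ops" unfolding A_def by (intro sum_in_bounded_ops scaleR_in_bounded_ops pdiff_in_bounded_ops Tb)
    have "adj A = (\<Sum>j<N. \<epsilon> j *\<^sub>R ((2 ^ j) *\<^sub>R pdiff (adj T) (2 ^ j)))"
      by (rule adj_eqI[OF A]) (simp add: A_def blinfun.sum_left blinfun.scaleR_left cinner.sum_left
          cinner.sum_right cinner.scaleR_left cinner.scaleR_right cinner_adj[OF pdiff_in_bounded_ops[OF Tb]] adj_pdiff[OF Tb])
    then show ?thesis using signs[of \<epsilon> N, OF \<epsilon>] norm_adj[OF A] by (simp add: A_def)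
  qed
  have pow': "norm (opow (adj T) n) \<le> 1 + D * 2" for n
    using pow[of n] by (simp add: adj_opow[OF Tb, symmetric] norm_adj Tb)
  note sq = dyadic_square_function[OF pow signed_sums_square_function[OF signs]]
    and sq' = dyadic_square_function[OF pow' signed_sums_square_function[OF signs']]
  show ?thesis by (rule square_opI[OF Tb pow sq sq'])
qed

section \<open>Joint calculus from square functions\<close>

text \<open>The binomial coefficient of \<open>k + 2\<close> over 2, that is, the coefficient of
  \<open>w^k\<close> in \<open>(1 - w)^-3\<close>.\<close>

definition approx_weight :: "nat \<Rightarrow> real"
  where "approx_weight k = real (Suc k) * real (Suc (Suc k)) / 2"

text \<open>With \<open>w = z\<^sup>3\<close> the sum \<open>\<Sum>\<^sub>k (k+1)(k+2)/2 w\<^sup>k (1 - w)\<^sup>3\<close> is an approximate unit. The factor \<open>z\<^sup>3\<^sup>k (1 - z)\<^sup>3\<close>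
  can be split into three equal pieces: one stays in the contour integral and gains \<open>1/(k+1)\<close>, the other
  two go to the square functions of the operator and of its adjoint.\<close>

definition approx_unit :: "nat \<Rightarrow> complex \<Rightarrow> complex"
  where "approx_unit N z = (\<Sum>k<N. of_real (approx_weight k) * z ^ (3 * k) * (1 - z) ^ 3 * (1 + z + z\<^sup>2) ^ 3)"

text \<open>The truncated binomial series with its exact remainder. The general ring serves two
  purposes: \<open>w = z^3\<close> for convergence and \<open>w = cmod z\<close> for the uniform
  bound.\<close>

lemma approx_weight_sum:
  fixes w :: "'b::{comm_ring_1,real_algebra_1}"
  shows "(1 - w) ^ 3 * (\<Sum>k<N. of_real (approx_weight k) * w ^ k)
    = 1 - w ^ N * (1 + of_nat N * (1 - w) + of_real (real N * real (Suc N) / 2) * (1 - w)\<^sup>2)"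
proof (induction N)
  case (Suc N)
  define h :: 'b where "h = of_real (real N * real (Suc N) / 2)"
  have h1: "of_real (approx_weight N) = h + of_nat (Suc N)"
  proof -
    have "approx_weight N = real N * real (Suc N) / 2 + real (Suc N)" by (simp add: approx_weight_def field_simps)
    then show ?thesis by (simp only: h_def of_real_add of_real_of_nat_eq)
  qed
  have h2: "of_real (real (Suc N) * real (Suc (Suc N)) / 2) = h + of_nat (Suc N)"
    using h1 by (simp add: approx_weight_def)
  have "(1 - w) ^ 3 * (\<Sum>k<Suc N. of_real (approx_weight k) * w ^ k)
      = 1 - w ^ N * (1 + of_nat N * (1 - w) + h * (1 - w)\<^sup>2) + (1 - w) ^ 3 * ((h + of_nat (Suc N)) * w ^ N)"
    by (simp only: sum.lessThan_Suc distrib_left[of "(1 - w) ^ 3"] Suc h1 h_def[symmetric])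
  also have "\<dots> = 1 - w ^ Suc N * (1 + of_nat (Suc N) * (1 - w) + (h + of_nat (Suc N)) * (1 - w)\<^sup>2)"
  proof -
    have "v - a * (1 + n * u + h * u\<^sup>2) + u ^ 3 * ((h + (1 + n)) * a)
        = v - (1 - u) * a * (1 + (1 + n) * u + (h + (1 + n)) * u\<^sup>2)" for a n u v :: 'b
      by (simp add: power2_eq_square power3_eq_cube algebra_simps)
    from this[of 1 "w ^ N" "of_nat N" "1 - w"] show ?thesis by (simp only: of_nat_Suc power_Suc diff_diff_eq2 add_diff_cancel_left')
  qed
  finally show ?case unfolding h2 .
qed simp

lemma approx_unit_eq: "approx_unit N z = (1 - z ^ 3) ^ 3 * (\<Sum>k<N. of_real (approx_weight k) * (z ^ 3) ^ k)"
proof -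
  have e: "(1 - z) ^ 3 * (1 + z + z\<^sup>2) ^ 3 = (1 - z ^ 3) ^ 3"
    unfolding power_mult_distrib[symmetric]
    by (rule arg_cong[of _ _ "\<lambda>v. v ^ 3"]) (simp add: power2_eq_square power3_eq_cube algebra_simps)
  show ?thesis
    unfolding approx_unit_def sum_distrib_left power_mult[symmetric] e[symmetric] by (simp only: mult_ac)
qed

lemma approx_unit_tendsto:
  assumes z: "cmod z < 1"
  shows "(\<lambda>N. approx_unit N z) \<longlonglongrightarrow> 1"
proof -
  define w where "w = z ^ 3"
  have w: "cmod w < 1" unfolding w_def norm_power using z by (simp add: power_less_one_iff)
  have b: "norm (w ^ N * (1 + of_nat N * (1 - w) + of_real (real N * real (Suc N) / 2) * (1 - w)\<^sup>2))
      \<le> cmod w ^ N * (1 + real N * 2 + real N * real (Suc N) / 2 * 4)" for N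
  proof -
    have 2: "cmod (1 - w) \<le> 2" using norm_triangle_ineq4[of 1 w] w by simp
    have 4: "cmod ((1 - w)\<^sup>2) \<le> 4" unfolding norm_power using power_mono[OF 2, of 2] by simp
    have "cmod (1 + of_nat N * (1 - w) + of_real (real N * real (Suc N) / 2) * (1 - w)\<^sup>2)
        \<le> 1 + real N * 2 + real N * real (Suc N) / 2 * 4"
    proof (intro norm_triangle_mono)
      show "cmod (of_nat N * (1 - w)) \<le> real N * 2" unfolding norm_mult using 2 by (simp add: mult_left_mono)
      show "cmod (of_real (real N * real (Suc N) / 2) * (1 - w)\<^sup>2) \<le> real N * real (Suc N) / 2 * 4"
        unfolding norm_mult norm_of_real by (intro mult_mono 4) auto
    qed simp
    then show ?thesis unfolding norm_mult norm_power by (intro mult_left_mono) auto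
  qed
  have "(\<lambda>N. cmod w ^ N * (1 + real N * 2 + real N * real (Suc N) / 2 * 4)) \<longlonglongrightarrow> 0"
  proof (cases "w = 0")
    case True
    have "\<forall>\<^sub>F N in sequentially. cmod w ^ N * (1 + real N * 2 + real N * real (Suc N) / 2 * 4) = 0"
      using eventually_gt_at_top[of "0::nat"] by eventually_elim (simp add: True)
    then show ?thesis by (rule tendsto_eventually)
  next
    case False
    then have "0 < cmod w" by simp
    then show ?thesis using w by real_asymp
  qed
  then have "(\<lambda>N. w ^ N * (1 + of_nat N * (1 - w) + of_real (real N * real (Suc N) / 2) * (1 - w)\<^sup>2)) \<longlonglongrightarrow> 0"
    by (rule Lim_null_comparison[OF always_eventually[OF allI[OF b]]])
  from tendsto_diff[OF tendsto_const[of 1] this] show ?thesis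
    unfolding approx_unit_eq w_def[symmetric] approx_weight_sum by simp
qed

text \<open>The Stolz estimate replaces \<open>(1 - z)^3\<close> by a multiple of
  \<open>(1 - r)^3\<close> with \<open>r = cmod z\<close>. Since \<open>r^(3k) <= r^k\<close>, the
  positive series left over has partial sums at most one. The 27 bounds
  \<open>(1 + z + z^2)^3\<close>.\<close>

lemma cmod_approx_unit_le:
  assumes z: "z \<in> stolz \<gamma>" and \<gamma>: "\<gamma> \<in> {0<..<pi/2}"
  shows "cmod (approx_unit N z) \<le> 27 * (2 / (1 - sin \<gamma>)) ^ 3"
proof -
  define r where "r = cmod z"
  have r: "0 \<le> r" "r < 1" using cmod_less_one_stolz[OF z \<gamma>] by (simp_all add: r_def)
  have s: "0 < 1 - sin \<gamma>" using sin_angle[OF \<gamma>] by simp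
  have zc: "z \<in> closure (stolz \<gamma>)" using z closure_subset by blast
  have q: "cmod (1 - z) \<le> 2 / (1 - sin \<gamma>) * (1 - r)"
    using stolz_estimate[OF zc \<gamma>] s by (simp add: r_def field_simps)
  have W0: "0 \<le> approx_weight k" for k by (simp add: approx_weight_def)
  have sum0: "0 \<le> (\<Sum>k<N. approx_weight k * r ^ k)" using W0 r by (intro sum_nonneg mult_nonneg_nonneg) auto
  have "(1 - r) ^ 3 * (\<Sum>k<N. approx_weight k * r ^ k)
    = 1 - r ^ N * (1 + real N * (1 - r) + (real N * real (Suc N) / 2) * (1 - r)\<^sup>2)"
    using approx_weight_sum[of r N] by simp
  also have "\<dots> \<le> 1" using r by simp
  finally have S: "(1 - r) ^ 3 * (\<Sum>k<N. approx_weight k * r ^ k) \<le> 1" .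
  have z3: "cmod (1 + z + z\<^sup>2) \<le> 3"
  proof -
    have "cmod (z\<^sup>2) \<le> 1" unfolding norm_power using r by (intro power_le_one) (auto simp: r_def)
    then have "cmod (1 + z + z\<^sup>2) \<le> 1 + 1 + 1" using r by (intro norm_triangle_mono) (auto simp: r_def)
    then show ?thesis by simp
  qed
  have "cmod (approx_unit N z) \<le> (\<Sum>k<N. approx_weight k * r ^ k * (2 / (1 - sin \<gamma>) * (1 - r)) ^ 3 * 3 ^ 3)"
    unfolding approx_unit_def
  proof (rule sum_norm_le)
    fix k
    have "r ^ (3 * k) \<le> r ^ k" using r by (intro power_decreasing) auto
    then show "cmod (of_real (approx_weight k) * z ^ (3 * k) * (1 - z) ^ 3 * (1 + z + z\<^sup>2) ^ 3)
        \<le> approx_weight k * r ^ k * (2 / (1 - sin \<gamma>) * (1 - r)) ^ 3 * 3 ^ 3"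
      unfolding norm_mult norm_power norm_of_real r_def[symmetric] using W0[of k] r s
      by (intro mult_mono power_mono q z3) (auto intro!: mult_nonneg_nonneg)
  qed
  also have "\<dots> = 27 * (2 / (1 - sin \<gamma>)) ^ 3 * ((1 - r) ^ 3 * (\<Sum>k<N. approx_weight k * r ^ k))"
    unfolding sum_distrib_right[symmetric] power_mult_distrib by simp
  also have "\<dots> \<le> 27 * (2 / (1 - sin \<gamma>)) ^ 3 * 1"
    using s by (intro mult_left_mono S) auto
  finally show ?thesis by simp
qed

lemma approx_unit_holomorphic: "approx_unit N holomorphic_on S"
  unfolding approx_unit_def by (intro holomorphic_intros)

section \<open>Square functions over multi-indices\<close>

fun pdiff_list :: "nat list \<Rightarrow> (nat \<Rightarrow> nat) \<Rightarrow> (nat \<Rightarrow> 'a::complex_hilbert_space \<Rightarrow>\<^sub>L 'a) \<Rightarrow> 'a \<Rightarrow> 'a"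
  where "pdiff_list [] k T x = x"
  | "pdiff_list (i # is) k T x = pdiff (T i) (k i) (pdiff_list is k T x)"

lemma pdiff_list_cong: "(\<And>i. i \<in> set is \<Longrightarrow> k i = l i) \<Longrightarrow> pdiff_list is k T x = pdiff_list is l T x"
  by (induction "is") auto

text \<open>Summing over the index of the outermost operator first costs \<open>(M i)^2\<close> and
  leaves the same sum for the rest of the list.\<close>

lemma pdiff_list_square_function:
  assumes "distinct is" and M: "\<And>i. i \<in> set is \<Longrightarrow> square_function_bounded (M i) (T i)"
  shows "(\<Sum>k\<in>(\<Pi>\<^sub>E i\<in>set is. {..<N}). (\<Prod>i\<in>set is. real (Suc (k i))) * (norm (pdiff_list is k T x))\<^sup>2)
    \<le> (\<Prod>i\<in>set is. (M i)\<^sup>2) * (norm x)\<^sup>2"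
  using assms
proof (induction "is")
  case (Cons i "is")
  have i: "i \<notin> set is" using Cons.prems by auto
  let ?P = "\<Pi>\<^sub>E i\<in>set is. {..<N}"
  have "(\<Sum>k\<in>(\<Pi>\<^sub>E i\<in>set (i # is). {..<N}). (\<Prod>i\<in>set (i # is). real (Suc (k i))) * (norm (pdiff_list (i # is) k T x))\<^sup>2)
      = (\<Sum>(j, k)\<in>{..<N} \<times> ?P. (\<Prod>l\<in>set (i # is). real (Suc ((k(i := j)) l))) * (norm (pdiff_list (i # is) (k(i := j)) T x))\<^sup>2)"
    unfolding list.set PiE_insert_eq
    by (subst sum.reindex[OF inj_combinator[OF i]]) (simp add: case_prod_unfold comp_def)
  also have "\<dots> = (\<Sum>j<N. \<Sum>k\<in>?P. (\<Prod>l\<in>set is. real (Suc (k l))) * (real (Suc j) * (norm (pdiff (T i) j (pdiff_list is k T x)))\<^sup>2))"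
    unfolding sum.cartesian_product[symmetric]
  proof (intro sum.cong refl)
    fix j k
    have "(\<Prod>l\<in>set is. real (Suc ((k(i := j)) l))) = (\<Prod>l\<in>set is. real (Suc (k l)))"
      by (rule prod.cong) (use i in auto)
    moreover have "pdiff_list is (k(i := j)) T x = pdiff_list is k T x"
      by (rule pdiff_list_cong) (use i in auto)
    ultimately show "(\<Prod>l\<in>set (i # is). real (Suc ((k(i := j)) l))) * (norm (pdiff_list (i # is) (k(i := j)) T x))\<^sup>2
        = (\<Prod>l\<in>set is. real (Suc (k l))) * (real (Suc j) * (norm (pdiff (T i) j (pdiff_list is k T x)))\<^sup>2)"
      using i by simp
  qed
  also have "\<dots> = (\<Sum>k\<in>?P. (\<Prod>l\<in>set is. real (Suc (k l))) * (\<Sum>j<N. real (Suc j) * (norm (pdiff (T i) j (pdiff_list is k T x)))\<^sup>2))"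
    by (subst sum.swap) (simp only: sum_distrib_left)
  also have "\<dots> \<le> (\<Sum>k\<in>?P. (\<Prod>l\<in>set is. real (Suc (k l))) * ((M i)\<^sup>2 * (norm (pdiff_list is k T x))\<^sup>2))"
    using Cons.prems(2)[of i] unfolding square_function_bounded_def
    by (intro sum_mono mult_left_mono prod_nonneg) auto
  also have "\<dots> = (M i)\<^sup>2 * (\<Sum>k\<in>?P. (\<Prod>l\<in>set is. real (Suc (k l))) * (norm (pdiff_list is k T x))\<^sup>2)"
    unfolding sum_distrib_left by (simp only: mult_ac)
  also have "\<dots> \<le> (M i)\<^sup>2 * ((\<Prod>i\<in>set is. (M i)\<^sup>2) * (norm x)\<^sup>2)"
    using Cons by (intro mult_left_mono Cons.IH) auto
  finally show ?case using i by (simp add: mult.assoc)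
qed simp

context stolz_calculus
begin

text \<open>The resolvents commute with \<open>T i\<close>, so the difference can be pulled out to
  the left of them and passed to the second argument.\<close>

lemma form_adj:
  assumes i: "i \<in> {1..m}"
  shows "form \<phi> (pdiff (T i) k x) y = form \<phi> x (pdiff (adj (T i)) k y)"
  unfolding form_def
proof (rule Bochner_Integration.integral_cong[OF refl])
  fix t assume t: "t \<in> space cube"
  have set_upt: "set [1..<Suc m] = {1..m}" by auto
  have "resolvent_prod m (curve t) T (T i u) = T i (resolvent_prod m (curve t) T u)" for u
    unfolding resolvent_prod_list
    by (rule T_resolvent_list[of "[1..<Suc m]" i "curve t" u, unfolded set_upt, OF subset_refl i curve_notin_closure[OF t]])
  then have "resolvent_prod m (curve t) T (pdiff (T i) k x) = pdiff (T i) k (resolvent_prod m (curve t) T x)"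
    by (intro pdiff_commute_apply T_bounded_ops i blinfun.bounded_linear_right)
  then show "\<phi> (curve t) * velocity t * cinner (resolvent_prod m (curve t) T (pdiff (T i) k x)) y
      = \<phi> (curve t) * velocity t * cinner (resolvent_prod m (curve t) T x) (pdiff (adj (T i)) k y)"
    by (simp add: cinner_adj[OF pdiff_in_bounded_ops[OF T_bounded_ops[OF i]]] adj_pdiff[OF T_bounded_ops[OF i]])
qed

lemma H0_infty_times_pdiff:
  assumes "\<phi> \<in> H0_infty m \<gamma>" and "i \<in> {1..m}"
  shows "(\<lambda>z. \<phi> z * (z i ^ k * (1 - z i))) \<in> H0_infty m \<gamma>"
  using H0_infty_times_coordinate(3)[OF H0_infty_times_coordinate(2)[OF assms, of k] assms(2)]
  by (simp only: mult.assoc)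

text \<open>The statements are proved together with \<phi> arbitrary: each step absorbs one factor
  into \<phi>, and the enlarged function must again be admissible.\<close>

lemma form_pdiff_list:
  assumes "\<phi> \<in> H0_infty m \<gamma>" "distinct is" "set is \<subseteq> {1..m}"
  shows "form \<phi> (pdiff_list is k T x) y = form (\<lambda>z. \<phi> z * (\<Prod>i\<in>set is. z i ^ k i * (1 - z i))) x y"
    and "form \<phi> x (pdiff_list is k (\<lambda>i. adj (T i)) y) = form (\<lambda>z. \<phi> z * (\<Prod>i\<in>set is. z i ^ k i * (1 - z i))) x y"
    and "(\<lambda>z. \<phi> z * (\<Prod>i\<in>set is. z i ^ k i * (1 - z i))) \<in> H0_infty m \<gamma>"
proof -
  have "form \<phi> (pdiff_list is k T x) y = form (\<lambda>z. \<phi> z * (\<Prod>i\<in>set is. z i ^ k i * (1 - z i))) x y \<and>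
    form \<phi> x (pdiff_list is k (\<lambda>i. adj (T i)) y) = form (\<lambda>z. \<phi> z * (\<Prod>i\<in>set is. z i ^ k i * (1 - z i))) x y \<and>
    (\<lambda>z. \<phi> z * (\<Prod>i\<in>set is. z i ^ k i * (1 - z i))) \<in> H0_infty m \<gamma>"
    using assms
  proof (induction "is" arbitrary: \<phi>)
    case (Cons i "is")
    have i: "i \<in> {1..m}" and i': "i \<notin> set is" using Cons.prems by auto
    let ?\<psi> = "\<lambda>z. \<phi> z * (z i ^ k i * (1 - z i))"
    have H: "?\<psi> \<in> H0_infty m \<gamma>" by (rule H0_infty_times_pdiff[OF Cons.prems(1) i])
    have IH: "form ?\<psi> (pdiff_list is k T x) y = form (\<lambda>z. ?\<psi> z * (\<Prod>i\<in>set is. z i ^ k i * (1 - z i))) x y"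
      "form ?\<psi> x (pdiff_list is k (\<lambda>i. adj (T i)) y) = form (\<lambda>z. ?\<psi> z * (\<Prod>i\<in>set is. z i ^ k i * (1 - z i))) x y"
      "(\<lambda>z. ?\<psi> z * (\<Prod>i\<in>set is. z i ^ k i * (1 - z i))) \<in> H0_infty m \<gamma>"
      using Cons.IH[OF H] Cons.prems by auto
    have eq: "(\<lambda>z. \<phi> z * (\<Prod>i\<in>set (i # is). z i ^ k i * (1 - z i))) = (\<lambda>z. ?\<psi> z * (\<Prod>i\<in>set is. z i ^ k i * (1 - z i)))"
      using i' by (simp add: fun_eq_iff mult.assoc)
    show ?case
      unfolding eq pdiff_list.simps form_adj[OF i, symmetric] form_pdiff[OF Cons.prems(1) i]
      using IH by blast
  qed simp
  then show "form \<phi> (pdiff_list is k T x) y = form (\<lambda>z. \<phi> z * (\<Prod>i\<in>set is. z i ^ k i * (1 - z i))) x y"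
    "form \<phi> x (pdiff_list is k (\<lambda>i. adj (T i)) y) = form (\<lambda>z. \<phi> z * (\<Prod>i\<in>set is. z i ^ k i * (1 - z i))) x y"
    "(\<lambda>z. \<phi> z * (\<Prod>i\<in>set is. z i ^ k i * (1 - z i))) \<in> H0_infty m \<gamma>" by auto
qed

text \<open>With \<open>p\<close> the product of the \<open>z i ^ k i * (1 - z i)\<close>, the term
  is \<open>\<psi> p p p\<close>. One \<open>p\<close> goes to \<open>x\<close>, one to
  \<open>y\<close>, and \<open>form_bound\<close> uses the third. The weight is at most
  \<open>(k i + 1)^2\<close> and the integral cancels one power, leaving exactly the square function
  weight. The constant is \<open>1728 = 27 * 64\<close>.\<close>

lemma form_approx_term_bound:
  assumes \<phi>: "\<phi> \<in> H0_infty m \<gamma>" and B: "0 \<le> B" "\<And>z. z \<in> stolz_prod m \<gamma> \<Longrightarrow> cmod (\<phi> z) \<le> B"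
  shows "(\<lambda>z. \<phi> z * (\<Prod>i=1..m. of_real (approx_weight (k i)) * z i ^ (3 * k i) * (1 - z i) ^ 3 * (1 + z i + (z i)\<^sup>2) ^ 3)) \<in> H0_infty m \<gamma>"
    and "cmod (form (\<lambda>z. \<phi> z * (\<Prod>i=1..m. of_real (approx_weight (k i)) * z i ^ (3 * k i) * (1 - z i) ^ 3 * (1 + z i + (z i)\<^sup>2) ^ 3)) x y)
      \<le> B * (\<Prod>i=1..m. 1728 * C i / (1 - sin (\<gamma> i))) * ((\<Prod>i=1..m. real (Suc (k i))) *
        (norm (pdiff_list [1..<Suc m] k T x) * norm (pdiff_list [1..<Suc m] k (\<lambda>i. adj (T i)) y)))"
proof -
  have set_upt: "set [1..<Suc m] = {1..m}" by auto
  have z1: "cmod (z i) \<le> 1" if "z \<in> stolz_prod m \<gamma>" "i \<in> {1..m}" for z i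
    using stolz_prod_cmod_less[OF that] by simp
  have W: "0 \<le> approx_weight j" "approx_weight j \<le> real (Suc j) * real (Suc j)" for j
    by (simp_all add: approx_weight_def field_simps)
  define b where "b z = (\<Prod>i=1..m. of_real (approx_weight (k i)) * (1 + z i + (z i)\<^sup>2) ^ 3)" for z :: "nat \<Rightarrow> complex"
  define p where "p z = (\<Prod>i=1..m. z i ^ k i * (1 - z i))" for z :: "nat \<Rightarrow> complex"
  have b_le: "cmod (b z) \<le> (\<Prod>i=1..m. approx_weight (k i) * 27)" if z: "z \<in> stolz_prod m \<gamma>" for z
    unfolding b_def prod_norm[symmetric]
  proof (intro prod_mono conjI)
    fix i assume i: "i \<in> {1..m}"
    have "cmod ((z i)\<^sup>2) \<le> 1" unfolding norm_power by (intro power_le_one z1[OF z i]) simp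
    then have "cmod (1 + z i + (z i)\<^sup>2) \<le> 1 + 1 + 1" using z1[OF z i] by (intro norm_triangle_mono) auto
    then have "cmod (1 + z i + (z i)\<^sup>2) ^ 3 \<le> 3 ^ 3" by (intro power_mono) auto
    then show "cmod (of_real (approx_weight (k i)) * (1 + z i + (z i)\<^sup>2) ^ 3) \<le> approx_weight (k i) * 27"
      unfolding norm_mult norm_power norm_of_real using W(1)[of "k i"] by (intro mult_mono) auto
  qed simp
  have b_hol: "holomorphic_on_stolz_prod b m \<gamma>"
    unfolding b_def
  proof (rule holomorphic_on_stolz_prod_prod)
    fix i assume i: "i \<in> {1..m}"
    show "holomorphic_on_stolz_prod (\<lambda>z. of_real (approx_weight (k i)) * (1 + z i + (z i)\<^sup>2) ^ 3) m \<gamma>"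
      by (rule holomorphic_on_stolz_prod_coordinate[where g = "\<lambda>z. of_real (approx_weight (k i)) * (1 + z + z\<^sup>2) ^ 3", OF _ i])
        (intro holomorphic_intros)
  qed
  define \<psi> where "\<psi> z = \<phi> z * b z" for z
  have \<psi>: "\<psi> \<in> H0_infty m \<gamma>" unfolding \<psi>_def by (rule H0_infty_mult[OF \<phi> b_hol b_le])
  have H: "(\<lambda>z. \<eta> z * p z) \<in> H0_infty m \<gamma>" if "\<eta> \<in> H0_infty m \<gamma>" for \<eta>
    using form_pdiff_list(3)[OF that distinct_upt, of 1 "Suc m"] unfolding set_upt p_def by simp
  have FX: "form \<eta> (pdiff_list [1..<Suc m] k T u) v = form (\<lambda>z. \<eta> z * p z) u v" if "\<eta> \<in> H0_infty m \<gamma>" for \<eta> u v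
    using form_pdiff_list(1)[OF that distinct_upt, of 1 "Suc m"] unfolding set_upt p_def by simp
  have FY: "form \<eta> u (pdiff_list [1..<Suc m] k (\<lambda>i. adj (T i)) v) = form (\<lambda>z. \<eta> z * p z) u v" if "\<eta> \<in> H0_infty m \<gamma>" for \<eta> u v
    using form_pdiff_list(2)[OF that distinct_upt, of 1 "Suc m"] unfolding set_upt p_def by simp
  let ?X = "pdiff_list [1..<Suc m] k T x" and ?Y = "pdiff_list [1..<Suc m] k (\<lambda>i. adj (T i)) y"
  have eq: "(\<lambda>z. \<phi> z * (\<Prod>i=1..m. of_real (approx_weight (k i)) * z i ^ (3 * k i) * (1 - z i) ^ 3 * (1 + z i + (z i)\<^sup>2) ^ 3))
      = (\<lambda>z. \<psi> z * p z * p z * p z)"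
  proof
    fix z :: "nat \<Rightarrow> complex"
    have "of_real (approx_weight (k i)) * z i ^ (3 * k i) * (1 - z i) ^ 3 * (1 + z i + (z i)\<^sup>2) ^ 3
        = (of_real (approx_weight (k i)) * (1 + z i + (z i)\<^sup>2) ^ 3) * (z i ^ k i * (1 - z i)) * (z i ^ k i * (1 - z i)) * (z i ^ k i * (1 - z i))" for i
    proof -
      have p: "z i ^ (3 * k i) = z i ^ k i * z i ^ k i * z i ^ k i"
        by (simp add: power_mult power3_eq_cube mult.commute[of 3])
      have "w * (a * a * a) * q ^ 3 * c = w * c * (a * q) * (a * q) * (a * q)" for w a q c :: complex
        by (simp add: power3_eq_cube)
      then show ?thesis unfolding p .
    qed
    then show "\<phi> z * (\<Prod>i=1..m. of_real (approx_weight (k i)) * z i ^ (3 * k i) * (1 - z i) ^ 3 * (1 + z i + (z i)\<^sup>2) ^ 3)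
        = \<psi> z * p z * p z * p z"
      unfolding \<psi>_def b_def p_def by (simp only: prod.distrib mult.assoc)
  qed
  show "(\<lambda>z. \<phi> z * (\<Prod>i=1..m. of_real (approx_weight (k i)) * z i ^ (3 * k i) * (1 - z i) ^ 3 * (1 + z i + (z i)\<^sup>2) ^ 3)) \<in> H0_infty m \<gamma>"
    unfolding eq by (intro H \<psi>)
  have "form (\<lambda>z. \<psi> z * p z * p z * p z) x y = form (\<lambda>z. \<psi> z * p z) ?X ?Y"
    by (simp only: FX[OF H[OF \<psi>]] FY[OF H[OF H[OF \<psi>]]])
  also have "cmod \<dots> \<le> (B * (\<Prod>i=1..m. approx_weight (k i) * 27)) *
      (\<Prod>i=1..m. 64 * C i / ((1 - sin (\<gamma> i)) * real (Suc (k i)))) * norm ?X * norm ?Y"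
  proof (rule form_bound[OF H[OF \<psi>]])
    show "0 \<le> B * (\<Prod>i=1..m. approx_weight (k i) * 27)" using B(1) W(1) by (intro mult_nonneg_nonneg prod_nonneg) auto
    fix z assume z: "z \<in> stolz_prod m \<gamma>"
    have "cmod (\<psi> z * p z) \<le> (B * (\<Prod>i=1..m. approx_weight (k i) * 27)) * cmod (p z)"
      unfolding \<psi>_def norm_mult using B b_le[OF z] z W(1) by (intro mult_right_mono mult_mono) (auto intro!: prod_nonneg)
    then show "cmod (\<psi> z * p z) \<le> (B * (\<Prod>i=1..m. approx_weight (k i) * 27)) * (\<Prod>i=1..m. cmod (z i) ^ k i * cmod (1 - z i))"
      by (simp add: p_def prod_norm[symmetric] norm_mult norm_power)
  qed
  also have "\<dots> = B * (\<Prod>i=1..m. (approx_weight (k i) * 27) * (64 * C i / ((1 - sin (\<gamma> i)) * real (Suc (k i))))) * (norm ?X * norm ?Y)"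
    unfolding prod.distrib[of "\<lambda>i. approx_weight (k i) * 27"] by (simp only: mult.assoc)
  also have "\<dots> \<le> B * (\<Prod>i=1..m. (1728 * C i / (1 - sin (\<gamma> i))) * real (Suc (k i))) * (norm ?X * norm ?Y)"
  proof (intro mult_right_mono mult_left_mono prod_mono conjI B(1))
    fix i assume i: "i \<in> {1..m}"
    have s: "0 < 1 - sin (\<gamma> i)" using sin_angle[OF \<gamma>_angle[OF i]] by simp
    have q: "0 \<le> 64 * C i / ((1 - sin (\<gamma> i)) * real (Suc (k i)))"
      using s C_nonneg[OF i] by (intro divide_nonneg_nonneg mult_nonneg_nonneg) auto
    show "0 \<le> approx_weight (k i) * 27 * (64 * C i / ((1 - sin (\<gamma> i)) * real (Suc (k i))))"
      using W(1)[of "k i"] q by (intro mult_nonneg_nonneg) auto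
    have "approx_weight (k i) * 27 * (64 * C i / ((1 - sin (\<gamma> i)) * real (Suc (k i))))
        \<le> (real (Suc (k i)) * real (Suc (k i))) * 27 * (64 * C i / ((1 - sin (\<gamma> i)) * real (Suc (k i))))"
      by (intro mult_right_mono W(2) q) auto
    also have "\<dots> = 1728 * C i / (1 - sin (\<gamma> i)) * real (Suc (k i))"
      by (simp del: of_nat_Suc)
    finally show "approx_weight (k i) * 27 * (64 * C i / ((1 - sin (\<gamma> i)) * real (Suc (k i))))
        \<le> 1728 * C i / (1 - sin (\<gamma> i)) * real (Suc (k i))" .
  qed auto
  finally show "cmod (form (\<lambda>z. \<phi> z * (\<Prod>i=1..m. of_real (approx_weight (k i)) * z i ^ (3 * k i) * (1 - z i) ^ 3 * (1 + z i + (z i)\<^sup>2) ^ 3)) x y)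
      \<le> B * (\<Prod>i=1..m. 1728 * C i / (1 - sin (\<gamma> i))) * ((\<Prod>i=1..m. real (Suc (k i))) * (norm ?X * norm ?Y))"
    unfolding eq prod.distrib[of "\<lambda>i. 1728 * C i / (1 - sin (\<gamma> i))"] by (simp only: mult.assoc)
qed

text \<open>First \<phi> times the approximate unit is bounded uniformly in \<open>N\<close>: expand
  over multi-indices and apply Cauchy-Schwarz. Dominated convergence then removes the unit.\<close>

lemma form_square_function_bound:
  assumes M: "\<And>i. i \<in> {1..m} \<Longrightarrow> square_function_bounded (M i) (T i)"
    and M': "\<And>i. i \<in> {1..m} \<Longrightarrow> square_function_bounded (M i) (adj (T i))"
    and \<phi>: "\<phi> \<in> H0_infty m \<gamma>" and B: "0 \<le> B" "\<And>z. z \<in> stolz_prod m \<gamma> \<Longrightarrow> cmod (\<phi> z) \<le> B"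
  shows "cmod (form \<phi> x y) \<le> B * (\<Prod>i=1..m. 1728 * C i / (1 - sin (\<gamma> i))) * (\<Prod>i=1..m. (M i)\<^sup>2) * norm x * norm y"
proof -
  have set_upt: "set [1..<Suc m] = {1..m}" by auto
  define K where "K = B * (\<Prod>i=1..m. 1728 * C i / (1 - sin (\<gamma> i)))"
  have K0: "0 \<le> K" unfolding K_def
    using B(1) C_nonneg sin_angle[OF \<gamma>_angle] by (intro mult_nonneg_nonneg prod_nonneg ballI divide_nonneg_nonneg) (auto intro: less_imp_le)
  define q where "q k z = (\<Prod>i=1..m. of_real (approx_weight (k i)) * z i ^ (3 * k i) * (1 - z i) ^ 3 * (1 + z i + (z i)\<^sup>2) ^ 3)"
    for k and z :: "nat \<Rightarrow> complex"
  define U where "U N z = (\<Prod>i=1..m. approx_unit N (z i))" for N and z :: "nat \<Rightarrow> complex"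
  let ?P = "\<lambda>N. \<Pi>\<^sub>E i\<in>{1..m}. {..<N::nat}"
  have U_sum: "U N z = (\<Sum>k\<in>?P N. q k z)" for N z
    unfolding U_def q_def approx_unit_def by (rule prod_sum_PiE) auto
  have fin: "finite (?P N)" for N by (intro finite_PiE) auto
  have qH: "(\<lambda>z. \<phi> z * q k z) \<in> H0_infty m \<gamma>" for k
    unfolding q_def by (rule form_approx_term_bound(1)[OF \<phi> B])
  have U_form: "form (\<lambda>z. \<phi> z * U N z) x y = (\<Sum>k\<in>?P N. form (\<lambda>z. \<phi> z * q k z) x y)" for N
    unfolding form_def U_sum sum_distrib_left sum_distrib_right
    by (rule Bochner_Integration.integral_sum) (rule form_integrable[OF qH])
  have U_bound: "cmod (form (\<lambda>z. \<phi> z * U N z) x y) \<le> K * (\<Prod>i=1..m. (M i)\<^sup>2) * norm x * norm y" for N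
  proof -
    define w where "w k = (\<Prod>i=1..m. real (Suc (k i)))" for k :: "nat \<Rightarrow> nat"
    have w0: "0 \<le> w k" for k by (simp add: w_def prod_nonneg)
    define X where "X k = norm (pdiff_list [1..<Suc m] k T x)" for k
    define Y where "Y k = norm (pdiff_list [1..<Suc m] k (\<lambda>i. adj (T i)) y)" for k
    have "cmod (form (\<lambda>z. \<phi> z * U N z) x y) \<le> (\<Sum>k\<in>?P N. K * (w k * (X k * Y k)))"
      unfolding U_form
      by (rule sum_norm_le) (unfold q_def K_def w_def X_def Y_def, rule form_approx_term_bound(2)[OF \<phi> B])
    also have "\<dots> = K * (\<Sum>k\<in>?P N. (sqrt (w k) * X k) * (sqrt (w k) * Y k))"
      unfolding sum_distrib_left
    proof (rule sum.cong[OF refl])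
      fix k
      have "sqrt (w k) * sqrt (w k) = w k" using w0 by simp
      then have "w k * (X k * Y k) = (sqrt (w k) * X k) * (sqrt (w k) * Y k)" by (metis mult.assoc mult.left_commute)
      then show "K * (w k * (X k * Y k)) = K * ((sqrt (w k) * X k) * (sqrt (w k) * Y k))" by simp
    qed
    also have "\<dots> \<le> K * (sqrt (\<Sum>k\<in>?P N. (sqrt (w k) * X k)\<^sup>2) * sqrt (\<Sum>k\<in>?P N. (sqrt (w k) * Y k)\<^sup>2))"
      by (intro mult_left_mono Cauchy_Schwarz_sum_sqrt K0)
    also have "\<dots> \<le> K * (sqrt ((\<Prod>i=1..m. (M i)\<^sup>2) * (norm x)\<^sup>2) * sqrt ((\<Prod>i=1..m. (M i)\<^sup>2) * (norm y)\<^sup>2))"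
    proof (intro mult_left_mono mult_mono real_sqrt_le_mono K0)
      show "(\<Sum>k\<in>?P N. (sqrt (w k) * X k)\<^sup>2) \<le> (\<Prod>i=1..m. (M i)\<^sup>2) * (norm x)\<^sup>2"
        using pdiff_list_square_function[of "[1..<Suc m]" M T x N, unfolded set_upt, OF distinct_upt M]
        unfolding power_mult_distrib real_sqrt_pow2[OF w0] unfolding w_def X_def .
      show "(\<Sum>k\<in>?P N. (sqrt (w k) * Y k)\<^sup>2) \<le> (\<Prod>i=1..m. (M i)\<^sup>2) * (norm y)\<^sup>2"
        using pdiff_list_square_function[of "[1..<Suc m]" M "\<lambda>i. adj (T i)" y N, unfolded set_upt, OF distinct_upt M']
        unfolding power_mult_distrib real_sqrt_pow2[OF w0] unfolding w_def Y_def .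
    qed (auto intro!: sum_nonneg mult_nonneg_nonneg prod_nonneg)
    also have "\<dots> = K * (\<Prod>i=1..m. (M i)\<^sup>2) * norm x * norm y"
    proof -
      have "sqrt (p * a\<^sup>2) * sqrt (p * b\<^sup>2) = p * a * b" if "0 \<le> p" "0 \<le> a" "0 \<le> b" for p a b :: real
        using that by (simp add: real_sqrt_mult)
      then show ?thesis by (simp add: prod_nonneg)
    qed
    finally show ?thesis .
  qed
  \<comment> \<open>This bound of the approximate unit only dominates the integrand in the limit;
    the final constant comes from \<open>U_bound\<close>.\<close>
  define D where "D = (\<Prod>i=1..m. 27 * (2 / (1 - sin (\<gamma> i))) ^ 3)"
  have U_le: "cmod (U N z) \<le> D" if z: "z \<in> stolz_prod m \<gamma>" for N z
    unfolding U_def D_def prod_norm[symmetric]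
  proof (intro prod_mono conjI norm_ge_zero)
    fix i assume i: "i \<in> {1..m}"
    have "z i \<in> stolz (\<gamma> i)" using z i unfolding stolz_prod_def by (rule PiE_mem)
    then show "cmod (approx_unit N (z i)) \<le> 27 * (2 / (1 - sin (\<gamma> i))) ^ 3" by (rule cmod_approx_unit_le[OF _ \<gamma>_angle[OF i]])
  qed
  have U_lim: "(\<lambda>N. U N z) \<longlonglongrightarrow> 1" if z: "z \<in> stolz_prod m \<gamma>" for z
  proof -
    have "(\<lambda>N. U N z) \<longlonglongrightarrow> (\<Prod>i=1..m. 1)"
      unfolding U_def by (intro tendsto_prod approx_unit_tendsto stolz_prod_cmod_less[OF z])
    then show ?thesis by simp
  qed
  have UH: "(\<lambda>z. \<phi> z * U N z) \<in> H0_infty m \<gamma>" for N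
  proof (rule H0_infty_mult[OF \<phi> _ U_le])
    show "holomorphic_on_stolz_prod (U N) m \<gamma>"
      unfolding U_def
      by (intro holomorphic_on_stolz_prod_prod holomorphic_on_stolz_prod_coordinate approx_unit_holomorphic)
  qed
  have "(\<lambda>N. form (\<lambda>z. \<phi> z * U N z) x y) \<longlonglongrightarrow> form \<phi> x y"
    unfolding form_def
  proof (rule integral_dominated_convergence)
    show "(\<lambda>t. \<phi> (curve t) * velocity t * cinner (resolvent_prod m (curve t) T x) y) \<in> borel_measurable cube"
      by (rule borel_measurable_integrable[OF form_integrable[OF \<phi>]])
    show "(\<lambda>t. \<phi> (curve t) * U N (curve t) * velocity t * cinner (resolvent_prod m (curve t) T x) y) \<in> borel_measurable cube" for N
      by (rule borel_measurable_integrable[OF form_integrable[OF UH]])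
    show "integrable cube (\<lambda>t. D * norm (\<phi> (curve t) * velocity t * cinner (resolvent_prod m (curve t) T x) y))"
      by (intro integrable_mult_right integrable_norm form_integrable \<phi>)
    show "AE t in cube. (\<lambda>N. \<phi> (curve t) * U N (curve t) * velocity t * cinner (resolvent_prod m (curve t) T x) y)
        \<longlonglongrightarrow> \<phi> (curve t) * velocity t * cinner (resolvent_prod m (curve t) T x) y"
    proof (rule AE_I2)
      fix t assume t: "t \<in> space cube"
      have "(\<lambda>N. \<phi> (curve t) * U N (curve t) * velocity t * cinner (resolvent_prod m (curve t) T x) y)
        \<longlonglongrightarrow> \<phi> (curve t) * 1 * velocity t * cinner (resolvent_prod m (curve t) T x) y"
        by (intro tendsto_mult tendsto_const U_lim curve_in_stolz_prod t)
      then show "(\<lambda>N. \<phi> (curve t) * U N (curve t) * velocity t * cinner (resolvent_prod m (curve t) T x) y)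
        \<longlonglongrightarrow> \<phi> (curve t) * velocity t * cinner (resolvent_prod m (curve t) T x) y" by simp
    qed
    show "AE t in cube. norm (\<phi> (curve t) * U N (curve t) * velocity t * cinner (resolvent_prod m (curve t) T x) y)
        \<le> D * norm (\<phi> (curve t) * velocity t * cinner (resolvent_prod m (curve t) T x) y)" for N
    proof (rule AE_I2)
      fix t assume t: "t \<in> space cube"
      have "cmod (U N (curve t)) * norm (\<phi> (curve t) * velocity t * cinner (resolvent_prod m (curve t) T x) y)
          \<le> D * norm (\<phi> (curve t) * velocity t * cinner (resolvent_prod m (curve t) T x) y)"
        by (intro mult_right_mono U_le curve_in_stolz_prod t) simp
      then show "norm (\<phi> (curve t) * U N (curve t) * velocity t * cinner (resolvent_prod m (curve t) T x) y)
        \<le> D * norm (\<phi> (curve t) * velocity t * cinner (resolvent_prod m (curve t) T x) y)"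
        unfolding norm_mult by (simp only: mult_ac)
    qed
  qed
  then have "cmod (form \<phi> x y) \<le> K * (\<Prod>i=1..m. (M i)\<^sup>2) * norm x * norm y"
    by (intro Lim_bounded[OF tendsto_norm]) (use U_bound in auto)
  then show ?thesis by (simp only: K_def)
qed

end

text \<open>The type announced is \<alpha>, while the resolvent bound is taken at a smaller
  \<open>\<alpha>'\<close>. All contours with angles between \<alpha> and \<gamma> thus share the
  same resolvent constants, as the uniform estimate requires.\<close>

lemma square_op_joint_bounded_calculus:
  fixes T :: "nat \<Rightarrow> 'a::complex_hilbert_space \<Rightarrow>\<^sub>L 'a"
  assumes ritt: "\<And>i. i \<in> {1..m} \<Longrightarrow> ritt (T i)" and sq: "\<And>i. i \<in> {1..m} \<Longrightarrow> square_op (T i)"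
    and comm: "\<And>i j. i \<in> {1..m} \<Longrightarrow> j \<in> {1..m} \<Longrightarrow> op_commute (T i) (T j)"
  shows "joint_bounded_calculus m T"
proof -
  have "\<exists>\<alpha>' \<alpha> \<gamma> C M. ritt_of_type \<alpha> (T i) \<and> \<alpha>' < \<alpha> \<and> \<alpha> < \<gamma> \<and> \<gamma> < pi/2 \<and> resolvent_bound \<alpha>' C (T i) \<and>
      square_function_bounded M (T i) \<and> square_function_bounded M (adj (T i))" if i: "i \<in> {1..m}" for i
  proof -
    obtain \<alpha>0 where T: "ritt_of_type \<alpha>0 (T i)" using ritt[OF i] unfolding ritt_def by blast
    then have "\<alpha>0 < pi/2" unfolding ritt_of_type_def by auto
    then obtain \<alpha>' where \<alpha>': "\<alpha>0 < \<alpha>'" "\<alpha>' < pi/2" using dense by blast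
    obtain \<alpha> where \<alpha>: "\<alpha>' < \<alpha>" "\<alpha> < pi/2" using dense \<alpha>' by blast
    obtain \<gamma> where \<gamma>: "\<alpha> < \<gamma>" "\<gamma> < pi/2" using dense \<alpha> by blast
    obtain C where C: "resolvent_bound \<alpha>' C (T i)" using ritt_of_type_resolvent_bound[OF T \<alpha>'] by blast
    have "ritt_of_type \<alpha> (T i)" by (rule ritt_of_type_mono[OF T]) (use \<alpha>' \<alpha> in auto)
    moreover obtain M where "square_function_bounded M (T i)" "square_function_bounded M (adj (T i))"
      using sq[OF i] unfolding square_op_def by blast
    ultimately show ?thesis using \<alpha> \<gamma> C by blast
  qed
  then obtain \<alpha>' \<alpha> \<gamma> C M where par: "\<And>i. i \<in> {1..m} \<Longrightarrow> ritt_of_type (\<alpha> i) (T i) \<and> \<alpha>' i < \<alpha> i \<and> \<alpha> i < \<gamma> i \<and> \<gamma> i < pi/2 \<and>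
      resolvent_bound (\<alpha>' i) (C i) (T i) \<and> square_function_bounded (M i) (T i) \<and> square_function_bounded (M i) (adj (T i))"
    by metis
  define K where "K = (\<Prod>i=1..m. 1728 * C i / (1 - sin (\<gamma> i))) * (\<Prod>i=1..m. (M i)\<^sup>2)"
  have K0: "0 \<le> K"
  proof -
    have "0 \<le> 1728 * C i / (1 - sin (\<gamma> i))" if i: "i \<in> {1..m}" for i
      using par[OF i] resolvent_bound_basic(3)[of "\<alpha>' i" "C i" "T i"] by simp
    then show ?thesis unfolding K_def by (intro mult_nonneg_nonneg prod_nonneg) auto
  qed
  have main: "norm (joint_calculus m \<beta> T \<phi>) \<le> (K + 1) * (SUP z\<in>stolz_prod m \<gamma>. cmod (\<phi> z))"
    if \<phi>: "\<phi> \<in> H0_infty m \<gamma>" and \<beta>: "\<And>i. i \<in> {1..m} \<Longrightarrow> \<beta> i \<in> {\<alpha> i<..<\<gamma> i}" for \<phi> \<beta>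
  proof -
    interpret stolz_calculus m T \<alpha>' \<beta> \<gamma> C
    proof
      fix i assume i: "i \<in> {1..m}"
      show "resolvent_bound (\<alpha>' i) (C i) (T i)" using par[OF i] by blast
      show "\<alpha>' i < \<beta> i \<and> \<beta> i < \<gamma> i \<and> \<gamma> i < pi/2" using par[OF i] \<beta>[OF i] by auto
    qed (rule comm)
    define B where "B = (SUP z\<in>stolz_prod m \<gamma>. cmod (\<phi> z))"
    have "bounded (\<phi> ` stolz_prod m \<gamma>)" using \<phi> unfolding H0_infty_def by blast
    then have bdd: "bdd_above ((\<lambda>z. cmod (\<phi> z)) ` stolz_prod m \<gamma>)"
      unfolding bounded_iff by (auto simp: bdd_above_def)
    have B: "cmod (\<phi> z) \<le> B" if "z \<in> stolz_prod m \<gamma>" for z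
      unfolding B_def by (rule cSUP_upper[OF that bdd])
    have "(\<lambda>i\<in>{1..m}. 1/2) \<in> space cube"
      unfolding space_cube by (intro restrict_PiE_iff[THEN iffD2]) auto
    then have B0: "0 \<le> B" using B[OF curve_in_stolz_prod] order_trans[OF norm_ge_zero] by blast
    have "norm (joint_calculus m \<beta> T \<phi>) \<le> K * B"
    proof (rule norm_blinfun_le_cinner)
      show "0 \<le> K * B" using K0 B0 by simp
      fix x y
      have "cmod (cinner (joint_calculus m \<beta> T \<phi> x) y) = (1 / (2 * pi)) ^ m * cmod (form \<phi> x y)"
        unfolding joint_calculus_form[OF \<phi>] norm_mult norm_power by (simp add: norm_divide norm_mult)
      also have "\<dots> \<le> 1 * cmod (form \<phi> x y)"
        using pi_ge_two by (intro mult_right_mono power_le_one) auto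
      also have "\<dots> \<le> B * (\<Prod>i=1..m. 1728 * C i / (1 - sin (\<gamma> i))) * (\<Prod>i=1..m. (M i)\<^sup>2) * norm x * norm y"
        unfolding mult_1 by (rule form_square_function_bound[OF _ _ \<phi> B0 B]) (use par in blast)+
      also have "\<dots> = K * B * norm x * norm y" by (simp add: K_def)
      finally show "cmod (cinner (joint_calculus m \<beta> T \<phi> x) y) \<le> K * B * norm x * norm y" .
    qed
    also have "\<dots> \<le> (K + 1) * B" using B0 by (simp add: distrib_right)
    finally show ?thesis unfolding B_def .
  qed
  show ?thesis
    unfolding joint_bounded_calculus_def
  proof (intro exI conjI ballI allI impI)
    show "ritt_of_type (\<alpha> i) (T i)" "\<gamma> i \<in> {\<alpha> i<..<pi/2}" if "i \<in> {1..m}" for i using par[OF that] by auto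
    show "0 < K + 1" using K0 by simp
    show "norm (joint_calculus m \<beta> T \<phi>) \<le> (K + 1) * (SUP z\<in>stolz_prod m \<gamma>. cmod (\<phi> z))"
      if "\<phi> \<in> H0_infty m \<gamma>" "\<forall>i\<in>{1..m}. \<beta> i \<in> {\<alpha> i<..<\<gamma> i}" for \<phi> \<beta>
      using main that by blast
  qed
qed

theorem theorem2p12:
  fixes T :: "nat \<Rightarrow> 'a::complex_hilbert_space \<Rightarrow>\<^sub>L 'a" and n :: nat
  assumes "\<And>i. i \<in> {1..n} \<Longrightarrow> ritt (T i)"
    and "\<And>i j. i \<in> {1..n} \<Longrightarrow> j \<in> {1..n} \<Longrightarrow> op_commute (T i) (T j)"
  shows "((\<forall>i\<in>{1..n}. similar_to_contraction (T i)) \<longleftrightarrow>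
      (\<forall>k\<in>{1..n}. \<forall>\<iota>. \<iota> \<in> {1..k} \<rightarrow> {1..n} \<and> strict_mono_on {1..k} \<iota> \<longrightarrow>
        joint_bounded_calculus k (\<lambda>j. T (\<iota> j)))) \<and>
    ((\<forall>i\<in>{1..n}. similar_to_contraction (T i)) \<longleftrightarrow>
      (\<exists>S\<in>bounded_ops. op_invertible S \<and>
        (\<forall>i\<in>{1..n}. op_contraction (op_conj S (T i))) \<and>
        (\<forall>i\<in>{1..n}. \<forall>j\<in>{1..n}. op_commute (op_conj S (T i)) (op_conj S (T j)))))"
    (is "(?similar \<longleftrightarrow> ?calculus) \<and> (?similar \<longleftrightarrow> ?joint)")
proof -
  have Tb: "T i \<in> bounded_ops" if "i \<in> {1..n}" for i
    using assms(1)[OF that] unfolding ritt_def ritt_of_type_def by blast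
  have similar_square: "\<forall>i\<in>{1..n}. square_op (T i)" if ?similar
  proof
    fix i assume i: "i \<in> {1..n}"
    obtain M where "\<And>k. real (Suc k) * norm (pdiff (T i) k) \<le> M" using ritt_pdiff_bound[OF assms(1)[OF i]] by blast
    then show "square_op (T i)" using similar_to_contraction_square_op[OF Tb[OF i]] that i by blast
  qed
  have square_joint: ?joint if "\<forall>i\<in>{1..n}. square_op (T i)"
  proof -
    have "\<exists>S\<in>bounded_ops. op_invertible S \<and> (\<forall>i\<in>{1..n}. op_contraction (op_conj S (T i)))"
      by (rule square_op_joint_similarity) (use that assms(2) in auto)
    then obtain S where S: "S \<in> bounded_ops" "op_invertible S" "\<And>i. i \<in> {1..n} \<Longrightarrow> op_contraction (op_conj S (T i))"
      by blast
    have "op_commute (op_conj S (T i)) (op_conj S (T j))" if "i \<in> {1..n}" "j \<in> {1..n}" for i j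
      using assms(2)[OF that] unfolding op_commute_def by (simp add: op_conj_compose[OF S(2)])
    then show ?thesis using S by blast
  qed
  have joint_similar: ?similar if ?joint
    using that unfolding similar_to_contraction_def by blast
  have square_calculus: ?calculus if "\<forall>i\<in>{1..n}. square_op (T i)"
  proof (intro ballI allI impI)
    fix k \<iota> assume "k \<in> {1..n}" and \<iota>: "\<iota> \<in> {1..k} \<rightarrow> {1..n} \<and> strict_mono_on {1..k} \<iota>"
    then have mem: "\<iota> j \<in> {1..n}" if "j \<in> {1..k}" for j using that by blast
    show "joint_bounded_calculus k (\<lambda>j. T (\<iota> j))"
      by (rule square_op_joint_bounded_calculus) (use assms mem that in blast)+
  qed
  have calculus_square: "\<forall>i\<in>{1..n}. square_op (T i)" if ?calculus
  proof
    fix i assume i: "i \<in> {1..n}"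
    then have "1 \<in> {1..n}" by simp
    \<comment> \<open>A tuple of length one is selected by the constant map, which is vacuously
      strictly monotone on a single index.\<close>
    moreover have "(\<lambda>_. i) \<in> {1..1} \<rightarrow> {1..n} \<and> strict_mono_on {1..1::nat} (\<lambda>_. i)"
      using i by (auto simp: strict_mono_on_def)
    ultimately have "joint_bounded_calculus 1 (\<lambda>_. T i)" using that by blast
    then show "square_op (T i)" by (rule calculus_imp_square_op)
  qed
  show ?thesis
    using similar_square square_joint joint_similar square_calculus calculus_square by blast
qed

end
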